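(* Let $a\in(\mathbb{C}^* )^n$ and let $B\in\mathbb{C}^{n\times n}$ be symmetric, and suppose the vertex coloring model $(a,B)$ is twin free. Let $U$ be a nondegenerate $k\times n$ complex matrix with columns $u_1,\ldots,u_n$ such that $U^TU=B$. Then the following are equivalent: (i) $p_{a,B}=p_y$ (as functions on $\mathcal{G}$) for some real edge coloring model $y$; (ii) there exist $l\geq k$ and $g\in O_l(\mathbb{C})$ such that the set $\left\{\begin{pmatrix} gu_i\\ a_i\end{pmatrix}\;\middle|\; i=1,\ldots,n\right\}\subseteq\mathbb{C}^{l+1}$ is closed under complex conjugation; (iii) there exist $l\geq k$ and $g\in O_l(\mathbb{C})$ such that the $l$-color edge coloring model $\sum_{i=1}^n a_i\,\mathrm{ev}_{gu_i}$ is real. If moreover $UU^*\in\mathbb{R}^{k\times k}$, then one can take $g$ equal to the identity in (ii) and (iii).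
   Context: $\mathcal{G}$ is the set of all finite graphs, multiple edges and loops allowed. For $a\in(\mathbb{C}^* )^n$ ($\mathbb{C}^*=\mathbb{C}\setminus\{0\}$) and symmetric $B\in\mathbb{C}^{n\times n}$, the pair $(a,B)$ is an $n$-color vertex coloring model with partition function $p_{a,B}(H)=\sum_{\phi:V(H)\to[n]}\prod_{v\in V(H)}a_{\phi(v)}\prod_{uv\in E(H)}B_{\phi(u),\phi(v)}$. Indices $i\ne j$ are twins of $(a,B)$ if the $i$th and $j$th rows of $B$ are equal; $(a,B)$ is twin free if it has no twins. A $k$-color edge coloring model is a linear functional $h$ on $R(\mathbb{C})=\mathbb{C}[x_1,\ldots,x_k]$; it is real if $h(p)\in\mathbb{R}$ for all $p\in\mathbb{R}[x_1,\ldots,x_k]$ (a real edge coloring model is a real $k$-color model for some $k$). Its partition function is $p_h(G)=\sum_{\phi:E(G)\to[k]}\prod_{v\in V(G)}h\big(\prod_{e\in\delta(v)}x_{\phi(e)}\big)$, where $\delta(v)$ is the multiset of edges incident with $v$, a loop counted twice. For $u\in\mathbb{C}^k$, $\mathrm{ev}_u$ is the functional $p\mapsto p(u)$. A $k\times n$ matrix $U$ is nondegenerate if the span of its columns is nondegenerate for the standard bilinear form $(x,y)=\sum_i x_iy_i$ on $\mathbb{C}^k$, i.e. $\mathrm{rk}(U^TU)=\mathrm{rk}(U)$. $O_l(\mathbb{C})=\{g\in\mathbb{C}^{l\times l}:(gv,gv)=(v,v)\ \forall v\}$; vectors in $\mathbb{C}^k$ are regarded as vectors in $\mathbb{C}^l$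 ($l\ge k$) by appending zeros. $U^*$ is the conjugate transpose. *)

theory Defs
  imports
    "HOL-Library.Poly_Mapping"
    "HOL-Library.FuncSet"
    "Jordan_Normal_Form.VS_Connect"
    "Jordan_Normal_Form.Schur_Decomposition"
begin

section \<open>Finite graphs with loops and multiple edges\<close>

text \<open>
  The two ends of an edge are listed in an arbitrary order, which carries no
  information: both partition functions below are insensitive to it (for
  the vertex coloring models because \<open>B\<close> is symmetric). Graphs on
  natural numbers represent all finite graphs up to isomorphism.
\<close>

record mgraph =
  verts :: "nat set"
  edges :: "nat set"
  ends :: "nat \<Rightarrow> nat \<times> nat"

definition finite_graphs :: "mgraph set" where
  "finite_graphs = {G. finite (verts G) \<and> finite (edges G) \<and>
     (\<forall>e\<in>edges G. ends G e \<in> verts G \<times> verts G)}"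

text \<open>A loop at \<open>v\<close> occurs twice in \<open>incident_edges G v\<close>.\<close>

definition incident_edges :: "mgraph \<Rightarrow> nat \<Rightarrow> nat multiset" where
  "incident_edges G v =
     filter_mset (\<lambda>e. fst (ends G e) = v) (mset_set (edges G)) +
     filter_mset (\<lambda>e. snd (ends G e) = v) (mset_set (edges G))"


section \<open>Vertex coloring models\<close>

text \<open>Colors are \<open>0, \<dots>, n - 1\<close>.\<close>

definition vertex_coloring_model :: "nat \<Rightarrow> complex vec \<Rightarrow> complex mat \<Rightarrow> bool" where
  "vertex_coloring_model n a B \<longleftrightarrow>
     a \<in> carrier_vec n \<and> (\<forall>i<n. a $ i \<noteq> 0) \<and> B \<in> carrier_mat n n \<and> transpose_mat B = B"

definition twins :: "complex mat \<Rightarrow> nat \<Rightarrow> nat \<Rightarrow> bool" where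
  "twins B i j \<longleftrightarrow> i \<noteq> j \<and> row B i = row B j"

definition twin_free :: "nat \<Rightarrow> complex vec \<Rightarrow> complex mat \<Rightarrow> bool" where
  "twin_free n a B \<longleftrightarrow> \<not> (\<exists>i<n. \<exists>j<n. twins B i j)"

definition vertex_partition_function ::
    "nat \<Rightarrow> complex vec \<Rightarrow> complex mat \<Rightarrow> mgraph \<Rightarrow> complex" where
  "vertex_partition_function n a B H =
     (\<Sum>\<phi>\<in>verts H \<rightarrow>\<^sub>E {..<n}.
        (\<Prod>v\<in>verts H. a $ \<phi> v) *
        (\<Prod>e\<in>edges H. B $$ (\<phi> (fst (ends H e)), \<phi> (snd (ends H e)))))"


section \<open>Edge coloring models\<close>

text \<open>
  A polynomial maps exponent vectors (finitely supported functions from variable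
  indices to exponents) to coefficients; the polynomial ring in \<open>k\<close> variables
  consists of those in which only the variables \<open>0, \<dots>, k - 1\<close> occur.
\<close>

type_synonym cpoly = "(nat \<Rightarrow>\<^sub>0 nat) \<Rightarrow>\<^sub>0 complex"

definition polys :: "nat \<Rightarrow> cpoly set" where
  "polys k = {p. \<forall>m\<in>Poly_Mapping.keys p. Poly_Mapping.keys m \<subseteq> {..<k}}"

definition real_polys :: "nat \<Rightarrow> cpoly set" where
  "real_polys k = {p\<in>polys k. \<forall>m. Poly_Mapping.lookup p m \<in> \<real>}"

definition const_poly :: "complex \<Rightarrow> cpoly" where
  "const_poly c = Poly_Mapping.single 0 c"

definition var_poly :: "nat \<Rightarrow> cpoly" where
  "var_poly i = Poly_Mapping.single (Poly_Mapping.single i 1) 1"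

text \<open>The values of \<open>h\<close> outside \<open>polys k\<close> are irrelevant.\<close>

definition edge_coloring_model :: "nat \<Rightarrow> (cpoly \<Rightarrow> complex) \<Rightarrow> bool" where
  "edge_coloring_model k h \<longleftrightarrow>
     (\<forall>p\<in>polys k. \<forall>q\<in>polys k. h (p + q) = h p + h q) \<and>
     (\<forall>c. \<forall>p\<in>polys k. h (const_poly c * p) = c * h p)"

definition real_edge_coloring_model :: "nat \<Rightarrow> (cpoly \<Rightarrow> complex) \<Rightarrow> bool" where
  "real_edge_coloring_model k h \<longleftrightarrow>
     edge_coloring_model k h \<and> (\<forall>p\<in>real_polys k. h p \<in> \<real>)"

definition edge_partition_function ::
    "nat \<Rightarrow> (cpoly \<Rightarrow> complex) \<Rightarrow> mgraph \<Rightarrow> complex" where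
  "edge_partition_function k h G =
     (\<Sum>\<phi>\<in>edges G \<rightarrow>\<^sub>E {..<k}.
        \<Prod>v\<in>verts G. h (\<Prod>e\<in>#incident_edges G v. var_poly (\<phi> e)))"

definition ev :: "complex vec \<Rightarrow> cpoly \<Rightarrow> complex" where
  "ev u p = (\<Sum>m\<in>Poly_Mapping.keys p. Poly_Mapping.lookup p m *
     (\<Prod>i\<in>Poly_Mapping.keys m. (u $ i) ^ Poly_Mapping.lookup m i))"


section \<open>Nondegenerate matrices and the complex orthogonal group\<close>

text \<open>
  The product \<open>x \<bullet> y\<close> of vectors is the bilinear form, without complex conjugation.
\<close>

definition nondegenerate_mat :: "complex mat \<Rightarrow> bool" where
  "nondegenerate_mat U \<longleftrightarrow>
     (\<forall>x\<in>vec_space.col_space (dim_row U) U.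
        (\<forall>y\<in>vec_space.col_space (dim_row U) U. x \<bullet> y = 0) \<longrightarrow> x = 0\<^sub>v (dim_row U))"

definition complex_orthogonal_group :: "nat \<Rightarrow> complex mat set" where
  "complex_orthogonal_group l =
     {g\<in>carrier_mat l l. \<forall>v\<in>carrier_vec l. (g *\<^sub>v v) \<bullet> (g *\<^sub>v v) = v \<bullet> v}"

definition pad_vec :: "nat \<Rightarrow> complex vec \<Rightarrow> complex vec" where
  "pad_vec l u = u @\<^sub>v 0\<^sub>v (l - dim_vec u)"

definition closed_under_conjugation :: "complex vec set \<Rightarrow> bool" where
  "closed_under_conjugation S \<longleftrightarrow> (\<forall>w\<in>S. conjugate w \<in> S)"

definition extended_columns ::
    "nat \<Rightarrow> complex vec \<Rightarrow> complex mat \<Rightarrow> nat \<Rightarrow> complex mat \<Rightarrow> complex vec set" where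
  "extended_columns n a U l g =
     {(g *\<^sub>v pad_vec l (col U i)) @\<^sub>v vec 1 (\<lambda>_. a $ i) | i. i < n}"

definition evaluation_model ::
    "nat \<Rightarrow> complex vec \<Rightarrow> complex mat \<Rightarrow> nat \<Rightarrow> complex mat \<Rightarrow> cpoly \<Rightarrow> complex" where
  "evaluation_model n a U l g p = (\<Sum>i<n. a $ i * ev (g *\<^sub>v pad_vec l (col U i)) p)"

definition real_mat :: "complex mat \<Rightarrow> bool" where
  "real_mat A \<longleftrightarrow> elements_mat A \<subseteq> \<real>"

end

theory Submission
  imports Defs
begin

text \<open>
  For a real edge coloring model \<open>y\<close> with the partition function of \<open>(a, B)\<close>, every linear combination
  of graphs with open ends has an associated tensor. Gluing it to its complex conjugate expresses the norm
  of the tensor for \<open>y\<close> through closed graphs, so a combination whose tensor vanishes for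
  \<open>\<Sum>\<^sub>i a\<^sub>i ev\<^bsub>u\<^sub>i\<^esub>\<close> has vanishing tensor for \<open>y\<close> too. Consider \<open>n\<close> vertices weighted by the indicator
  polynomial of the event that their Gram matrix is \<open>B\<close>. Multiplication by the coordinates of these vertices
  acts on the resulting nonzero functional with annihilating polynomials, because any further vertex
  coincides with one of the \<open>n\<close> vertices. A joint eigenvector gives points \<open>w\<^sub>i\<close> with Gram matrix \<open>B\<close> and
  \<open>y = \<Sum>\<^sub>i b\<^sub>i ev\<^bsub>w\<^sub>i\<^esub>\<close>; comparing closed graphs, \<open>b = a\<close> up to an automorphism of \<open>B\<close>. Reality of \<open>y\<close> and
  independence of evaluations make the pairs \<open>(w\<^sub>i, a\<^sub>i)\<close> closed under conjugation, and Witt's theorem moves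
  \<open>u\<^sub>i\<close> to \<open>w\<^sub>i\<close>.
\<close>

text \<open>Closed graphs see only invariants of the orthogonal group, and over the complex numbers
  these do not force \<open>y\<close> to be a sum of evaluations: for \<open>n = 1\<close>,
  \<open>a = 1\<close>, \<open>B = 0\<close>, the functional with values 1, 1, i on the monomials 1,
  x_1, x_2 and 0 on all others has the partition function of ev_0, since its linear part is
  isotropic, yet it is no such sum. Reality removes this obstacle, because a real tensor of norm
  zero is zero. Nothing bounds the degree of \<open>y\<close>, and its number of colors is unrelated
  to \<open>k\<close>. A polynomial annihilating a coordinate must therefore come from the graphs:
  it is the product of the \<open>n\<close> differences between that coordinate of an additional
  vertex and those of the \<open>n\<close> vertices, read as a polynomial in the additional one.
  Witt's theorem needs both spans to be nondegenerate. For the w_i this is positivity again: a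
  vector of a conjugation closed span that is orthogonal to the span is Hermitian orthogonal to
  itself.\<close>

subsection \<open>Contracting edges of a vertex tensor\<close>

type_synonym functional = "(nat \<times> nat) multiset \<Rightarrow> complex"

definition monomial_value :: "(cpoly \<Rightarrow> complex) \<Rightarrow> nat multiset \<Rightarrow> complex" where
  "monomial_value y \<mu> = y (\<Prod>c\<in>#\<mu>. var_poly c)"

text \<open>A functional maps monomials in the variables \<open>x\<^bsub>v,c\<^esub>\<close>, encoded as multisets of pairs \<open>(v, c)\<close>,
  to their values. The tensor power of \<open>Y\<close> is made \<open>0\<close> on monomials outside the range, so that
  identities between functionals hold without side conditions.\<close>

definition vertex_tensor :: "nat \<Rightarrow> (nat multiset \<Rightarrow> complex) \<Rightarrow> nat set \<Rightarrow> functional" where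
  "vertex_tensor m Y V N = (if set_mset N \<subseteq> V \<times> {..<m}
     then \<Prod>v\<in>V. Y (image_mset snd (filter_mset (\<lambda>x. fst x = v) N)) else 0)"

definition contract_edge :: "nat \<Rightarrow> nat \<times> nat \<Rightarrow> functional \<Rightarrow> functional" where
  "contract_edge m e L N = (\<Sum>c<m. L (N + {#(fst e, c), (snd e, c)#}))"

definition contract :: "nat \<Rightarrow> (nat \<times> nat) list \<Rightarrow> functional \<Rightarrow> functional" where
  "contract m E = foldr (contract_edge m) E"

lemma contract_Nil [simp]: "contract m [] L = L"
  by (simp add: contract_def)

lemma contract_Cons: "contract m (e # E) L N = (\<Sum>c<m. contract m E L (N + {#(fst e, c), (snd e, c)#}))"
  by (simp add: contract_def contract_edge_def)

lemma contract_append: "contract m (E @ F) L = contract m E (contract m F L)"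
  by (simp add: contract_def)

lemma contract_shift: "contract m E (\<lambda>N. L (N + M)) N = contract m E L (N + M)"
  by (induction E arbitrary: N) (simp_all add: contract_Cons add_ac)

lemma contract_add: "contract m E (\<lambda>N. L N + L' N) N = contract m E L N + contract m E L' N"
  by (induction E arbitrary: N) (simp_all add: contract_Cons sum.distrib)

lemma contract_cmult: "contract m E (\<lambda>N. k * L N) N = k * contract m E L N"
  by (induction E arbitrary: N) (simp_all add: contract_Cons sum_distrib_left)

text \<open>A contraction evaluates \<open>L\<close> only at multisets containing
  \<open>N\<close>.\<close>

lemma contract_eq_0:
  assumes "\<And>M. L (N + M) = 0"
  shows "contract m E L N = 0"
  using assms
proof (induction E arbitrary: N)
  case Nil
  show ?case using Nil[of "{#}"] by simp
next
  case (Cons e E)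
  have "contract m E L (N + {#(fst e, c), (snd e, c)#}) = 0" for c
    using Cons.prems by (intro Cons.IH) (simp only: add.assoc)
  then show ?case by (simp only: contract_Cons sum.neutral_const)
qed

lemma contract_map_PiE:
  fixes en :: "nat \<Rightarrow> nat \<times> nat"
  assumes "distinct es"
  shows "contract m (map en es) L N = (\<Sum>\<phi>\<in>set es \<rightarrow>\<^sub>E {..<m}.
    L (N + (\<Sum>e\<leftarrow>es. {#(fst (en e), \<phi> e), (snd (en e), \<phi> e)#})))"
  using assms
proof (induction es arbitrary: N)
  case Nil
  then show ?case by simp
next
  case (Cons x es)
  let ?t = "\<lambda>\<phi> e. {#(fst (en e), \<phi> e), (snd (en e), \<phi> e)#}"
  have "(\<Sum>\<phi>\<in>set (x # es) \<rightarrow>\<^sub>E {..<m}. L (N + (\<Sum>e\<leftarrow>x # es. ?t \<phi> e))) =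
     (\<Sum>(c, \<phi>)\<in>{..<m} \<times> (set es \<rightarrow>\<^sub>E {..<m}). L (N + (\<Sum>e\<leftarrow>x # es. ?t (\<phi>(x := c)) e)))"
    unfolding list.set PiE_insert_eq using Cons.prems
    by (subst sum.reindex[OF inj_combinator]) (simp_all add: case_prod_unfold)
  also have "\<dots> = (\<Sum>(c, \<phi>)\<in>{..<m} \<times> (set es \<rightarrow>\<^sub>E {..<m}). L (N + {#(fst (en x), c), (snd (en x), c)#} + (\<Sum>e\<leftarrow>es. ?t \<phi> e)))"
  proof (rule sum.cong[OF refl], clarify)
    fix c :: nat and \<phi> :: "nat \<Rightarrow> nat"
    have m: "map (?t (\<phi>(x := c))) es = map (?t \<phi>) es" using Cons.prems by auto
    show "L (N + (\<Sum>e\<leftarrow>x # es. ?t (\<phi>(x := c)) e)) = L (N + {#(fst (en x), c), (snd (en x), c)#} + (\<Sum>e\<leftarrow>es. ?t \<phi> e))"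
      unfolding list.map(2) m by (simp only: sum_list.Cons fun_upd_same add.assoc)
  qed
  also have "\<dots> = (\<Sum>c<m. \<Sum>\<phi>\<in>set es \<rightarrow>\<^sub>E {..<m}. L (N + {#(fst (en x), c), (snd (en x), c)#} + (\<Sum>e\<leftarrow>es. ?t \<phi> e)))"
    by (simp add: sum.cartesian_product)
  also have "\<dots> = contract m (map en (x # es)) L N"
    using Cons by (simp add: contract_Cons)
  finally show ?case ..
qed

text \<open>Expanding every edge contraction at the empty monomial gives one term per edge coloring.
  Both half-edges of an edge receive its color, so a loop counts twice at its vertex, as in
  \<open>incident_edges\<close>.\<close>

lemma edge_partition_function_eq_contract:
  assumes "G \<in> finite_graphs" "distinct es" "set es = edges G"
  shows "edge_partition_function m y G =
    contract m (map (ends G) es) (vertex_tensor m (monomial_value y) (verts G)) {#}"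
proof -
  have en: "ends G e \<in> verts G \<times> verts G" if "e \<in> set es" for e
    using assms that by (auto simp: finite_graphs_def)
  have inc: "incident_edges G v = filter_mset (\<lambda>e. fst (ends G e) = v) (mset es) +
     filter_mset (\<lambda>e. snd (ends G e) = v) (mset es)" for v
    using assms unfolding incident_edges_def by (metis mset_set_set)
  have f: "image_mset snd (filter_mset (\<lambda>x. fst x = v) (\<Sum>e\<leftarrow>fs. {#(fst (ends G e), \<phi> e), (snd (ends G e), \<phi> e)#}))
    = image_mset \<phi> (filter_mset (\<lambda>e. fst (ends G e) = v) (mset fs) + filter_mset (\<lambda>e. snd (ends G e) = v) (mset fs))" for v fs and \<phi> :: "nat \<Rightarrow> nat"
    by (induction fs) auto
  have r: "set_mset (\<Sum>e\<leftarrow>fs. {#(fst (ends G e), \<phi> e), (snd (ends G e), \<phi> e)#}) \<subseteq> verts G \<times> {..<m}"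
    if "set fs \<subseteq> set es" "\<phi> \<in> set es \<rightarrow>\<^sub>E {..<m}" for fs \<phi>
    using that(1)
  proof (induction fs)
    case (Cons e fs)
    then show ?case using en[of e] that(2) by (auto simp: PiE_iff mem_Times_iff)
  qed simp
  show ?thesis
    unfolding contract_map_PiE[OF assms(2)] edge_partition_function_def assms(3)[symmetric]
  proof (rule sum.cong[OF refl])
    fix \<phi> assume "\<phi> \<in> set es \<rightarrow>\<^sub>E {..<m}"
    then show "(\<Prod>v\<in>verts G. y (\<Prod>e\<in>#incident_edges G v. var_poly (\<phi> e))) =
      vertex_tensor m (monomial_value y) (verts G) ({#} + (\<Sum>e\<leftarrow>es. {#(fst (ends G e), \<phi> e), (snd (ends G e), \<phi> e)#}))"
      using r[of es \<phi>] by (simp add: vertex_tensor_def f inc monomial_value_def image_mset.compositionality comp_def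
        del: image_mset_union)
  qed
qed

section \<open>Gluing graphs with open ends\<close>

definition color_lists :: "nat \<Rightarrow> nat \<Rightarrow> nat list set" where
  "color_lists m t = {c. set c \<subseteq> {..<m} \<and> length c = t}"

lemma finite_color_lists [simp]: "finite (color_lists m t)"
  by (simp add: color_lists_def finite_lists_length_eq)

lemma color_lists_0 [simp]: "color_lists m 0 = {[]}"
  by (auto simp: color_lists_def)

lemma sum_color_lists_Suc:
  "(\<Sum>c\<in>color_lists m (Suc t). f c) = (\<Sum>x<m. \<Sum>c\<in>color_lists m t. f (x # c))"
proof -
  have "(\<Sum>c\<in>color_lists m (Suc t). f c) = (\<Sum>(c, x)\<in>color_lists m t \<times> {..<m}. f (x # c))"
    unfolding color_lists_def lists_length_Suc_eq
    by (subst sum.reindex) (auto simp: inj_on_def case_prod_unfold)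
  also have "\<dots> = (\<Sum>c\<in>color_lists m t. \<Sum>x<m. f (x # c))"
    by (simp add: sum.cartesian_product)
  finally show ?thesis by (simp add: sum.swap[of _ "{..<m}"])
qed

text \<open>Edges joining the attachment vertices of corresponding open ends amount to a sum over
  the common colors of these ends.\<close>

lemma contract_zip:
  assumes "length \<tau> = length \<tau>'"
  shows "contract m (zip \<tau> \<tau>') L N =
    (\<Sum>c\<in>color_lists m (length \<tau>). L (N + mset (zip \<tau> c) + mset (zip \<tau>' c)))"
  using assms
proof (induction \<tau> \<tau>' arbitrary: N rule: list_induct2)
  case Nil
  then show ?case by simp
next
  case (Cons x xs y ys)
  then show ?case by (simp add: contract_Cons sum_color_lists_Suc add_ac add_mset_commute)
qed

definition shift_vertices :: "nat \<Rightarrow> (nat \<times> nat) multiset \<Rightarrow> (nat \<times> nat) multiset" where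
  "shift_vertices s = image_mset (map_prod ((+) s) id)"

text \<open>Every vertex sees the variables of its own component only; a color outside the range
  makes both sides 0.\<close>

lemma vertex_tensor_disjoint_union:
  assumes "fst ` set_mset N \<subseteq> {..<s}" "fst ` set_mset N' \<subseteq> {..<s'}"
  shows "vertex_tensor m Y {..<s + s'} (N + shift_vertices s N') =
    vertex_tensor m Y {..<s} N * vertex_tensor m Y {..<s'} N'"
proof -
  let ?f = "\<lambda>v N. Y (image_mset snd (filter_mset (\<lambda>x. fst x = v) N))"
  have r: "set_mset (N + shift_vertices s N') \<subseteq> {..<s + s'} \<times> {..<m} \<longleftrightarrow>
      set_mset N \<subseteq> {..<s} \<times> {..<m} \<and> set_mset N' \<subseteq> {..<s'} \<times> {..<m}"
    using assms by (fastforce simp: shift_vertices_def subset_iff mem_Times_iff)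
  have 1: "?f v (N + shift_vertices s N') = ?f v N" if "v < s" for v
  proof -
    have "filter_mset (\<lambda>x. fst x = v) (shift_vertices s N') = {#}"
      using that unfolding shift_vertices_def by (induction N') auto
    then show ?thesis by (simp del: filter_mset_eq_mempty_iff)
  qed
  have 2: "?f (s + v) (N + shift_vertices s N') = ?f v N'" for v
  proof -
    have "filter_mset (\<lambda>x. fst x = s + v) N = {#}"
      using assms(1) by (induction N) auto
    moreover have "image_mset snd (filter_mset (\<lambda>x. fst x = s + v) (shift_vertices s N')) = image_mset snd (filter_mset (\<lambda>x. fst x = v) N')"
      unfolding shift_vertices_def by (induction N') auto
    ultimately show ?thesis by (simp del: filter_mset_eq_mempty_iff)
  qed
  have "(\<Prod>v<s + s'. ?f v (N + shift_vertices s N')) = (\<Prod>v<s. ?f v N) * (\<Prod>v<s'. ?f v N')"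
  proof -
    have "(\<Prod>v<s + q. g v) = (\<Prod>v<s. g v) * (\<Prod>v<q. g (s + v))" for g :: "nat \<Rightarrow> complex" and q
      by (induction q) (simp_all add: mult_ac)
    moreover have "(\<Prod>v<s. ?f v (N + shift_vertices s N')) = (\<Prod>v<s. ?f v N)"
      by (rule prod.cong[OF refl]) (simp only: 1 lessThan_iff)
    ultimately show ?thesis by (simp only: 2)
  qed
  then show ?thesis using r by (auto simp: vertex_tensor_def)
qed

text \<open>\<open>L\<close> is an arbitrary functional that factors, so that in
  \<open>contract_glue\<close> it can be one that already carries the edges of the other
  component.\<close>

lemma contract_left_factor:
  assumes "\<And>N N'. fst ` set_mset N \<subseteq> {..<s} \<Longrightarrow> fst ` set_mset N' \<subseteq> {..<s'} \<Longrightarrow>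
      L (N + shift_vertices s N') = A N * B N'"
    and "set E \<subseteq> {..<s} \<times> {..<s}" "fst ` set_mset N \<subseteq> {..<s}" "fst ` set_mset N' \<subseteq> {..<s'}"
  shows "contract m E L (N + shift_vertices s N') = contract m E A N * B N'"
  using assms(2,3)
proof (induction E arbitrary: N)
  case Nil
  then show ?case using assms by simp
next
  case (Cons e E)
  have "contract m E L (N + shift_vertices s N' + {#(fst e, c), (snd e, c)#}) =
      contract m E A (N + {#(fst e, c), (snd e, c)#}) * B N'" for c
    using Cons.IH[of "N + {#(fst e, c), (snd e, c)#}"] Cons.prems
    by (auto simp: add_ac)
  then show ?case by (simp only: contract_Cons sum_distrib_right)
qed

lemma contract_right_factor:
  assumes "\<And>N N'. fst ` set_mset N \<subseteq> {..<s} \<Longrightarrow> fst ` set_mset N' \<subseteq> {..<s'} \<Longrightarrow>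
      L (N + shift_vertices s N') = A N * B N'"
    and "set E \<subseteq> {..<s'} \<times> {..<s'}" "fst ` set_mset N \<subseteq> {..<s}" "fst ` set_mset N' \<subseteq> {..<s'}"
  shows "contract m (map (map_prod ((+) s) ((+) s)) E) L (N + shift_vertices s N') = A N * contract m E B N'"
  using assms(2,4)
proof (induction E arbitrary: N')
  case Nil
  then show ?case using assms by simp
next
  case (Cons e E)
  have "contract m (map (map_prod ((+) s) ((+) s)) E) L (N + shift_vertices s N' + {#(s + fst e, c), (s + snd e, c)#}) =
      A N * contract m E B (N' + {#(fst e, c), (snd e, c)#})" for c
  proof -
    have "N + shift_vertices s N' + {#(s + fst e, c), (s + snd e, c)#} = N + shift_vertices s (N' + {#(fst e, c), (snd e, c)#})"
      by (simp add: shift_vertices_def)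
    then show ?thesis
      unfolding \<open>N + _ + _ = _\<close>
      using Cons.prems by (intro Cons.IH) (auto simp: mem_Times_iff)
  qed
  then show ?case by (simp add: contract_Cons sum_distrib_left)
qed

text \<open>The inner edges of each graph act on their own tensor factor, and the joining edges are
  summed last. The value of the glued graph is thus the standard bilinear pairing of two open
  tensors, which later expresses norms of tensors by closed graphs.\<close>

lemma contract_glue:
  assumes "set E \<subseteq> {..<s} \<times> {..<s}" "set E' \<subseteq> {..<s'} \<times> {..<s'}"
    and "set \<tau> \<subseteq> {..<s}" "set \<tau>' \<subseteq> {..<s'}" "length \<tau> = length \<tau>'"
  shows "contract m (zip \<tau> (map ((+) s) \<tau>') @ E @ map (map_prod ((+) s) ((+) s)) E')
      (vertex_tensor m Y {..<s + s'}) {#} =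
    (\<Sum>c\<in>color_lists m (length \<tau>). contract m E (vertex_tensor m Y {..<s}) (mset (zip \<tau> c)) *
       contract m E' (vertex_tensor m Y {..<s'}) (mset (zip \<tau>' c)))"
proof -
  let ?L = "contract m (map (map_prod ((+) s) ((+) s)) E') (vertex_tensor m Y {..<s + s'})"
  have 1: "?L (N + shift_vertices s N') = vertex_tensor m Y {..<s} N * contract m E' (vertex_tensor m Y {..<s'}) N'"
    if "fst ` set_mset N \<subseteq> {..<s}" "fst ` set_mset N' \<subseteq> {..<s'}" for N N'
    using that assms vertex_tensor_disjoint_union by (intro contract_right_factor) auto
  have 2: "contract m E ?L (N + shift_vertices s N') =
      contract m E (vertex_tensor m Y {..<s}) N * contract m E' (vertex_tensor m Y {..<s'}) N'"
    if "fst ` set_mset N \<subseteq> {..<s}" "fst ` set_mset N' \<subseteq> {..<s'}" for N N'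
    using that assms 1 by (intro contract_left_factor) auto
  have sh: "mset (zip (map ((+) s) xs) c) = shift_vertices s (mset (zip xs c))" for xs c
    by (simp add: shift_vertices_def zip_map1 map_prod_def id_def)
  have 3: "fst ` set_mset (mset (zip xs c)) \<subseteq> {..<q}" if "set xs \<subseteq> {..<q}" for xs :: "nat list" and c :: "nat list" and q
    using that by (auto dest: set_zip_leftD)
  show ?thesis
    unfolding contract_append using assms(5)
    by (simp only: contract_zip length_map sh add_0) (intro sum.cong[OF refl] 2 3 assms)
qed

section \<open>Functionals given by weighted points\<close>

definition point_value :: "nat \<Rightarrow> (nat \<Rightarrow> complex) \<Rightarrow> (nat \<Rightarrow> nat \<Rightarrow> complex) \<Rightarrow> nat multiset \<Rightarrow> complex" where
  "point_value n a u \<mu> = (\<Sum>i<n. a i * (\<Prod>c\<in>#\<mu>. u i c))"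

lemma prod_mset_fibres:
  assumes "finite V" "fst ` set_mset N \<subseteq> V"
  shows "(\<Prod>v\<in>V. \<Prod>c\<in>#image_mset snd (filter_mset (\<lambda>x. fst x = v) N). f v c) = (\<Prod>x\<in>#N. f (fst x) (snd x) :: complex)"
  using assms(2)
proof (induction N)
  case empty
  then show ?case by simp
next
  case (add x N)
  have "(\<Prod>v\<in>V. \<Prod>c\<in>#image_mset snd (filter_mset (\<lambda>y. fst y = v) (add_mset x N)). f v c) =
    (\<Prod>v\<in>V. (if v = fst x then f v (snd x) else 1) * (\<Prod>c\<in>#image_mset snd (filter_mset (\<lambda>x. fst x = v) N). f v c))"
    by (intro prod.cong) auto
  also have "\<dots> = f (fst x) (snd x) * (\<Prod>v\<in>V. \<Prod>c\<in>#image_mset snd (filter_mset (\<lambda>x. fst x = v) N). f v c)"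
    using assms(1) add.prems by (simp add: prod.distrib)
  finally show ?case using add by simp
qed

text \<open>Multiplying out the vertex factors gives a sum over assignments of points to vertices.
  For a fixed assignment the color sum of an edge becomes a Gram entry.\<close>

lemma contract_point_value:
  assumes "finite V" "set_mset N \<subseteq> V \<times> {..<k}" "set E \<subseteq> V \<times> V"
  shows "contract k E (vertex_tensor k (point_value n a u) V) N =
    (\<Sum>\<psi>\<in>V \<rightarrow>\<^sub>E {..<n}. (\<Prod>v\<in>V. a (\<psi> v)) *
       (\<Prod>e\<leftarrow>E. \<Sum>c<k. u (\<psi> (fst e)) c * u (\<psi> (snd e)) c) * (\<Prod>x\<in>#N. u (\<psi> (fst x)) (snd x)))"
  using assms(2,3)
proof (induction E arbitrary: N)
  case Nil
  have "vertex_tensor k (point_value n a u) V N =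
    (\<Prod>v\<in>V. \<Sum>i<n. a i * (\<Prod>c\<in>#image_mset snd (filter_mset (\<lambda>x. fst x = v) N). u i c))"
    using Nil by (simp add: vertex_tensor_def point_value_def)
  also have "\<dots> = (\<Sum>\<psi>\<in>V \<rightarrow>\<^sub>E {..<n}. \<Prod>v\<in>V. a (\<psi> v) * (\<Prod>c\<in>#image_mset snd (filter_mset (\<lambda>x. fst x = v) N). u (\<psi> v) c))"
    using assms(1) by (rule prod_sum_PiE) simp
  also have "\<dots> = (\<Sum>\<psi>\<in>V \<rightarrow>\<^sub>E {..<n}. (\<Prod>v\<in>V. a (\<psi> v)) * (\<Prod>x\<in>#N. u (\<psi> (fst x)) (snd x)))"
  proof (rule sum.cong[OF refl])
    fix \<psi> :: "nat \<Rightarrow> nat"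
    show "(\<Prod>v\<in>V. a (\<psi> v) * (\<Prod>c\<in>#image_mset snd (filter_mset (\<lambda>x. fst x = v) N). u (\<psi> v) c)) =
      (\<Prod>v\<in>V. a (\<psi> v)) * (\<Prod>x\<in>#N. u (\<psi> (fst x)) (snd x))"
      using Nil prod_mset_fibres[OF assms(1), of N "\<lambda>v. u (\<psi> v)"] by (subst prod.distrib) fastforce
  qed
  finally show ?case by simp
next
  case (Cons e E)
  have e: "fst e \<in> V" "snd e \<in> V" using Cons.prems by auto
  have "contract k (e # E) (vertex_tensor k (point_value n a u) V) N =
    (\<Sum>c<k. \<Sum>\<psi>\<in>V \<rightarrow>\<^sub>E {..<n}. (\<Prod>v\<in>V. a (\<psi> v)) *
       (\<Prod>e\<leftarrow>E. \<Sum>c<k. u (\<psi> (fst e)) c * u (\<psi> (snd e)) c) * (\<Prod>x\<in>#N + {#(fst e, c), (snd e, c)#}. u (\<psi> (fst x)) (snd x)))"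
    unfolding contract_Cons using Cons.prems e by (intro sum.cong[OF refl] Cons.IH) auto
  also have "\<dots> = (\<Sum>\<psi>\<in>V \<rightarrow>\<^sub>E {..<n}. \<Sum>c<k. (\<Prod>v\<in>V. a (\<psi> v)) *
       (\<Prod>e\<leftarrow>E. \<Sum>c<k. u (\<psi> (fst e)) c * u (\<psi> (snd e)) c) * (\<Prod>x\<in>#N + {#(fst e, c), (snd e, c)#}. u (\<psi> (fst x)) (snd x)))"
    by (rule sum.swap)
  also have "\<dots> = (\<Sum>\<psi>\<in>V \<rightarrow>\<^sub>E {..<n}. (\<Prod>v\<in>V. a (\<psi> v)) *
       (\<Prod>e\<leftarrow>e # E. \<Sum>c<k. u (\<psi> (fst e)) c * u (\<psi> (snd e)) c) * (\<Prod>x\<in>#N. u (\<psi> (fst x)) (snd x)))"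
    by (intro sum.cong[OF refl]) (simp add: sum_distrib_left sum_distrib_right mult_ac)
  finally show ?case .
qed

text \<open>Any points with Gram matrix \<open>B\<close> may be used; below these are the columns of
  \<open>U\<close> and their rotations.\<close>

lemma vertex_partition_function_eq_contract:
  assumes "G \<in> finite_graphs" "distinct es" "set es = edges G"
    and B: "\<And>i j. i < n \<Longrightarrow> j < n \<Longrightarrow> B $$ (i, j) = (\<Sum>c<k. u i c * u j c)"
  shows "vertex_partition_function n a B G =
    contract k (map (ends G) es) (vertex_tensor k (point_value n (($) a) u) (verts G)) {#}"
proof -
  have en: "ends G e \<in> verts G \<times> verts G" if "e \<in> set es" for e
    using assms that by (auto simp: finite_graphs_def)
  have fin: "finite (verts G)" using assms by (simp add: finite_graphs_def)
  have V: "set_mset {#} \<subseteq> verts G \<times> {..<k}" "set (map (ends G) es) \<subseteq> verts G \<times> verts G"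
    using en by fastforce+
  show ?thesis
    unfolding vertex_partition_function_def contract_point_value[OF fin V]
  proof (rule sum.cong[OF refl])
    fix \<psi> assume psi: "\<psi> \<in> verts G \<rightarrow>\<^sub>E {..<n}"
    have "(\<Prod>e\<in>edges G. B $$ (\<psi> (fst (ends G e)), \<psi> (snd (ends G e)))) =
      (\<Prod>e\<leftarrow>es. B $$ (\<psi> (fst (ends G e)), \<psi> (snd (ends G e))))"
      using assms(2) by (simp add: prod.distinct_set_conv_list flip: assms(3))
    also have "map (\<lambda>e. B $$ (\<psi> (fst (ends G e)), \<psi> (snd (ends G e)))) es =
      map (\<lambda>e. \<Sum>c<k. u (\<psi> (fst (ends G e))) c * u (\<psi> (snd (ends G e))) c) es"
      using psi en by (auto intro!: B simp: mem_Times_iff PiE_iff)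
    finally show "(\<Prod>v\<in>verts G. a $ \<psi> v) * (\<Prod>e\<in>edges G. B $$ (\<psi> (fst (ends G e)), \<psi> (snd (ends G e)))) =
      (\<Prod>v\<in>verts G. a $ \<psi> v) * (\<Prod>e\<leftarrow>map (ends G) es. \<Sum>c<k. u (\<psi> (fst e)) c * u (\<psi> (snd e)) c) *
      (\<Prod>x\<in>#{#}. u (\<psi> (fst x)) (snd x))"
      by (simp add: comp_def)
  qed
qed

subsection \<open>Quantum graphs with open ends\<close>

definition gram :: "nat \<Rightarrow> (nat \<Rightarrow> nat \<Rightarrow> complex) \<Rightarrow> nat \<Rightarrow> nat \<Rightarrow> complex" where
  "gram k u i j = (\<Sum>c<k. u i c * u j c)"

text \<open>A fragment consists of a coefficient, its edges and the vertices to which its open ends are attached.\<close>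

type_synonym fragment = "complex \<times> (nat \<times> nat) list \<times> nat list"

definition wf_frag :: "nat \<Rightarrow> nat \<Rightarrow> fragment list \<Rightarrow> bool" where
  "wf_frag s t \<Gamma> \<longleftrightarrow> (\<forall>(l, E, \<tau>)\<in>set \<Gamma>. set E \<subseteq> {..<s} \<times> {..<s} \<and> set \<tau> \<subseteq> {..<s} \<and> length \<tau> = t)"

text \<open>The value of the polynomial of the quantum graph at the configuration that puts vertex
  \<open>v\<close> at the point with index \<open>\<psi> v\<close>.\<close>

definition frag_eval :: "nat \<Rightarrow> (nat \<Rightarrow> nat \<Rightarrow> complex) \<Rightarrow> fragment list \<Rightarrow> (nat \<Rightarrow> nat) \<Rightarrow> nat list \<Rightarrow> complex" where
  "frag_eval k u \<Gamma> \<psi> c = (\<Sum>(l, E, \<tau>)\<leftarrow>\<Gamma>. l * (\<Prod>e\<leftarrow>E. gram k u (\<psi> (fst e)) (\<psi> (snd e))) *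
     (\<Prod>x\<leftarrow>zip \<tau> c. u (\<psi> (fst x)) (snd x)))"

text \<open>The action of a quantum graph whose \<open>i\<close>th open end is colored \<open>c\<^sub>i\<close> on functionals: multiplication by
  the polynomial in which an edge \<open>vw\<close> stands for \<open>\<Sum>\<^sub>c x\<^bsub>v,c\<^esub> x\<^bsub>w,c\<^esub>\<close> and an open end at \<open>v\<close> for \<open>x\<^bsub>v,c\<^sub>i\<^esub>\<close>.\<close>

definition frag_act :: "nat \<Rightarrow> fragment list \<Rightarrow> nat list \<Rightarrow> functional \<Rightarrow> functional" where
  "frag_act m \<Gamma> c L N = (\<Sum>(l, E, \<tau>)\<leftarrow>\<Gamma>. l * contract m E L (N + mset (zip \<tau> c)))"

text \<open>The factors share their vertices while their open ends stay separate, so a coloring of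
  the ends of the product is a concatenation.\<close>

definition frag_mul :: "fragment list \<Rightarrow> fragment list \<Rightarrow> fragment list" where
  "frag_mul \<Gamma> \<Delta> = concat (map (\<lambda>(l, E, \<tau>). map (\<lambda>(l', E', \<tau>'). (l * l', E @ E', \<tau> @ \<tau>')) \<Delta>) \<Gamma>)"

definition frag_scale :: "complex \<Rightarrow> fragment list \<Rightarrow> fragment list" where
  "frag_scale \<kappa> \<Gamma> = map (\<lambda>(l, E, \<tau>). (\<kappa> * l, E, \<tau>)) \<Gamma>"

definition frag_const :: "complex \<Rightarrow> fragment list" where
  "frag_const \<kappa> = [(\<kappa>, [], [])]"

definition frag_edge :: "nat \<Rightarrow> nat \<Rightarrow> fragment list" where
  "frag_edge i j = [(1, [(i, j)], [])]"

definition frag_end :: "nat \<Rightarrow> fragment list" where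
  "frag_end v = [(1, [], [v])]"

definition frag_prod :: "fragment list list \<Rightarrow> fragment list" where
  "frag_prod \<Gamma>s = foldr frag_mul \<Gamma>s (frag_const 1)"

lemma wf_frag_simps [simp]:
  "wf_frag s t (\<Gamma> @ \<Delta>) \<longleftrightarrow> wf_frag s t \<Gamma> \<and> wf_frag s t \<Delta>"
  "wf_frag s t (frag_scale \<kappa> \<Gamma>) \<longleftrightarrow> wf_frag s t \<Gamma>"
  "wf_frag s 0 (frag_const \<kappa>)"
  "wf_frag s 0 (frag_edge i j) \<longleftrightarrow> i < s \<and> j < s"
  "wf_frag s (Suc 0) (frag_end v) \<longleftrightarrow> v < s"
  "wf_frag s t []"
  by (simp_all add: wf_frag_def ball_Un frag_scale_def frag_const_def frag_edge_def frag_end_def case_prod_unfold)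

lemma wf_frag_mul: "wf_frag s t \<Gamma> \<Longrightarrow> wf_frag s t' \<Delta> \<Longrightarrow> wf_frag s (t + t') (frag_mul \<Gamma> \<Delta>)"
  unfolding wf_frag_def frag_mul_def by fastforce

lemma wf_frag_prod: "\<forall>\<Gamma>\<in>set \<Gamma>s. wf_frag s t \<Gamma> \<Longrightarrow> wf_frag s (length \<Gamma>s * t) (frag_prod \<Gamma>s)"
  by (induction \<Gamma>s) (auto simp: frag_prod_def intro!: wf_frag_mul)

lemma wf_frag_mono: "wf_frag s t \<Gamma> \<Longrightarrow> s \<le> s' \<Longrightarrow> wf_frag s' t \<Gamma>"
  unfolding wf_frag_def by fastforce

lemma frag_eval_simps [simp]:
  "frag_eval k u (\<Gamma> @ \<Delta>) \<psi> c = frag_eval k u \<Gamma> \<psi> c + frag_eval k u \<Delta> \<psi> c"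
  "frag_eval k u (frag_const \<kappa>) \<psi> c = \<kappa>"
  "frag_eval k u (frag_edge i j) \<psi> c = gram k u (\<psi> i) (\<psi> j)"
  "frag_eval k u (frag_end v) \<psi> (x # c) = u (\<psi> v) x"
  "frag_eval k u [] \<psi> c = 0"
  by (simp_all add: frag_eval_def frag_const_def frag_edge_def frag_end_def)

lemma frag_eval_scale [simp]: "frag_eval k u (frag_scale \<kappa> \<Gamma>) \<psi> c = \<kappa> * frag_eval k u \<Gamma> \<psi> c"
  by (induction \<Gamma>) (auto simp: frag_eval_def frag_scale_def algebra_simps)

lemma frag_eval_mul:
  assumes "wf_frag s (length c) \<Gamma>"
  shows "frag_eval k u (frag_mul \<Gamma> \<Delta>) \<psi> (c @ c') = frag_eval k u \<Gamma> \<psi> c * frag_eval k u \<Delta> \<psi> c'"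
  using assms
proof (induction \<Gamma>)
  case Nil
  then show ?case by (simp add: frag_mul_def)
next
  case (Cons g \<Gamma>)
  obtain l E \<tau> where g: "g = (l, E, \<tau>)" by (cases g)
  have \<tau>: "length \<tau> = length c" using Cons.prems g by (simp add: wf_frag_def)
  have "frag_eval k u (map (\<lambda>(l', E', \<tau>'). (l * l', E @ E', \<tau> @ \<tau>')) \<Delta>) \<psi> (c @ c') =
    l * (\<Prod>e\<leftarrow>E. gram k u (\<psi> (fst e)) (\<psi> (snd e))) * (\<Prod>x\<leftarrow>zip \<tau> c. u (\<psi> (fst x)) (snd x)) * frag_eval k u \<Delta> \<psi> c'"
    using \<tau> by (induction \<Delta>) (auto simp: frag_eval_def algebra_simps)
  moreover have "frag_eval k u (frag_mul \<Gamma> \<Delta>) \<psi> (c @ c') = frag_eval k u \<Gamma> \<psi> c * frag_eval k u \<Delta> \<psi> c'"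
    using Cons by (simp add: wf_frag_def)
  moreover have "frag_mul (g # \<Gamma>) \<Delta> = map (\<lambda>(l', E', \<tau>'). (l * l', E @ E', \<tau> @ \<tau>')) \<Delta> @ frag_mul \<Gamma> \<Delta>"
    by (simp add: frag_mul_def g)
  moreover have "frag_eval k u (g # \<Gamma>) \<psi> c = l * (\<Prod>e\<leftarrow>E. gram k u (\<psi> (fst e)) (\<psi> (snd e))) * (\<Prod>x\<leftarrow>zip \<tau> c. u (\<psi> (fst x)) (snd x)) + frag_eval k u \<Gamma> \<psi> c"
    by (simp add: frag_eval_def g)
  ultimately show ?case by (simp add: algebra_simps)
qed

lemma frag_act_simps [simp]:
  "frag_act m (\<Gamma> @ \<Delta>) c L N = frag_act m \<Gamma> c L N + frag_act m \<Delta> c L N"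
  "frag_act m (frag_const \<kappa>) c L N = \<kappa> * L N"
  "frag_act m (frag_edge i j) c L N = (\<Sum>x<m. L (N + {#(i, x), (j, x)#}))"
  "frag_act m (frag_end v) (x # c) L N = L (N + {#(v, x)#})"
  "frag_act m [] c L N = 0"
  by (simp_all add: frag_act_def frag_const_def frag_edge_def frag_end_def contract_Cons)

lemma frag_act_scale [simp]: "frag_act m (frag_scale \<kappa> \<Gamma>) c L N = \<kappa> * frag_act m \<Gamma> c L N"
  by (induction \<Gamma>) (auto simp: frag_act_def frag_scale_def algebra_simps)

text \<open>The edges of a product are contracted one list after the other, and contraction commutes
  with multiplication by monomials. The length condition lets \<open>zip\<close> split the color
  list between the two factors.\<close>

lemma frag_act_mul:
  assumes "wf_frag s (length c) \<Gamma>"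
  shows "frag_act m (frag_mul \<Gamma> \<Delta>) (c @ c') L = frag_act m \<Gamma> c (frag_act m \<Delta> c' L)"
proof
  fix N
  show "frag_act m (frag_mul \<Gamma> \<Delta>) (c @ c') L N = frag_act m \<Gamma> c (frag_act m \<Delta> c' L) N"
    using assms
  proof (induction \<Gamma>)
    case Nil
    then show ?case by (simp add: frag_mul_def)
  next
    case (Cons g \<Gamma>)
    obtain l E \<tau> where g: "g = (l, E, \<tau>)" by (cases g)
    have \<tau>: "length \<tau> = length c" using Cons.prems g by (simp add: wf_frag_def)
    have "frag_act m (map (\<lambda>(l', E', \<tau>'). (l * l', E @ E', \<tau> @ \<tau>')) \<Delta>) (c @ c') L N =
      l * contract m E (frag_act m \<Delta> c' L) (N + mset (zip \<tau> c))"
    proof (induction \<Delta>)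
      case Nil
      show ?case by (simp add: frag_act_def contract_eq_0)
    next
      case (Cons d \<Delta>)
      obtain l' E' \<tau>' where d: "d = (l', E', \<tau>')" by (cases d)
      have "frag_act m (d # \<Delta>) c' L = (\<lambda>N. l' * contract m E' L (N + mset (zip \<tau>' c')) + frag_act m \<Delta> c' L N)"
        by (simp add: frag_act_def d fun_eq_iff)
      then have "contract m E (frag_act m (d # \<Delta>) c' L) (N + mset (zip \<tau> c)) =
        l' * contract m E (contract m E' L) (N + mset (zip \<tau> c) + mset (zip \<tau>' c')) + contract m E (frag_act m \<Delta> c' L) (N + mset (zip \<tau> c))"
        by (simp add: contract_add contract_cmult contract_shift)
      moreover have "frag_act m (map (\<lambda>(l', E', \<tau>'). (l * l', E @ E', \<tau> @ \<tau>')) (d # \<Delta>)) (c @ c') L N =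
        l * l' * contract m E (contract m E' L) (N + mset (zip \<tau> c) + mset (zip \<tau>' c')) +
        frag_act m (map (\<lambda>(l', E', \<tau>'). (l * l', E @ E', \<tau> @ \<tau>')) \<Delta>) (c @ c') L N"
        using \<tau> by (simp add: d frag_act_def contract_append add_ac)
      ultimately show ?case
        using Cons.IH by (simp add: algebra_simps)
    qed
    moreover have "frag_act m (frag_mul \<Gamma> \<Delta>) (c @ c') L N = frag_act m \<Gamma> c (frag_act m \<Delta> c' L) N"
      using Cons by (simp add: wf_frag_def)
    moreover have "frag_mul (g # \<Gamma>) \<Delta> = map (\<lambda>(l', E', \<tau>'). (l * l', E @ E', \<tau> @ \<tau>')) \<Delta> @ frag_mul \<Gamma> \<Delta>"
      by (simp add: frag_mul_def g)
    moreover have "frag_act m (g # \<Gamma>) c (frag_act m \<Delta> c' L) N =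
       l * contract m E (frag_act m \<Delta> c' L) (N + mset (zip \<tau> c)) + frag_act m \<Gamma> c (frag_act m \<Delta> c' L) N"
      by (simp add: frag_act_def g)
    ultimately show ?case by simp
  qed
qed

lemma frag_eval_prod: "\<forall>\<Gamma>\<in>set \<Gamma>s. wf_frag s 0 \<Gamma> \<Longrightarrow>
    frag_eval k u (frag_prod \<Gamma>s) \<psi> [] = (\<Prod>\<Gamma>\<leftarrow>\<Gamma>s. frag_eval k u \<Gamma> \<psi> [])"
proof (induction \<Gamma>s)
  case (Cons \<Gamma> \<Gamma>s)
  then show ?case using frag_eval_mul[of s "[]" \<Gamma> k u _ \<psi> "[]"] by (simp add: frag_prod_def)
qed (simp add: frag_prod_def)

lemma frag_act_shift: "frag_act m \<Gamma> c (\<lambda>N. L (N + M)) N = frag_act m \<Gamma> c L (N + M)"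
  by (simp add: frag_act_def contract_shift add_ac)

lemma frag_act_add: "frag_act m \<Gamma> c (\<lambda>N. L N + L' N) N = frag_act m \<Gamma> c L N + frag_act m \<Gamma> c L' N"
  by (induction \<Gamma>) (auto simp: frag_act_def contract_add algebra_simps)

lemma frag_act_cmult: "frag_act m \<Gamma> c (\<lambda>N. \<kappa> * L N) N = \<kappa> * frag_act m \<Gamma> c L N"
  by (induction \<Gamma>) (auto simp: frag_act_def contract_cmult algebra_simps)

lemma frag_act_eq_0:
  assumes "\<And>M. L (N + M) = 0"
  shows "frag_act m \<Gamma> c L N = 0"
proof -
  have "contract m E L (N + M) = 0" for E M
    by (rule contract_eq_0) (simp only: assms add.assoc)
  then show ?thesis by (induction \<Gamma>) (auto simp: frag_act_def)
qed

lemma frag_act_left_factor: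
  assumes "\<And>N N'. fst ` set_mset N \<subseteq> {..<s} \<Longrightarrow> fst ` set_mset N' \<subseteq> {..<s'} \<Longrightarrow>
      L (N + shift_vertices s N') = A N * B N'"
    and "wf_frag s t \<Gamma>" "fst ` set_mset N \<subseteq> {..<s}" "fst ` set_mset N' \<subseteq> {..<s'}"
  shows "frag_act m \<Gamma> c L (N + shift_vertices s N') = frag_act m \<Gamma> c A N * B N'"
  using assms(2)
proof (induction \<Gamma>)
  case Nil
  then show ?case by simp
next
  case (Cons g \<Gamma>)
  obtain l E \<tau> where g: "g = (l, E, \<tau>)" by (cases g)
  have "contract m E L (N + mset (zip \<tau> c) + shift_vertices s N') = contract m E A (N + mset (zip \<tau> c)) * B N'"
    using Cons.prems assms(3,4) g
    by (intro contract_left_factor[where s' = s']) (auto simp: wf_frag_def assms(1) dest: set_zip_leftD)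
  moreover have "N + mset (zip \<tau> c) + shift_vertices s N' = N + shift_vertices s N' + mset (zip \<tau> c)"
    by (simp add: add_ac)
  ultimately show ?case
    using Cons by (simp add: g wf_frag_def frag_act_def algebra_simps)
qed

lemma contract_in_Reals:
  assumes "\<And>N. L N \<in> \<real>"
  shows "contract m E L N \<in> \<real>"
  using assms by (induction E arbitrary: N) (auto simp: contract_Cons intro!: sum_in_Reals)

lemma frag_act_point_value:
  assumes "wf_frag s t \<Gamma>" "c \<in> color_lists k t"
  shows "frag_act k \<Gamma> c (vertex_tensor k (point_value n a u) {..<s}) {#} =
    (\<Sum>\<psi>\<in>{..<s} \<rightarrow>\<^sub>E {..<n}. (\<Prod>v<s. a (\<psi> v)) * frag_eval k u \<Gamma> \<psi> c)"
  using assms(1)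
proof (induction \<Gamma>)
  case Nil
  then show ?case by simp
next
  case (Cons g \<Gamma>)
  obtain l E \<tau> where g: "g = (l, E, \<tau>)" by (cases g)
  have "set_mset (mset (zip \<tau> c)) \<subseteq> {..<s} \<times> {..<k}"
    using Cons.prems assms(2) g by (auto simp: wf_frag_def color_lists_def dest: set_zip_leftD set_zip_rightD)
  then have "contract k E (vertex_tensor k (point_value n a u) {..<s}) (mset (zip \<tau> c)) =
    (\<Sum>\<psi>\<in>{..<s} \<rightarrow>\<^sub>E {..<n}. (\<Prod>v<s. a (\<psi> v)) *
       (\<Prod>e\<leftarrow>E. gram k u (\<psi> (fst e)) (\<psi> (snd e))) * (\<Prod>x\<leftarrow>zip \<tau> c. u (\<psi> (fst x)) (snd x)))"
    using Cons.prems g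
    by (subst contract_point_value) (auto simp: wf_frag_def gram_def prod_mset_prod_list simp flip: mset_map)
  then show ?case
    using Cons by (simp add: g wf_frag_def frag_act_def frag_eval_def sum.distrib distrib_left sum_distrib_left mult_ac)
qed

section \<open>Consequences of reality\<close>

locale matching_models =
  fixes n k m :: nat and a :: "nat \<Rightarrow> complex" and u :: "nat \<Rightarrow> nat \<Rightarrow> complex" and Y :: "nat multiset \<Rightarrow> complex"
  assumes real: "set_mset \<mu> \<subseteq> {..<m} \<Longrightarrow> Y \<mu> \<in> \<real>"
    and agree: "set E \<subseteq> {..<s} \<times> {..<s} \<Longrightarrow>
      contract m E (vertex_tensor m Y {..<s}) {#} = contract k E (vertex_tensor k (point_value n a u) {..<s}) {#}"
begin

lemma vertex_tensor_in_Reals: "vertex_tensor m Y V N \<in> \<real>"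
  by (force simp: vertex_tensor_def intro!: prod_in_Reals real)

lemma frag_act_eq_sum:
  assumes "wf_frag s 0 \<Gamma>"
  shows "frag_act m \<Gamma> [] (vertex_tensor m Y {..<s}) {#} =
    (\<Sum>\<psi>\<in>{..<s} \<rightarrow>\<^sub>E {..<n}. (\<Prod>v<s. a (\<psi> v)) * frag_eval k u \<Gamma> \<psi> [])"
proof -
  have "frag_act m \<Gamma> [] (vertex_tensor m Y {..<s}) {#} = frag_act k \<Gamma> [] (vertex_tensor k (point_value n a u) {..<s}) {#}"
    using assms by (induction \<Gamma>) (auto simp: frag_act_def wf_frag_def agree)
  then show ?thesis using frag_act_point_value[OF assms, of "[]" k] by simp
qed

text \<open>The norm of the real tensor is the pairing of the quantum graph with its complex conjugate, which is
  a combination of values at closed graphs and can therefore be computed in the vertex model.\<close>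

lemma frag_act_closed_eq_0:
  assumes wf: "wf_frag s t \<Gamma>"
    and 0: "\<And>\<psi> c. \<psi> \<in> {..<s} \<rightarrow>\<^sub>E {..<n} \<Longrightarrow> c \<in> color_lists k t \<Longrightarrow> frag_eval k u \<Gamma> \<psi> c = 0"
    and c: "c \<in> color_lists m t"
  shows "frag_act m \<Gamma> c (vertex_tensor m Y {..<s}) {#} = 0"
proof -
  define q where "q = length \<Gamma>"
  define l where "l i = fst (\<Gamma> ! i)" for i
  define E where "E i = fst (snd (\<Gamma> ! i))" for i
  define \<tau> where "\<tau> i = snd (snd (\<Gamma> ! i))" for i
  define T where "T m Y i c = contract m (E i) (vertex_tensor m Y {..<s}) (mset (zip (\<tau> i) c))" for m Y i c
  have wfi: "set (E i) \<subseteq> {..<s} \<times> {..<s}" "set (\<tau> i) \<subseteq> {..<s}" "length (\<tau> i) = t" if "i < q" for i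
    using wf nth_mem[of i \<Gamma>] that unfolding wf_frag_def q_def E_def \<tau>_def by (auto simp: case_prod_unfold)
  have act: "frag_act m \<Gamma> c (vertex_tensor m Y {..<s}) {#} = (\<Sum>i<q. l i * T m Y i c)" for m Y c
    unfolding frag_act_def T_def l_def E_def \<tau>_def q_def
    by (simp add: case_prod_unfold sum_list_sum_nth atLeast0LessThan)
  \<comment> \<open>Two fragments glued at corresponding ends form a closed graph on
    \<open>s + s\<close> vertices, where the two models agree.\<close>
  have glue: "(\<Sum>c\<in>color_lists m t. T m Y i c * T m Y j c) =
      (\<Sum>c\<in>color_lists k t. T k (point_value n a u) i c * T k (point_value n a u) j c)" if "i < q" "j < q" for i j
  proof -
    let ?G = "zip (\<tau> i) (map ((+) s) (\<tau> j)) @ E i @ map (map_prod ((+) s) ((+) s)) (E j)"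
    have *: "(\<Sum>c\<in>color_lists m t. T m Y i c * T m Y j c) = contract m ?G (vertex_tensor m Y {..<s + s}) {#}" for m Y
      using contract_glue[of "E i" s "E j" s "\<tau> i" "\<tau> j" m Y] wfi that unfolding T_def by simp
    have "set ?G \<subseteq> {..<s + s} \<times> {..<s + s}"
      using wfi[OF that(1)] wfi[OF that(2)] by (fastforce dest: set_zip_leftD set_zip_rightD)
    then show ?thesis unfolding * by (rule agree)
  qed
  have bil: "(\<Sum>c\<in>C. (\<Sum>i<q. l i * X i c) * (\<Sum>j<q. cnj (l j) * X j c)) =
      (\<Sum>i<q. \<Sum>j<q. l i * cnj (l j) * (\<Sum>c\<in>C. X i c * X j c))" for X :: "nat \<Rightarrow> nat list \<Rightarrow> complex" and C
  proof -
    have "(\<Sum>c\<in>C. (\<Sum>i<q. l i * X i c) * (\<Sum>j<q. cnj (l j) * X j c)) =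
      (\<Sum>c\<in>C. \<Sum>i<q. \<Sum>j<q. l i * cnj (l j) * (X i c * X j c))"
      by (simp add: sum_product mult_ac)
    also have "\<dots> = (\<Sum>i<q. \<Sum>j<q. \<Sum>c\<in>C. l i * cnj (l j) * (X i c * X j c))"
      by (subst sum.swap, rule sum.cong[OF refl], rule sum.swap)
    finally show ?thesis by (simp add: sum_distrib_left)
  qed
  let ?A = "\<lambda>c. \<Sum>i<q. l i * T m Y i c"
  have "T m Y i c \<in> \<real>" for i c
    unfolding T_def by (intro contract_in_Reals vertex_tensor_in_Reals)
  then have cnj: "(\<Sum>j<q. cnj (l j) * T m Y j c) = cnj (?A c)" for c
    by (simp add: Reals_cnj_iff)
  have "(\<Sum>c\<in>color_lists m t. ?A c * cnj (?A c)) =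
     (\<Sum>c\<in>color_lists k t. (\<Sum>i<q. l i * T k (point_value n a u) i c) * (\<Sum>j<q. cnj (l j) * T k (point_value n a u) j c))"
    unfolding cnj[symmetric] bil by (simp add: glue)
  \<comment> \<open>On the vertex side the second factor need not be the conjugate of the first, but
    the first one vanishes by assumption.\<close>
  also have "\<dots> = 0"
    unfolding act[symmetric] by (simp add: frag_act_point_value[OF wf] 0)
  finally have "of_real (\<Sum>c\<in>color_lists m t. (norm (?A c))\<^sup>2) = (0 :: complex)"
    by (simp only: of_real_sum complex_norm_square)
  then have "(\<Sum>c\<in>color_lists m t. (norm (?A c))\<^sup>2) = 0"
    by (simp only: of_real_eq_0_iff)
  then have "\<forall>c\<in>color_lists m t. (norm (?A c))\<^sup>2 = 0"
    by (subst (asm) sum_nonneg_eq_0_iff) auto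
  then show ?thesis using c act by simp
qed

text \<open>Vanishing at all configurations is stable under multiplication by monomials, so the
  result at the empty monomial extends to every \<open>N\<close>.\<close>

lemma frag_act_eq_0_if_eval_eq_0:
  assumes wf: "wf_frag s t \<Gamma>"
    and 0: "\<And>\<psi> c. \<psi> \<in> {..<s} \<rightarrow>\<^sub>E {..<n} \<Longrightarrow> c \<in> color_lists k t \<Longrightarrow> frag_eval k u \<Gamma> \<psi> c = 0"
    and c: "c \<in> color_lists m t"
  shows "frag_act m \<Gamma> c (vertex_tensor m Y {..<s}) N = 0"
proof (cases "set_mset N \<subseteq> {..<s} \<times> {..<m}")
  case False
  show ?thesis
    by (rule frag_act_eq_0) (use False in \<open>auto simp: vertex_tensor_def\<close>)
next
  case True
  obtain xs where xs: "mset xs = N" using ex_mset by blast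
  \<comment> \<open>One open end per variable of \<open>N\<close>: acting with this fragment is
    multiplication by the monomial \<open>N\<close>.\<close>
  define \<Delta> where "\<Delta> = [(1 :: complex, [] :: (nat \<times> nat) list, map fst xs)]"
  have xs': "set xs \<subseteq> {..<s} \<times> {..<m}" using True xs by auto
  have wf\<Delta>: "wf_frag s (length xs) \<Delta>"
    using xs' by (auto simp: wf_frag_def \<Delta>_def)
  have tc: "length c = t" using c by (simp add: color_lists_def)
  have \<Delta>: "frag_act m \<Delta> (map snd xs) L = (\<lambda>M. L (M + N))" for L
    by (simp add: frag_act_def \<Delta>_def fun_eq_iff zip_map_fst_snd xs)
  have "frag_act m (frag_mul \<Gamma> \<Delta>) (c @ map snd xs) (vertex_tensor m Y {..<s}) {#} = 0"
  proof (rule frag_act_closed_eq_0[OF wf_frag_mul[OF wf wf\<Delta>]])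
    show "c @ map snd xs \<in> color_lists m (t + length xs)"
      using c xs' by (auto simp: color_lists_def)
  next
    fix \<psi> d assume psi: "\<psi> \<in> {..<s} \<rightarrow>\<^sub>E {..<n}" and d: "d \<in> color_lists k (t + length xs)"
    have td: "length (take t d) = t" "take t d \<in> color_lists k t"
      using d set_take_subset[of t d] by (auto simp: color_lists_def)
    show "frag_eval k u (frag_mul \<Gamma> \<Delta>) \<psi> d = 0"
      using frag_eval_mul[of s "take t d" \<Gamma> k u \<Delta> \<psi> "drop t d"] td wf 0[OF psi td(2)] by simp
  qed
  then show ?thesis
    using wf tc by (simp add: frag_act_mul[of s] \<Delta> frag_act_shift)
qed

end

subsection \<open>Joint eigenfunctionals and independence of evaluations\<close>

text \<open>The module generated by \<open>L\<close> over the polynomials in the variables of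
  \<open>S\<close>, a variable acting by multiplication in the argument.\<close>

inductive_set translates :: "'v set \<Rightarrow> ('v multiset \<Rightarrow> complex) \<Rightarrow> ('v multiset \<Rightarrow> complex) set"
  for S :: "'v set" and L :: "'v multiset \<Rightarrow> complex" where
  base: "L \<in> translates S L"
| shift: "f \<in> translates S L \<Longrightarrow> x \<in> S \<Longrightarrow> (\<lambda>N. f (add_mset x N)) \<in> translates S L"
| add: "f \<in> translates S L \<Longrightarrow> g \<in> translates S L \<Longrightarrow> (\<lambda>N. f N + g N) \<in> translates S L"
| cmult: "f \<in> translates S L \<Longrightarrow> (\<lambda>N. \<kappa> * f N) \<in> translates S L"

lemma translates_mono: "f \<in> translates S L \<Longrightarrow> S \<subseteq> T \<Longrightarrow> f \<in> translates T L"
proof (induction rule: translates.induct)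
  case (shift f x)
  then show ?case by (intro translates.shift) auto
qed (simp_all add: translates.base translates.add translates.cmult)

lemma translates_trans:
  assumes "g \<in> translates T f" "f \<in> translates S L" "T \<subseteq> S"
  shows "g \<in> translates S L"
  using assms
proof (induction rule: translates.induct)
  case (shift f x)
  then show ?case by (intro translates.shift) auto
qed (simp_all add: translates.add translates.cmult)

definition poly_act :: "complex poly \<Rightarrow> 'v \<Rightarrow> ('v multiset \<Rightarrow> complex) \<Rightarrow> 'v multiset \<Rightarrow> complex" where
  "poly_act p x L N = (\<Sum>d\<le>degree p. poly.coeff p d * L (N + replicate_mset d x))"

lemma poly_act_altdef:
  assumes "degree p \<le> q"
  shows "poly_act p x L N = (\<Sum>d\<le>q. poly.coeff p d * L (N + replicate_mset d x))"
  unfolding poly_act_def using assms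
  by (intro sum.mono_neutral_left) (auto simp: coeff_eq_0)

lemma poly_act_pCons: "poly_act (pCons \<alpha> p) x L N = \<alpha> * L N + poly_act p x L (add_mset x N)"
proof -
  have "poly_act (pCons \<alpha> p) x L N = (\<Sum>d\<le>Suc (degree p). poly.coeff (pCons \<alpha> p) d * L (N + replicate_mset d x))"
    by (rule poly_act_altdef) (rule degree_pCons_le)
  also have "\<dots> = \<alpha> * L N + (\<Sum>d\<le>degree p. poly.coeff p d * L (N + replicate_mset (Suc d) x))"
    unfolding sum.atMost_Suc_shift by simp
  finally show ?thesis by (simp add: poly_act_def)
qed

lemma poly_act_0 [simp]: "poly_act 0 x L N = 0"
  by (simp add: poly_act_def)

lemma poly_act_diff_smult:
  "poly_act (p - smult \<kappa> q) x L N = poly_act p x L N - \<kappa> * poly_act q x L N"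
proof -
  define D where "D = max (degree p) (degree q)"
  have "degree (p - smult \<kappa> q) \<le> D" "degree p \<le> D" "degree q \<le> D"
    unfolding D_def by (auto intro!: degree_diff_le intro: le_trans[OF degree_smult_le])
  then show ?thesis
    by (simp add: poly_act_altdef[where q = D] sum_distrib_left sum_subtractf[symmetric] algebra_simps)
qed

lemma poly_act_linear_factor:
  "poly_act ([:- \<kappa>, 1:] * p) x L N = poly_act p x L (add_mset x N) - \<kappa> * poly_act p x L N"
proof -
  have "[:- \<kappa>, 1:] * p = pCons 0 p - smult \<kappa> p" by simp
  then show ?thesis by (simp only: poly_act_diff_smult poly_act_pCons) simp
qed

lemma poly_act_in_translates: "poly_act p x L \<in> translates {x} L"
proof (induction p arbitrary: L)
  case 0
  have "(\<lambda>N. 0 * L N) \<in> translates {x} L" by (intro translates.cmult translates.base)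
  then show ?case by (simp add: poly_act_def)
next
  case (pCons \<alpha> p)
  have "(\<lambda>N. \<alpha> * L N + poly_act p x L (add_mset x N)) \<in> translates {x} L"
    by (intro translates.add translates.cmult translates.base translates.shift[OF pCons.IH]) simp
  then show ?case by (simp add: poly_act_pCons[abs_def])
qed

lemma poly_act_eq_0_translates:
  assumes "f \<in> translates S L" "\<And>N. poly_act p x L N = 0"
  shows "poly_act p x f N = 0"
  using assms
proof (induction arbitrary: N rule: translates.induct)
  case (shift f y)
  have "poly_act p x (\<lambda>N. f (add_mset y N)) N = poly_act p x f (add_mset y N)"
    by (simp add: poly_act_def)
  then show ?case using shift by simp
next
  case (add f g)
  have "poly_act p x (\<lambda>N. f N + g N) N = poly_act p x f N + poly_act p x g N"
    by (simp add: poly_act_def distrib_left sum.distrib)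
  then show ?case using add by simp
next
  case (cmult f \<kappa>)
  have "poly_act p x (\<lambda>N. \<kappa> * f N) N = \<kappa> * poly_act p x f N"
    by (simp add: poly_act_def sum_distrib_left mult_ac)
  then show ?case using cmult by simp
qed simp

text \<open>Linear factors are split off \<open>p\<close> as long as the remaining factor still
  annihilates \<open>L\<close>. Once a remaining factor does not, its image of \<open>L\<close> is
  killed by \<open>x - \<kappa>\<close>.\<close>

lemma eigenfunctional_one_variable:
  assumes "p \<noteq> 0" "\<And>N. poly_act p x L N = 0" "L M \<noteq> 0"
  shows "\<exists>f\<in>translates {x} L. (\<exists>M'. f M' \<noteq> 0) \<and> (\<exists>\<kappa>. \<forall>N. f (add_mset x N) = \<kappa> * f N)"
  using assms(1,2)
proof (induction "degree p" arbitrary: p)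
  case 0
  then obtain \<alpha> where p: "p = [:\<alpha>:]" by (metis degree_eq_zeroE)
  then have "\<alpha> * L M = 0" using 0(3)[of M] by (simp add: poly_act_pCons)
  then show ?case using p 0(2) assms(3) by simp
next
  case (Suc d)
  have "\<not> constant (poly p)" using Suc(2) by (simp add: constant_degree)
  then obtain \<kappa> where "poly p \<kappa> = 0" using fundamental_theorem_of_algebra by blast
  then obtain q where q: "p = [:- \<kappa>, 1:] * q" by (auto simp: poly_eq_0_iff_dvd elim: dvdE)
  have q0: "q \<noteq> 0" using q Suc(3) by auto
  have dq: "d = degree q"
  proof -
    have "degree p = Suc (degree q)"
      unfolding q using q0 by (subst degree_mult_eq) auto
    then show ?thesis using Suc(2) by simp
  qed
  show ?case
  proof (cases "\<forall>N. poly_act q x L N = 0")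
    case True
    then show ?thesis using Suc(1)[OF dq q0] by blast
  next
    case False
    have "poly_act q x L (add_mset x N) = \<kappa> * poly_act q x L N" for N
      using Suc(4)[of N] unfolding q poly_act_linear_factor by simp
    then show ?thesis using False poly_act_in_translates[of q x L] by blast
  qed
qed

lemma translates_eigen:
  assumes "f \<in> translates S L" "\<And>N. L (add_mset y N) = \<kappa> * L N"
  shows "f (add_mset y N) = \<kappa> * f N"
  using assms
proof (induction arbitrary: N rule: translates.induct)
  case (shift f x)
  then show ?case by (simp add: add_mset_commute[of x y])
qed (simp_all add: algebra_simps)

text \<open>Multiplications by variables commute, so a translate of \<open>f\<close> keeps the
  eigenvalues of \<open>f\<close> and is annihilated by the polynomials that annihilate
  \<open>L\<close>. The variables can thus be treated one at a time.\<close>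

lemma joint_eigenfunctional:
  assumes "finite S" "\<And>x. x \<in> S \<Longrightarrow> \<exists>p. p \<noteq> 0 \<and> (\<forall>N. poly_act p x L N = 0)" "L M \<noteq> 0"
  shows "\<exists>f\<in>translates S L. (\<exists>M'. f M' \<noteq> 0) \<and> (\<exists>\<omega>. \<forall>x\<in>S. \<forall>N. f (add_mset x N) = \<omega> x * f N)"
  using assms(1,2)
proof (induction S)
  case empty
  then show ?case using assms(3) by (auto intro!: bexI[of _ L] translates.base)
next
  case (insert x S)
  have "\<exists>f\<in>translates S L. (\<exists>M'. f M' \<noteq> 0) \<and> (\<exists>\<omega>. \<forall>x\<in>S. \<forall>N. f (add_mset x N) = \<omega> x * f N)"
    by (rule insert.IH) (rule insert.prems, simp)
  then obtain f M' \<omega> where f: "f \<in> translates S L" "f M' \<noteq> 0" and \<omega>: "\<forall>y\<in>S. \<forall>N. f (add_mset y N) = \<omega> y * f N"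
    by (elim bexE conjE exE)
  obtain p where p: "p \<noteq> 0" "\<forall>N. poly_act p x L N = 0"
    using insert.prems[OF insertI1] by (elim exE conjE)
  have "poly_act p x f N = 0" for N
    by (rule poly_act_eq_0_translates[OF f(1)]) (rule p(2)[rule_format])
  from eigenfunctional_one_variable[OF p(1) this f(2)]
  obtain g \<kappa> M'' where g: "g \<in> translates {x} f" "g M'' \<noteq> 0" and \<kappa>: "\<forall>N. g (add_mset x N) = \<kappa> * g N"
    by (elim bexE conjE exE)
  have "g \<in> translates (insert x S) L"
  proof (rule translates_trans[OF g(1)])
    show "f \<in> translates (insert x S) L"
      using f(1) by (rule translates_mono) auto
  qed simp
  moreover have "\<forall>y\<in>insert x S. \<forall>N. g (add_mset y N) = (\<omega>(x := \<kappa>)) y * g N"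
    using \<kappa> translates_eigen[OF g(1), of _ "\<omega> _"] \<omega> insert.hyps(2) by auto
  ultimately show ?case using g(2) by (intro bexI[of _ g] conjI exI)
qed

text \<open>Eigenvalues act as the coordinates of a point: a joint eigenfunctional is a multiple of
  the evaluation there.\<close>

lemma eigenfunctional_eq_prod:
  assumes "\<And>x N. x \<in> S \<Longrightarrow> f (add_mset x N) = \<omega> x * f N" "set_mset N \<subseteq> S"
  shows "f N = (\<Prod>x\<in>#N. \<omega> x) * (f {#} :: complex)"
  using assms(2) by (induction N) (auto simp: assms(1))

text \<open>Only products of linear forms \<open>t\<^sub>j - \<kappa>\<close> are needed to separate finitely many points.\<close>

lemma sum_linear_factors_eq:
  fixes P Q :: "'i \<Rightarrow> nat \<Rightarrow> complex"
  assumes "\<And>\<mu>. set_mset \<mu> \<subseteq> {..<d} \<Longrightarrow>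
      (\<Sum>i\<in>I. e i * (\<Prod>c\<in>#\<mu>. P i c)) = (\<Sum>j\<in>J. f j * (\<Prod>c\<in>#\<mu>. Q j c))"
    and "set (map fst xs) \<subseteq> {..<d}" "set_mset \<mu> \<subseteq> {..<d}"
  shows "(\<Sum>i\<in>I. e i * ((\<Prod>(c, \<kappa>)\<leftarrow>xs. P i c - \<kappa>) * (\<Prod>c\<in>#\<mu>. P i c))) =
    (\<Sum>j\<in>J. f j * ((\<Prod>(c, \<kappa>)\<leftarrow>xs. Q j c - \<kappa>) * (\<Prod>c\<in>#\<mu>. Q j c)))"
  using assms(2,3)
proof (induction xs arbitrary: \<mu>)
  case Nil
  then show ?case using assms(1) by simp
next
  case (Cons x xs)
  obtain c \<kappa> where x: "x = (c, \<kappa>)" by (cases x)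
  have 1: "(\<Sum>i\<in>I. e i * ((\<Prod>(c, \<kappa>)\<leftarrow>xs. P i c - \<kappa>) * (\<Prod>c\<in>#add_mset c \<mu>. P i c))) =
    (\<Sum>j\<in>J. f j * ((\<Prod>(c, \<kappa>)\<leftarrow>xs. Q j c - \<kappa>) * (\<Prod>c\<in>#add_mset c \<mu>. Q j c)))"
    using Cons.prems by (intro Cons.IH) (auto simp: x)
  have 2: "(\<Sum>i\<in>I. e i * ((\<Prod>(c, \<kappa>)\<leftarrow>xs. P i c - \<kappa>) * (\<Prod>c\<in>#\<mu>. P i c))) =
    (\<Sum>j\<in>J. f j * ((\<Prod>(c, \<kappa>)\<leftarrow>xs. Q j c - \<kappa>) * (\<Prod>c\<in>#\<mu>. Q j c)))"
    using Cons.prems by (intro Cons.IH) (auto simp: x)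
  have *: "(\<Sum>i\<in>I. e i * ((\<Prod>(c, \<kappa>)\<leftarrow>x # xs. P i c - \<kappa>) * (\<Prod>c\<in>#\<mu>. P i c))) =
     (\<Sum>i\<in>I. e i * ((\<Prod>(c, \<kappa>)\<leftarrow>xs. P i c - \<kappa>) * (\<Prod>c\<in>#add_mset c \<mu>. P i c))) -
     \<kappa> * (\<Sum>i\<in>I. e i * ((\<Prod>(c, \<kappa>)\<leftarrow>xs. P i c - \<kappa>) * (\<Prod>c\<in>#\<mu>. P i c)))"
    for P :: "'i \<Rightarrow> nat \<Rightarrow> complex" and I e
    by (simp add: x sum_distrib_left sum_subtractf[symmetric] algebra_simps)
  show ?case unfolding * using 1 2 by simp
qed

text \<open>Both sides are tested on a product \<open>g\<close> of linear factors that vanishes at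
  every point different from \<open>p\<close> but not at \<open>p\<close>. Several indices may give
  the same point, so total weights over the fibre of \<open>p\<close> are compared.\<close>

lemma evaluations_independent:
  fixes P Q :: "'i \<Rightarrow> nat \<Rightarrow> complex"
  assumes "finite I" "finite J"
    and "\<And>\<mu>. set_mset \<mu> \<subseteq> {..<d} \<Longrightarrow>
      (\<Sum>i\<in>I. e i * (\<Prod>c\<in>#\<mu>. P i c)) = (\<Sum>j\<in>J. f j * (\<Prod>c\<in>#\<mu>. Q j c))"
  shows "(\<Sum>i | i \<in> I \<and> (\<forall>c<d. P i c = p c). e i) = (\<Sum>j | j \<in> J \<and> (\<forall>c<d. Q j c = p c). f j)"
proof -
  define Z where "Z = {z \<in> P ` I \<union> Q ` J. \<not> (\<forall>c<d. z c = p c)}"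
  have "finite Z" using assms(1,2) by (simp add: Z_def)
  then obtain zs where zs: "set zs = Z" using finite_list by blast
  \<comment> \<open>Each point to be removed differs from \<open>p\<close> in some coordinate below
    \<open>d\<close>; such a coordinate supplies its linear factor.\<close>
  define j where "j z = (SOME c. c < d \<and> z c \<noteq> p c)" for z
  have j: "j z < d \<and> z (j z) \<noteq> p (j z)" if "z \<in> Z" for z
    unfolding j_def by (rule someI_ex) (use that in \<open>auto simp: Z_def\<close>)
  define xs where "xs = map (\<lambda>z. (j z, z (j z))) zs"
  define g where "g t = (\<Prod>(c, \<kappa>)\<leftarrow>xs. t c - \<kappa>)" for t :: "nat \<Rightarrow> complex"
  have xs: "set (map fst xs) \<subseteq> {..<d}" using j by (auto simp: xs_def zs)
  have g: "g t = 0 \<longleftrightarrow> (\<exists>z\<in>Z. t (j z) = z (j z))" for t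
    by (simp add: g_def prod_list_zero_iff xs_def zs[symmetric] image_iff comp_def)
  have gp: "g p \<noteq> 0"
    using j unfolding g by metis
  have gcong: "g t = g p" if "\<forall>c<d. t c = p c" for t
  proof -
    have "t (j z) = p (j z)" if "z \<in> Z" for z using that j \<open>\<forall>c<d. t c = p c\<close> by blast
    then show ?thesis
      unfolding g_def xs_def by (intro arg_cong[where f = prod_list]) (simp add: zs)
  qed
  have *: "(\<Sum>i\<in>I. e i * g (P i)) = g p * (\<Sum>i | i \<in> I \<and> (\<forall>c<d. P i c = p c). e i)"
    if "finite I" "\<And>i. i \<in> I \<Longrightarrow> \<not> (\<forall>c<d. P i c = p c) \<Longrightarrow> P i \<in> Z"
    for I :: "'i set" and P :: "'i \<Rightarrow> nat \<Rightarrow> complex" and e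
  proof -
    have "(\<Sum>i\<in>I. e i * g (P i)) = (\<Sum>i | i \<in> I \<and> (\<forall>c<d. P i c = p c). e i * g (P i))"
    proof (intro sum.mono_neutral_right ballI)
      fix i assume "i \<in> I - {i \<in> I. \<forall>c<d. P i c = p c}"
      then have "P i \<in> Z" using that(2) by blast
      then have "g (P i) = 0" unfolding g by blast
      then show "e i * g (P i) = 0" by simp
    qed (use that(1) in auto)
    also have "\<dots> = (\<Sum>i | i \<in> I \<and> (\<forall>c<d. P i c = p c). g p * e i)"
    proof (rule sum.cong[OF refl])
      fix i assume "i \<in> {i \<in> I. \<forall>c<d. P i c = p c}"
      then have "g (P i) = g p" by (intro gcong) simp
      then show "e i * g (P i) = g p * e i" by simp
    qed
    finally show ?thesis by (simp add: sum_distrib_left)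
  qed
  have I: "P i \<in> Z" if "i \<in> I" "\<not> (\<forall>c<d. P i c = p c)" for i using that unfolding Z_def by blast
  have J: "Q i \<in> Z" if "i \<in> J" "\<not> (\<forall>c<d. Q i c = p c)" for i using that unfolding Z_def by blast
  have "(\<Sum>i\<in>I. e i * g (P i)) = (\<Sum>j\<in>J. f j * g (Q j))"
    using sum_linear_factors_eq[OF assms(3) xs, of "{#}"] by (simp add: g_def)
  then show ?thesis
    using gp *[OF assms(1) I, where e = e] *[OF assms(2) J, where e = f] by simp
qed

subsection \<open>Indicators of Gram matrices\<close>

lemma sum_in_translates:
  "finite A \<Longrightarrow> (\<And>x. x \<in> A \<Longrightarrow> g x \<in> translates S L) \<Longrightarrow> (\<lambda>N. \<Sum>x\<in>A. g x N) \<in> translates S L"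
proof (induction A rule: finite_induct)
  case empty
  show ?case using translates.cmult[OF translates.base, of 0] by simp
next
  case (insert x A)
  then show ?case using translates.add[of "g x" S L "\<lambda>N. \<Sum>x\<in>A. g x N"] by simp
qed

lemma shift_multiset_in_translates:
  "f \<in> translates S L \<Longrightarrow> set_mset M \<subseteq> S \<Longrightarrow> (\<lambda>N. f (N + M)) \<in> translates S L"
proof (induction M arbitrary: f)
  case (add x M)
  have "(\<lambda>N. f (add_mset x N)) \<in> translates S L"
    using add.prems by (intro translates.shift) auto
  then have "(\<lambda>N. f (add_mset x (N + M))) \<in> translates S L"
    using add.prems by (intro add.IH) auto
  then show ?case by simp
qed simp

text \<open>Polynomials annihilating a tensor therefore annihilate whatever quantum graphs make of
  it.\<close>

lemma frag_act_in_translates: "frag_act m \<Gamma> c L \<in> translates UNIV L"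
proof -
  have con: "contract m E L \<in> translates UNIV L" for E
  proof (induction E)
    case Nil
    show ?case by (simp add: translates.base)
  next
    case (Cons e E)
    have "(\<lambda>N. \<Sum>x<m. contract m E L (N + {#(fst e, x), (snd e, x)#})) \<in> translates UNIV L"
      by (intro sum_in_translates shift_multiset_in_translates Cons.IH) auto
    then show ?case by (simp only: contract_Cons[abs_def])
  qed
  show ?thesis
  proof (induction \<Gamma>)
    case Nil
    show ?case using translates.cmult[OF translates.base, of 0] by (simp add: frag_act_def[abs_def])
  next
    case (Cons g \<Gamma>)
    obtain l E \<tau> where g: "g = (l, E, \<tau>)" by (cases g)
    have "(\<lambda>N. l * contract m E L (N + mset (zip \<tau> c)) + frag_act m \<Gamma> c L N) \<in> translates UNIV L"
      by (intro translates.add translates.cmult shift_multiset_in_translates con Cons.IH) auto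
    then show ?case by (simp add: frag_act_def[abs_def] g)
  qed
qed

text \<open>Quantum graphs act by multiplication too, hence commute with translations.\<close>

lemma frag_act_eq_0_translates:
  assumes "f \<in> translates S L" "\<And>N. frag_act m \<Gamma> c L N = 0"
  shows "frag_act m \<Gamma> c f N = 0"
  using assms
proof (induction arbitrary: N rule: translates.induct)
  case (shift f x)
  then show ?case using frag_act_shift[of m \<Gamma> c f "{#x#}" N] by simp
qed (simp_all add: frag_act_add frag_act_cmult)

text \<open>A monomial outside \<open>D\<close> stays outside after multiplication.\<close>

lemma translates_eq_0:
  assumes "f \<in> translates S L" "\<And>N. \<not> set_mset N \<subseteq> D \<Longrightarrow> L N = 0" "\<not> set_mset N \<subseteq> D"
  shows "f N = 0"
  using assms
proof (induction arbitrary: N rule: translates.induct)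
  case (shift f x)
  then show ?case by auto
qed simp_all

lemma frag_act_support:
  assumes "\<And>N. \<not> set_mset N \<subseteq> D \<Longrightarrow> L N = 0" "\<not> set_mset N \<subseteq> D"
  shows "frag_act m \<Gamma> c L N = 0"
  by (rule frag_act_eq_0) (use assms in auto)

lemma vertex_tensor_support: "\<not> set_mset N \<subseteq> V \<times> {..<m} \<Longrightarrow> vertex_tensor m Y V N = 0"
  by (auto simp: vertex_tensor_def)

lemma prod_list_of_bool: "(\<Prod>x\<leftarrow>xs. of_bool (P x)) = (of_bool (\<forall>x\<in>set xs. P x) :: complex)"
  by (induction xs) auto

locale twin_free_points =
  fixes n k :: nat and u :: "nat \<Rightarrow> nat \<Rightarrow> complex"
  assumes twin_free: "i < n \<Longrightarrow> j < n \<Longrightarrow> (\<And>l. l < n \<Longrightarrow> gram k u i l = gram k u j l) \<Longrightarrow> i = j"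
begin

text \<open>The Lagrange interpolation polynomial for the value \<kappa> on the finite set of Gram
  entries, applied to the edge \<open>vw\<close>. Each factor is 1 at \<kappa>, so repetitions in
  the list do no harm.\<close>

definition value_indicator :: "nat \<Rightarrow> nat \<Rightarrow> complex \<Rightarrow> fragment list" where
  "value_indicator v w \<kappa> = frag_prod (map (\<lambda>\<kappa>'. frag_scale (1 / (\<kappa> - \<kappa>')) (frag_edge v w @ frag_const (- \<kappa>')))
     (filter (\<lambda>\<kappa>'. \<kappa>' \<noteq> \<kappa>) (map (\<lambda>(i, j). gram k u i j) (List.product [0..<n] [0..<n]))))"

lemma wf_value_indicator: "v < s \<Longrightarrow> w < s \<Longrightarrow> wf_frag s 0 (value_indicator v w \<kappa>)"
  unfolding value_indicator_def
  by (rule wf_frag_prod[of _ s 0, simplified]) auto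

lemma frag_eval_value_indicator:
  assumes "\<psi> v < n" "\<psi> w < n"
  shows "frag_eval k u (value_indicator v w \<kappa>) \<psi> [] = of_bool (gram k u (\<psi> v) (\<psi> w) = \<kappa>)"
proof -
  let ?xs = "filter (\<lambda>\<kappa>'. \<kappa>' \<noteq> \<kappa>) (map (\<lambda>(i, j). gram k u i j) (List.product [0..<n] [0..<n]))"
  let ?b = "gram k u (\<psi> v) (\<psi> w)"
  have "frag_eval k u (value_indicator v w \<kappa>) \<psi> [] = (\<Prod>\<kappa>'\<leftarrow>?xs. 1 / (\<kappa> - \<kappa>') * (?b - \<kappa>'))"
    unfolding value_indicator_def
    by (subst frag_eval_prod[of _ "Suc (max v w)"]) (auto simp: comp_def)
  also have "\<dots> = of_bool (?b = \<kappa>)"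
  proof (cases "?b = \<kappa>")
    case True
    have "map (\<lambda>\<kappa>'. 1 / (\<kappa> - \<kappa>') * (?b - \<kappa>')) ?xs = map (\<lambda>_. 1) ?xs"
      by (rule map_cong) (auto simp: True)
    then show ?thesis using True by (simp only:) (simp add: map_replicate_const)
  next
    case False
    then have "?b \<in> set ?xs" using assms by (force simp: image_iff)
    then have "(\<Prod>\<kappa>'\<leftarrow>?xs. 1 / (\<kappa> - \<kappa>') * (?b - \<kappa>')) = 0"
      unfolding prod_list_zero_iff by force
    then show ?thesis using False by simp
  qed
  finally show ?thesis .
qed

text \<open>All ordered pairs occur, including \<open>v = w\<close>, so that loops fix the
  diagonal.\<close>

definition gram_indicator :: "nat \<Rightarrow> (nat \<Rightarrow> nat) \<Rightarrow> fragment list" where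
  "gram_indicator s r = frag_prod (map (\<lambda>(v, w). value_indicator v w (gram k u (r v) (r w))) (List.product [0..<s] [0..<s]))"

lemma wf_gram_indicator: "wf_frag s 0 (gram_indicator s r)"
  unfolding gram_indicator_def
  by (rule wf_frag_prod[of _ s 0, simplified]) (auto intro: wf_value_indicator)

lemma frag_eval_gram_indicator:
  assumes "\<And>v. v < s \<Longrightarrow> \<psi> v < n"
  shows "frag_eval k u (gram_indicator s r) \<psi> [] =
    of_bool (\<forall>v<s. \<forall>w<s. gram k u (\<psi> v) (\<psi> w) = gram k u (r v) (r w))"
proof -
  have "frag_eval k u (gram_indicator s r) \<psi> [] =
    (\<Prod>x\<leftarrow>List.product [0..<s] [0..<s]. frag_eval k u (value_indicator (fst x) (snd x) (gram k u (r (fst x)) (r (snd x)))) \<psi> [])"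
    unfolding gram_indicator_def
    by (subst frag_eval_prod[of _ s]) (auto intro: wf_value_indicator simp: comp_def case_prod_unfold)
  also have "map (\<lambda>x. frag_eval k u (value_indicator (fst x) (snd x) (gram k u (r (fst x)) (r (snd x)))) \<psi> []) (List.product [0..<s] [0..<s]) =
     map (\<lambda>x. of_bool (gram k u (\<psi> (fst x)) (\<psi> (snd x)) = gram k u (r (fst x)) (r (snd x)))) (List.product [0..<s] [0..<s])"
    using assms by (intro map_cong refl frag_eval_value_indicator) auto
  finally show ?thesis by (simp add: prod_list_of_bool Ball_def)
qed

text \<open>Vertex \<open>n\<close> is an additional vertex. Where the first \<open>n\<close>
  vertices realise the Gram matrix and \<open>i < n\<close>, the condition says that it lies on the
  point of vertex \<open>i\<close>.\<close>

definition row_indicator :: "nat \<Rightarrow> fragment list" where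
  "row_indicator i = frag_prod (map (\<lambda>l. value_indicator n l (gram k u i l)) [0..<n])"

lemma wf_row_indicator: "wf_frag (Suc n) 0 (row_indicator i)"
  unfolding row_indicator_def
  by (rule wf_frag_prod[of _ "Suc n" 0, simplified]) (auto intro: wf_value_indicator)

lemma frag_eval_row_indicator:
  assumes "\<And>v. v \<le> n \<Longrightarrow> \<psi> v < n"
  shows "frag_eval k u (row_indicator i) \<psi> [] = of_bool (\<forall>l<n. gram k u (\<psi> n) (\<psi> l) = gram k u i l)"
proof -
  have "frag_eval k u (row_indicator i) \<psi> [] = (\<Prod>l\<leftarrow>[0..<n]. frag_eval k u (value_indicator n l (gram k u i l)) \<psi> [])"
    unfolding row_indicator_def
    by (subst frag_eval_prod[of _ "Suc n"]) (auto intro: wf_value_indicator simp: comp_def)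
  also have "map (\<lambda>l. frag_eval k u (value_indicator n l (gram k u i l)) \<psi> []) [0..<n] =
     map (\<lambda>l. of_bool (gram k u (\<psi> n) (\<psi> l) = gram k u i l)) [0..<n]"
    using assms by (intro map_cong refl frag_eval_value_indicator) auto
  finally show ?thesis by (simp add: prod_list_of_bool Ball_def)
qed

definition gram_preserving :: "(nat \<Rightarrow> nat) \<Rightarrow> bool" where
  "gram_preserving \<psi> \<longleftrightarrow> (\<forall>v<n. \<psi> v < n) \<and> (\<forall>v<n. \<forall>w<n. gram k u (\<psi> v) (\<psi> w) = gram k u v w)"

text \<open>If \<open>\<psi> v = \<psi> w\<close>, then \<open>v\<close> and \<open>w\<close> have
  equal Gram rows and are therefore equal; an injective self-map of a finite set is onto.\<close>

lemma gram_preserving_bij: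
  assumes "gram_preserving \<psi>"
  shows "bij_betw \<psi> {..<n} {..<n}"
proof -
  have "inj_on \<psi> {..<n}"
    by (rule inj_onI, rule twin_free) (use assms in \<open>auto simp: gram_preserving_def\<close>, metis)
  moreover have "\<psi> ` {..<n} \<subseteq> {..<n}" using assms by (auto simp: gram_preserving_def)
  ultimately show ?thesis by (simp add: bij_betw_def endo_inj_surj)
qed

text \<open>As \<psi> is onto, the products with all \<open>\<psi> l\<close> make up the full Gram
  row of \<open>j\<close>, which determines \<open>j\<close>.\<close>

lemma gram_preserving_eqI:
  assumes "gram_preserving \<psi>" "i < n" "j < n" "\<And>l. l < n \<Longrightarrow> gram k u j (\<psi> l) = gram k u i l"
  shows "j = \<psi> i"
proof (rule twin_free)
  fix l assume "l < n"
  then obtain l' where "l' < n" "l = \<psi> l'"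
    using gram_preserving_bij[OF assms(1)] by (metis bij_betw_def imageE lessThan_iff)
  then show "gram k u j l = gram k u (\<psi> i) l"
    using assms by (simp add: gram_preserving_def)
qed (use assms in \<open>auto simp: gram_preserving_def\<close>)

definition automorphisms :: "(nat \<Rightarrow> nat) set" where
  "automorphisms = {\<psi> \<in> {..<n} \<rightarrow>\<^sub>E {..<n}. gram_preserving \<psi>}"

lemma finite_automorphisms: "finite automorphisms"
  by (simp add: automorphisms_def finite_PiE)

lemma id_in_automorphisms: "restrict id {..<n} \<in> automorphisms"
  by (auto simp: automorphisms_def gram_preserving_def)

lemma prod_automorphism:
  "\<alpha> \<in> automorphisms \<Longrightarrow> (\<Prod>v<n. a (\<alpha> v)) = (\<Prod>v<n. a v :: complex)"
  using prod.reindex_bij_betw[OF gram_preserving_bij, of \<alpha> a] by (simp add: automorphisms_def)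

text \<open>Each entry of \<open>xs\<close> gets a vertex of its own, which the Gram conditions
  force onto the point of the old vertex named by the entry. The result is a moment of the weight
  vectors permuted by automorphisms; \<open>weights_unique\<close> separates these vectors.\<close>

lemma sum_gram_indicator:
  assumes "set xs \<subseteq> {..<n}"
  shows "(\<Sum>\<psi>\<in>{..<n + length xs} \<rightarrow>\<^sub>E {..<n}. (\<Prod>v<n + length xs. a (\<psi> v)) *
      frag_eval k u (gram_indicator (n + length xs) (\<lambda>v. if v < n then v else xs ! (v - n))) \<psi> []) =
    (\<Sum>\<alpha>\<in>automorphisms. (\<Prod>v<n. a (\<alpha> v)) * (\<Prod>j\<leftarrow>xs. a (\<alpha> j)))"
proof -
  define s where "s = n + length xs"
  define r where "r v = (if v < n then v else xs ! (v - n))" for v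
  have r: "r v < n" if "v < s" for v
  proof (cases "v < n")
    case False
    then have "v - n < length xs" using that by (simp add: s_def)
    then have "xs ! (v - n) \<in> set xs" by (rule nth_mem)
    then show ?thesis using False assms by (auto simp: r_def)
  qed (simp add: r_def)
  let ?P = "\<lambda>\<psi>. \<forall>v<s. \<forall>w<s. gram k u (\<psi> v) (\<psi> w) = gram k u (r v) (r w)"
  have "(\<Sum>\<psi>\<in>{..<s} \<rightarrow>\<^sub>E {..<n}. (\<Prod>v<s. a (\<psi> v)) * frag_eval k u (gram_indicator s r) \<psi> []) =
    (\<Sum>\<psi>\<in>{..<s} \<rightarrow>\<^sub>E {..<n}. (\<Prod>v<s. a (\<psi> v)) * of_bool (?P \<psi>))"
    by (intro sum.cong refl arg_cong2[where f = "(*)"] frag_eval_gram_indicator) auto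
  also have "\<dots> = (\<Sum>\<psi> | \<psi> \<in> {..<s} \<rightarrow>\<^sub>E {..<n} \<and> ?P \<psi>. \<Prod>v<s. a (\<psi> v))"
    by (rule sum.mono_neutral_cong_right) (auto simp: finite_PiE)
  also have "\<dots> = (\<Sum>\<alpha>\<in>automorphisms. \<Prod>v<s. a (\<alpha> (r v)))"
  \<comment> \<open>Restriction to the first \<open>n\<close> vertices is inverse to extending an
    automorphism along \<open>r\<close>.\<close>
  proof (rule sum.reindex_bij_witness[where i = "\<lambda>\<alpha>. restrict (\<lambda>v. \<alpha> (r v)) {..<s}" and j = "\<lambda>\<psi>. restrict \<psi> {..<n}"])
    fix \<psi> assume psi: "\<psi> \<in> {\<psi> \<in> {..<s} \<rightarrow>\<^sub>E {..<n}. ?P \<psi>}"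
    then have psiE: "\<psi> \<in> {..<s} \<rightarrow>\<^sub>E {..<n}" by blast
    have gp: "gram_preserving \<psi>"
      unfolding gram_preserving_def
    proof (intro conjI allI impI)
      fix v w assume vw: "v < n" "w < n"
      then have s: "v < s" "w < s" and "r v = v" "r w = w" by (auto simp: s_def r_def)
      moreover have "gram k u (\<psi> v) (\<psi> w) = gram k u (r v) (r w)" using psi s by blast
      ultimately show "gram k u (\<psi> v) (\<psi> w) = gram k u v w" by simp
    next
      fix v assume "v < n"
      then have "v \<in> {..<s}" by (simp add: s_def)
      then show "\<psi> v < n" using psiE by auto
    qed
    \<comment> \<open>Against the first \<open>n\<close> vertices, vertex \<open>v\<close> has the
      products of \<open>r v\<close>, so the absence of twins places it on the same point.\<close>
    have eq: "\<psi> (r v) = \<psi> v" if "v < s" for v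
    proof -
      have row: "gram k u (\<psi> v) (\<psi> l) = gram k u (r v) l" if "l < n" for l
      proof -
        have "l < s" "r l = l" using that by (simp_all add: s_def r_def)
        moreover have "gram k u (\<psi> v) (\<psi> l) = gram k u (r v) (r l)"
          using psi \<open>v < s\<close> \<open>l < s\<close> by blast
        ultimately show ?thesis by simp
      qed
      have "\<psi> v < n" using psiE that by auto
      from gram_preserving_eqI[OF gp r[OF that] this row] show ?thesis by (rule sym)
    qed
    show "restrict (\<lambda>v. restrict \<psi> {..<n} (r v)) {..<s} = \<psi>"
    proof
      fix v
      show "restrict (\<lambda>v. restrict \<psi> {..<n} (r v)) {..<s} v = \<psi> v"
        using PiE_arb[OF psiE, of v] eq[of v] r[of v] by (cases "v < s") simp_all
    qed
    show "restrict \<psi> {..<n} \<in> automorphisms"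
      using gp by (auto simp: automorphisms_def gram_preserving_def)
    show "(\<Prod>v<s. a (restrict \<psi> {..<n} (r v))) = (\<Prod>v<s. a (\<psi> v))"
    proof (rule prod.cong[OF refl])
      fix v assume "v \<in> {..<s}"
      then show "a (restrict \<psi> {..<n} (r v)) = a (\<psi> v)" using eq[of v] r[of v] by simp
    qed
  next
    fix \<alpha> assume \<alpha>: "\<alpha> \<in> automorphisms"
    show "restrict (restrict (\<lambda>v. \<alpha> (r v)) {..<s}) {..<n} = \<alpha>"
    proof
      fix v
      show "restrict (restrict (\<lambda>v. \<alpha> (r v)) {..<s}) {..<n} v = \<alpha> v"
        using PiE_arb[of \<alpha> "{..<n}" _ v] \<alpha> by (cases "v < n") (auto simp: automorphisms_def r_def s_def)
    qed
    show "restrict (\<lambda>v. \<alpha> (r v)) {..<s} \<in> {\<psi> \<in> {..<s} \<rightarrow>\<^sub>E {..<n}. ?P \<psi>}"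
      using \<alpha> r by (auto simp: automorphisms_def gram_preserving_def)
  qed
  also have "\<dots> = (\<Sum>\<alpha>\<in>automorphisms. (\<Prod>v<n. a (\<alpha> v)) * (\<Prod>j\<leftarrow>xs. a (\<alpha> j)))"
  proof (rule sum.cong[OF refl])
    fix \<alpha>
    have add: "(\<Prod>v<n + q. g v) = (\<Prod>v<n. g v) * (\<Prod>v<q. g (n + v))" for g :: "nat \<Rightarrow> complex" and q
      by (induction q) (simp_all add: mult_ac)
    have "(\<Prod>v<s. a (\<alpha> (r v))) = (\<Prod>v<n. a (\<alpha> (r v))) * (\<Prod>v<length xs. a (\<alpha> (r (n + v))))"
      unfolding s_def by (rule add)
    also have "\<dots> = (\<Prod>v<n. a (\<alpha> v)) * (\<Prod>v<length xs. a (\<alpha> (xs ! v)))"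
      by (simp add: r_def)
    also have "(\<Prod>v<length xs. a (\<alpha> (xs ! v))) = (\<Prod>j\<leftarrow>xs. a (\<alpha> j))"
      by (simp add: prod.list_conv_set_nth atLeast0LessThan)
    finally show "(\<Prod>v<s. a (\<alpha> (r v))) = (\<Prod>v<n. a (\<alpha> v)) * (\<Prod>j\<leftarrow>xs. a (\<alpha> j))" .
  qed
  finally show ?thesis unfolding s_def r_def .
qed

text \<open>The points \<open>a \<circ> \<alpha>\<close> and \<open>b \<circ> \<beta>\<close>, with
  the products of their coordinates as weights, have the same moments. At the point \<open>a\<close>
  the first total is the number of automorphisms stabilising \<open>a\<close> times the product of
  the entries of \<open>a\<close>. It is nonzero, so the second fibre is inhabited.\<close>

lemma weights_unique:
  assumes nz: "\<And>i. i < n \<Longrightarrow> a i \<noteq> 0"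
    and eq: "\<And>s \<Gamma>. wf_frag s 0 \<Gamma> \<Longrightarrow>
      (\<Sum>\<psi>\<in>{..<s} \<rightarrow>\<^sub>E {..<n}. (\<Prod>v<s. a (\<psi> v)) * frag_eval k u \<Gamma> \<psi> []) =
      (\<Sum>\<psi>\<in>{..<s} \<rightarrow>\<^sub>E {..<n}. (\<Prod>v<s. b (\<psi> v)) * frag_eval k u \<Gamma> \<psi> [])"
  shows "\<exists>\<beta>\<in>automorphisms. \<forall>i<n. b (\<beta> i) = a i"
proof (rule ccontr)
  assume no: "\<not> ?thesis"
  have "(\<Sum>\<alpha>\<in>automorphisms. (\<Prod>v<n. a (\<alpha> v)) * (\<Prod>c\<in>#\<mu>. a (\<alpha> c))) =
     (\<Sum>\<alpha>\<in>automorphisms. (\<Prod>v<n. b (\<alpha> v)) * (\<Prod>c\<in>#\<mu>. b (\<alpha> c)))" if "set_mset \<mu> \<subseteq> {..<n}" for \<mu>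
  proof -
    obtain xs where xs: "mset xs = \<mu>" using ex_mset by blast
    have "set xs \<subseteq> {..<n}" using that xs by auto
    from sum_gram_indicator[OF this, of a] sum_gram_indicator[OF this, of b]
    show ?thesis using eq[OF wf_gram_indicator]
      by (simp add: xs[symmetric] prod_mset_prod_list flip: mset_map)
  qed
  then have *: "(\<Sum>\<alpha> | \<alpha> \<in> automorphisms \<and> (\<forall>c<n. a (\<alpha> c) = a c). \<Prod>v<n. a (\<alpha> v)) =
      (\<Sum>\<beta> | \<beta> \<in> automorphisms \<and> (\<forall>c<n. b (\<beta> c) = a c). \<Prod>v<n. b (\<beta> v))"
    using evaluations_independent[OF finite_automorphisms finite_automorphisms, of n
      "\<lambda>\<alpha>. \<Prod>v<n. a (\<alpha> v)" "\<lambda>\<alpha> c. a (\<alpha> c)" "\<lambda>\<beta>. \<Prod>v<n. b (\<beta> v)" "\<lambda>\<beta> c. b (\<beta> c)" a]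
    by blast
  have "(\<Sum>\<alpha> | \<alpha> \<in> automorphisms \<and> (\<forall>c<n. a (\<alpha> c) = a c). \<Prod>v<n. a (\<alpha> v)) = 0"
  proof -
    have "{\<beta> \<in> automorphisms. \<forall>c<n. b (\<beta> c) = a c} = {}" using no by blast
    then show ?thesis unfolding * by (simp only: sum.empty)
  qed
  moreover have "(\<Sum>\<alpha> | \<alpha> \<in> automorphisms \<and> (\<forall>c<n. a (\<alpha> c) = a c). \<Prod>v<n. a (\<alpha> v)) =
    of_nat (card {\<alpha> \<in> automorphisms. \<forall>c<n. a (\<alpha> c) = a c}) * (\<Prod>v<n. a v)"
    by (simp add: prod_automorphism)
  \<comment> \<open>The identity stabilises \<open>a\<close>.\<close>
  moreover have "card {\<alpha> \<in> automorphisms. \<forall>c<n. a (\<alpha> c) = a c} \<noteq> 0"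
    using id_in_automorphisms finite_automorphisms by (auto simp: card_eq_0_iff)
  ultimately show False using nz by simp
qed

end

subsection \<open>Realising the edge coloring model by points\<close>

locale twin_free_matching = matching_models + twin_free_points +
  assumes weights_nonzero: "i < n \<Longrightarrow> a i \<noteq> 0"
begin

text \<open>Used for \<open>s = n\<close> and \<open>s = n + 1\<close>: the indicator constrains the
  first \<open>n\<close> vertices and leaves the last one free.\<close>

definition gram_functional :: "nat \<Rightarrow> functional" where
  "gram_functional s = frag_act m (gram_indicator n id) [] (vertex_tensor m Y {..<s})"

text \<open>At a configuration that is not Gram preserving the indicator factor vanishes, at the
  others \<open>\<Gamma>\<close> does, so the product vanishes everywhere.\<close>

lemma gram_functional_annihilated:
  assumes "n \<le> s" "wf_frag s t \<Gamma>"
    and 0: "\<And>\<psi> c. \<psi> \<in> {..<s} \<rightarrow>\<^sub>E {..<n} \<Longrightarrow> gram_preserving \<psi> \<Longrightarrow> c \<in> color_lists k t \<Longrightarrow> frag_eval k u \<Gamma> \<psi> c = 0"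
    and c: "c \<in> color_lists m t"
  shows "frag_act m \<Gamma> c (gram_functional s) N = 0"
proof -
  have lc: "length c = t" using c by (simp add: color_lists_def)
  have wf: "wf_frag s (t + 0) (frag_mul \<Gamma> (gram_indicator n id))"
    using assms(1,2) wf_frag_mono[OF wf_gram_indicator] by (intro wf_frag_mul) auto
  have "frag_act m (frag_mul \<Gamma> (gram_indicator n id)) c (vertex_tensor m Y {..<s}) N = 0"
  proof (rule frag_act_eq_0_if_eval_eq_0[OF wf])
    fix \<psi> d assume psi: "\<psi> \<in> {..<s} \<rightarrow>\<^sub>E {..<n}" and d: "d \<in> color_lists k (t + 0)"
    have ld: "length d = t" using d by (simp add: color_lists_def)
    have psin: "\<psi> v < n" if "v < n" for v using PiE_mem[OF psi, of v] that assms(1) by simp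
    have "frag_eval k u (frag_mul \<Gamma> (gram_indicator n id)) \<psi> (d @ []) =
      frag_eval k u \<Gamma> \<psi> d * frag_eval k u (gram_indicator n id) \<psi> []"
      by (rule frag_eval_mul[of s]) (use assms ld in simp)
    also have "\<dots> = 0"
    proof (cases "gram_preserving \<psi>")
      case True
      then show ?thesis using 0[OF psi True] d by simp
    next
      case False
      then have "\<not> (\<forall>v<n. \<forall>w<n. gram k u (\<psi> v) (\<psi> w) = gram k u (id v) (id w))"
        using psin unfolding gram_preserving_def id_apply by blast
      then have "frag_eval k u (gram_indicator n id) \<psi> [] = 0"
        by (subst frag_eval_gram_indicator[OF psin]) (simp_all only: of_bool_eq)
      then show ?thesis by simp
    qed
    finally show "frag_eval k u (frag_mul \<Gamma> (gram_indicator n id)) \<psi> d = 0" by simp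
  qed (use c in simp)
  then show ?thesis
    using frag_act_mul[of s c \<Gamma> m "gram_indicator n id" "[]"] assms(2) lc
    by (simp add: gram_functional_def)
qed

text \<open>The indicator does not involve vertex \<open>n\<close>, whose tensor factor
  \<open>Y\<close> therefore splits off.\<close>

lemma gram_functional_Suc:
  assumes "fst ` set_mset N \<subseteq> {..<n}" "set_mset \<mu> \<subseteq> {..<m}"
  shows "gram_functional (Suc n) (N + image_mset (Pair n) \<mu>) = gram_functional n N * Y \<mu>"
proof -
  have sh: "image_mset (Pair n) \<mu> = shift_vertices n (image_mset (Pair 0) \<mu>)"
    by (simp add: shift_vertices_def image_mset.compositionality comp_def)
  have "gram_functional (n + 1) (N + shift_vertices n (image_mset (Pair 0) \<mu>)) =
     gram_functional n N * vertex_tensor m Y {..<1} (image_mset (Pair 0) \<mu>)"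
    unfolding gram_functional_def
  proof (rule frag_act_left_factor[where s' = 1, OF _ wf_gram_indicator])
    fix N N' :: "(nat \<times> nat) multiset"
    assume "fst ` set_mset N \<subseteq> {..<n}" "fst ` set_mset N' \<subseteq> {..<1}"
    then show "vertex_tensor m Y {..<n + 1} (N + shift_vertices n N') =
        vertex_tensor m Y {..<n} N * vertex_tensor m Y {..<1} N'"
      by (rule vertex_tensor_disjoint_union)
  qed (use assms in auto)
  moreover have "vertex_tensor m Y {..<1} (image_mset (Pair 0) \<mu>) = Y \<mu>"
  proof -
    have "image_mset snd (filter_mset (\<lambda>x. fst x = 0) (image_mset (Pair (0 :: nat)) \<mu>)) = \<mu>"
      by (induction \<mu>) auto
    moreover have "set_mset (image_mset (Pair (0 :: nat)) \<mu>) \<subseteq> {..<1} \<times> {..<m}" using assms(2) by auto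
    ultimately show ?thesis by (simp add: vertex_tensor_def)
  qed
  ultimately show ?thesis by (simp add: sh)
qed

text \<open>At the empty monomial the functional counts the automorphisms, each with the product of
  the entries of \<open>a\<close> as weight.\<close>

lemma gram_functional_nonzero: "gram_functional n {#} \<noteq> 0"
proof -
  have "gram_functional n {#} = (\<Sum>\<psi>\<in>{..<n + length ([] :: nat list)} \<rightarrow>\<^sub>E {..<n}. (\<Prod>v<n + length ([] :: nat list). a (\<psi> v)) *
      frag_eval k u (gram_indicator (n + length ([] :: nat list)) (\<lambda>v. if v < n then v else [] ! (v - n))) \<psi> [])"
    unfolding gram_functional_def
    by (subst frag_act_eq_sum[OF wf_gram_indicator])
      (auto intro!: sum.cong simp: frag_eval_gram_indicator Pi_iff PiE_iff)
  also have "\<dots> = of_nat (card automorphisms) * (\<Prod>v<n. a v)"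
    by (subst sum_gram_indicator) (simp_all add: prod_automorphism)
  finally show ?thesis
    using weights_nonzero id_in_automorphisms finite_automorphisms by (auto simp: card_eq_0_iff)
qed

lemma gram_functional_support:
  "\<not> set_mset N \<subseteq> {..<s} \<times> {..<m} \<Longrightarrow> gram_functional s N = 0"
  unfolding gram_functional_def
  by (rule frag_act_support[of "{..<s} \<times> {..<m}"]) (auto simp: vertex_tensor_support)

text \<open>On a coloring whose first \<open>n\<close> vertices realise the Gram matrix, the last vertex coincides with
  one of them; hence the product of the differences \<open>x\<^sub>n - x\<^sub>l\<close> vanishes there.\<close>

definition end_difference :: "nat \<Rightarrow> fragment list" where
  "end_difference l = frag_end n @ frag_scale (- 1) (frag_end l)"

lemma wf_end_difference: "l < n \<Longrightarrow> wf_frag (Suc n) (Suc 0) (end_difference l)"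
  by (simp add: end_difference_def)

lemma frag_eval_end_differences:
  assumes "set ls \<subseteq> {..<n}" "length c = length ls" "l \<in> set ls" "\<psi> l = \<psi> n"
  shows "frag_eval k u (frag_prod (map end_difference ls)) \<psi> c = 0"
  using assms(1-3)
proof (induction ls arbitrary: c)
  case (Cons l' ls)
  then obtain x c' where c: "c = x # c'" by (cases c) auto
  have "frag_eval k u (frag_mul (end_difference l') (frag_prod (map end_difference ls))) \<psi> ([x] @ c') =
    frag_eval k u (end_difference l') \<psi> [x] * frag_eval k u (frag_prod (map end_difference ls)) \<psi> c'"
    using Cons.prems by (intro frag_eval_mul[of "Suc n"]) (simp add: wf_end_difference)
  moreover have "frag_eval k u (end_difference l') \<psi> [x] = 0 \<or> l \<in> set ls"
    using Cons.prems(3) assms(4) by (auto simp: end_difference_def)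
  ultimately show ?case using Cons c by (auto simp: frag_prod_def)
qed simp

text \<open>The old vertices are evaluated by \<open>gram_functional n\<close>, which leaves a
  polynomial in the single variable of vertex \<open>n\<close> and color \<open>c\<close>. Its top
  term takes the end at \<open>n\<close> from every difference, so that its coefficient is the value
  at \<open>N\<close> alone.\<close>

lemma frag_act_end_differences:
  assumes "set ls \<subseteq> {..<n}" "fst ` set_mset N \<subseteq> {..<n}" "c < m"
  shows "\<exists>p. degree p \<le> length ls \<and> poly.coeff p (length ls) = gram_functional n N \<and>
    (\<forall>\<mu>. set_mset \<mu> \<subseteq> {..<m} \<longrightarrow>
      frag_act m (frag_prod (map end_difference ls)) (replicate (length ls) c) (gram_functional (Suc n))
        (N + image_mset (Pair n) \<mu>) = poly_act p c Y \<mu>)"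
  using assms(1,2)
proof (induction ls arbitrary: N)
  case Nil
  show ?case
    by (rule exI[of _ "[:gram_functional n N:]"])
      (use Nil in \<open>auto simp: frag_prod_def poly_act_pCons gram_functional_Suc\<close>)
next
  case (Cons l ls)
  let ?A = "frag_act m (frag_prod (map end_difference ls)) (replicate (length ls) c) (gram_functional (Suc n))"
  have "fst ` set_mset (add_mset (l, c) N) \<subseteq> {..<n}" using Cons.prems by auto
  from Cons.IH[OF _ this] obtain q where q: "degree q \<le> length ls"
    "\<And>\<mu>. set_mset \<mu> \<subseteq> {..<m} \<Longrightarrow> ?A (add_mset (l, c) N + image_mset (Pair n) \<mu>) = poly_act q c Y \<mu>"
    using Cons.prems by auto
  from Cons.IH[of N] obtain p where p: "degree p \<le> length ls" "poly.coeff p (length ls) = gram_functional n N"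
    "\<And>\<mu>. set_mset \<mu> \<subseteq> {..<m} \<Longrightarrow> ?A (N + image_mset (Pair n) \<mu>) = poly_act p c Y \<mu>"
    using Cons.prems by auto
  have act: "frag_act m (frag_prod (map end_difference (l # ls))) (replicate (length (l # ls)) c) (gram_functional (Suc n)) M =
    ?A (add_mset (n, c) M) - ?A (add_mset (l, c) M)" for M
  proof -
    have "frag_act m (frag_mul (end_difference l) (frag_prod (map end_difference ls))) ([c] @ replicate (length ls) c) (gram_functional (Suc n)) =
      frag_act m (end_difference l) [c] ?A"
      using Cons.prems by (intro frag_act_mul[of "Suc n"]) (simp add: wf_end_difference)
    then show ?thesis by (simp add: frag_prod_def end_difference_def)
  qed
  \<comment> \<open>Multiplication by x_n - x_l turns \<open>p\<close> into X times \<open>p\<close>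
    minus the polynomial \<open>q\<close> belonging to \<open>N\<close> enlarged by the old variable
    \<open>(l, c)\<close>.\<close>
  have "degree (pCons 0 p - smult 1 q) \<le> Suc (length ls)"
    using p(1) q(1) by (intro degree_diff_le le_trans[OF degree_pCons_le]) auto
  moreover have "poly.coeff (pCons 0 p - smult 1 q) (Suc (length ls)) = gram_functional n N"
    using p(2) q(1) by (simp add: coeff_eq_0)
  moreover have "frag_act m (frag_prod (map end_difference (l # ls))) (replicate (length (l # ls)) c) (gram_functional (Suc n))
      (N + image_mset (Pair n) \<mu>) = poly_act (pCons 0 p - smult 1 q) c Y \<mu>" if "set_mset \<mu> \<subseteq> {..<m}" for \<mu>
    unfolding act poly_act_diff_smult poly_act_pCons
    using p(3)[of "add_mset c \<mu>"] q(2)[OF that] that assms(3) by simp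
  ultimately show ?case by (intro exI[of _ "pCons 0 p - smult 1 q"]) simp
qed

text \<open>The \<open>n\<close> old vertices exhaust all points, so vertex \<open>n\<close> meets
  one of them and the product of the \<open>n\<close> differences vanishes. The top coefficient
  \<open>gram_functional n {#}\<close> keeps the polynomial from being zero.\<close>

lemma annihilating_polynomial_vertex:
  assumes "c < m"
  shows "\<exists>p. p \<noteq> 0 \<and> (\<forall>\<mu>. set_mset \<mu> \<subseteq> {..<m} \<longrightarrow> poly_act p c Y \<mu> = 0)"
proof -
  let ?D = "frag_prod (map end_difference [0..<n])"
  obtain p where p: "poly.coeff p n = gram_functional n {#}"
    "\<And>\<mu>. set_mset \<mu> \<subseteq> {..<m} \<Longrightarrow>
      frag_act m ?D (replicate n c) (gram_functional (Suc n)) (image_mset (Pair n) \<mu>) = poly_act p c Y \<mu>"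
    using frag_act_end_differences[of "[0..<n]" "{#}" c] assms by (auto simp: atLeast0LessThan)
  have "frag_act m ?D (replicate n c) (gram_functional (Suc n)) N = 0" for N
  proof (rule gram_functional_annihilated)
    have "wf_frag (Suc n) (length (map end_difference [0..<n]) * Suc 0) ?D"
      by (rule wf_frag_prod) (auto intro: wf_end_difference)
    then show "wf_frag (Suc n) n ?D" by simp
  next
    fix \<psi> d assume psi: "\<psi> \<in> {..<Suc n} \<rightarrow>\<^sub>E {..<n}" "gram_preserving \<psi>" "d \<in> color_lists k n"
    have "\<psi> n \<in> \<psi> ` {..<n}"
      using psi(1) gram_preserving_bij[OF psi(2)] by (auto simp: bij_betw_def)
    then obtain l where "l < n" "\<psi> l = \<psi> n" by auto
    then show "frag_eval k u ?D \<psi> d = 0"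
      using psi(3) by (intro frag_eval_end_differences[of _ d l]) (auto simp: color_lists_def)
  qed (use assms in \<open>auto simp: color_lists_def\<close>)
  then show ?thesis
    using p gram_functional_nonzero by (intro exI[of _ p]) force
qed

text \<open>The polynomial acts on the tensor factor at \<open>v\<close>; the annihilation passes to
  \<open>gram_functional n\<close>, a translate of the tensor.\<close>

lemma annihilating_polynomial:
  assumes "v < n" "c < m"
  shows "\<exists>p. p \<noteq> 0 \<and> (\<forall>N. poly_act p (v, c) (gram_functional n) N = 0)"
proof -
  obtain p where p: "p \<noteq> 0" "\<And>\<mu>. set_mset \<mu> \<subseteq> {..<m} \<Longrightarrow> poly_act p c Y \<mu> = 0"
    using annihilating_polynomial_vertex[OF assms(2)] by blast
  have "poly_act p (v, c) (vertex_tensor m Y {..<n}) N = 0" for N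
  proof (cases "set_mset N \<subseteq> {..<n} \<times> {..<m}")
    case False
    then have "vertex_tensor m Y {..<n} (N + replicate_mset d (v, c)) = 0" for d
      by (intro vertex_tensor_support) (unfold set_mset_union, blast)
    then show ?thesis by (simp only: poly_act_def mult_zero_right sum.neutral_const)
  next
    case True
    let ?N = "\<lambda>w. image_mset snd (filter_mset (\<lambda>x. fst x = w) N)"
    have "vertex_tensor m Y {..<n} (N + replicate_mset d (v, c)) =
      (\<Prod>w\<in>{..<n} - {v}. Y (?N w)) * Y (?N v + replicate_mset d c)" for d
    proof -
      have rng: "set_mset (N + replicate_mset d (v, c)) \<subseteq> {..<n} \<times> {..<m}"
        using True assms by (auto split: if_splits)
      have fil: "image_mset snd (filter_mset (\<lambda>x. fst x = w) (N + replicate_mset d (v, c))) =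
          ?N w + (if w = v then replicate_mset d c else {#})" for w
        by (induction d) auto
      have "vertex_tensor m Y {..<n} (N + replicate_mset d (v, c)) =
        (\<Prod>w<n. Y (?N w + (if w = v then replicate_mset d c else {#})))"
        using rng unfolding vertex_tensor_def fil by simp
      also have "\<dots> = Y (?N v + replicate_mset d c) * (\<Prod>w\<in>{..<n} - {v}. Y (?N w + (if w = v then replicate_mset d c else {#})))"
        using assms by (subst prod.remove[of _ v]) auto
      also have "(\<Prod>w\<in>{..<n} - {v}. Y (?N w + (if w = v then replicate_mset d c else {#}))) = (\<Prod>w\<in>{..<n} - {v}. Y (?N w))"
        by (intro prod.cong) auto
      finally show ?thesis by (simp add: mult.commute)
    qed
    then have "poly_act p (v, c) (vertex_tensor m Y {..<n}) N = (\<Prod>w\<in>{..<n} - {v}. Y (?N w)) * poly_act p c Y (?N v)"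
      by (simp add: poly_act_def sum_distrib_left mult_ac)
    also have "poly_act p c Y (?N v) = 0"
      using True by (intro p(2)) auto
    finally show ?thesis by simp
  qed
  then have "poly_act p (v, c) (gram_functional n) N = 0" for N
    unfolding gram_functional_def by (rule poly_act_eq_0_translates[OF frag_act_in_translates])
  then show ?thesis using p(1) by blast
qed

text \<open>A joint eigenfunctional \<open>f\<close> on \<open>n\<close> vertices is extended to
  \<open>f \<otimes> Y\<close> on \<open>n + 1\<close> vertices. The row indicators split this
  functional according to the old vertex met by the last one, and on each piece the last vertex has
  the fixed coordinates \<open>w i\<close>.\<close>

lemma realising_points:
  "\<exists>b w. (\<forall>i<n. \<forall>j<n. gram m w i j = gram k u i j) \<and>
     (\<forall>\<mu>. set_mset \<mu> \<subseteq> {..<m} \<longrightarrow> Y \<mu> = point_value n b w \<mu>)"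
proof -
  let ?S = "{..<n} \<times> {..<m}"
  let ?L = "gram_functional n"
  have "\<exists>f\<in>translates ?S ?L. (\<exists>M'. f M' \<noteq> 0) \<and> (\<exists>\<omega>. \<forall>x\<in>?S. \<forall>N. f (add_mset x N) = \<omega> x * f N)"
    by (rule joint_eigenfunctional[where M = "{#}"]) (use annihilating_polynomial gram_functional_nonzero in auto)
  then obtain f M' \<omega> where f: "f \<in> translates ?S ?L" "f M' \<noteq> 0" and \<omega>: "\<forall>x\<in>?S. \<forall>N. f (add_mset x N) = \<omega> x * f N"
    by (elim bexE conjE exE)
  define w where "w i c = \<omega> (i, c)" for i c
  have fsupp: "f N = 0" if "\<not> set_mset N \<subseteq> ?S" for N
    by (rule translates_eq_0[OF f(1) _ that]) (rule gram_functional_support)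
  have fprod: "f N = (\<Prod>x\<in>#N. \<omega> x) * f {#}" if "set_mset N \<subseteq> ?S" for N
    using \<omega> that by (intro eigenfunctional_eq_prod[of ?S]) auto
  have f0: "f {#} \<noteq> 0"
  proof
    assume "f {#} = 0"
    then have "f M' = 0" using fprod[of M'] fsupp[of M'] by (cases "set_mset M' \<subseteq> ?S") simp_all
    then show False using f(2) by simp
  qed
  have gram: "gram m w i j = gram k u i j" if ij: "i < n" "j < n" for i j
  proof -
    \<comment> \<open>The Gram relation annihilates the functional and hence \<open>f\<close>, for
      which the variables are numbers.\<close>
    let ?X = "frag_edge i j @ frag_const (- gram k u i j)"
    have "frag_act m ?X [] ?L N = 0" for N
    proof (rule gram_functional_annihilated)
      show "wf_frag n 0 ?X" using ij by simp
    next
      fix \<psi> c assume "gram_preserving \<psi>"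
      then show "frag_eval k u ?X \<psi> c = 0" using ij by (simp add: gram_preserving_def)
    qed simp_all
    from frag_act_eq_0_translates[OF f(1) this]
    have "frag_act m ?X [] f {#} = 0" .
    then have "(\<Sum>x<m. f {#(i, x), (j, x)#}) = gram k u i j * f {#}" by simp
    also have "(\<Sum>x<m. f {#(i, x), (j, x)#}) = (\<Sum>x<m. w i x * w j x) * f {#}"
      using \<omega> ij unfolding sum_distrib_right by (intro sum.cong) (auto simp: w_def)
    finally show ?thesis using f0 by (simp add: gram_def)
  qed
  \<comment> \<open>The operations producing \<open>f\<close> involve only the first
    \<open>n\<close> vertices; repeated on \<open>n + 1\<close> vertices they produce
    \<open>f\<close> tensored with \<open>Y\<close>.\<close>
  have "\<exists>f'\<in>translates ?S (gram_functional (Suc n)). \<forall>N \<mu>. fst ` set_mset N \<subseteq> {..<n} \<longrightarrow> set_mset \<mu> \<subseteq> {..<m} \<longrightarrow>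
      f' (N + image_mset (Pair n) \<mu>) = f N * Y \<mu>"
    using f(1)
  proof (induction rule: translates.induct)
    case base
    then show ?case using gram_functional_Suc translates.base by blast
  next
    case (shift f x)
    then obtain f' where f': "f' \<in> translates ?S (gram_functional (Suc n))"
      "\<And>N \<mu>. fst ` set_mset N \<subseteq> {..<n} \<Longrightarrow> set_mset \<mu> \<subseteq> {..<m} \<Longrightarrow> f' (N + image_mset (Pair n) \<mu>) = f N * Y \<mu>"
      by blast
    have "f' (add_mset x (N + image_mset (Pair n) \<mu>)) = f (add_mset x N) * Y \<mu>"
      if "fst ` set_mset N \<subseteq> {..<n}" "set_mset \<mu> \<subseteq> {..<m}" for N \<mu>
      using f'(2)[of "add_mset x N" \<mu>] that shift.hyps(2) by auto
    then show ?case using translates.shift[OF f'(1) shift.hyps(2)] by (intro bexI[of _ "\<lambda>N. f' (add_mset x N)"]) auto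
  next
    case (add f g)
    then obtain f' g' where f': "f' \<in> translates ?S (gram_functional (Suc n))"
      "\<And>N \<mu>. fst ` set_mset N \<subseteq> {..<n} \<Longrightarrow> set_mset \<mu> \<subseteq> {..<m} \<Longrightarrow> f' (N + image_mset (Pair n) \<mu>) = f N * Y \<mu>"
      and g': "g' \<in> translates ?S (gram_functional (Suc n))"
      "\<And>N \<mu>. fst ` set_mset N \<subseteq> {..<n} \<Longrightarrow> set_mset \<mu> \<subseteq> {..<m} \<Longrightarrow> g' (N + image_mset (Pair n) \<mu>) = g N * Y \<mu>"
      by blast
    show ?case
      using translates.add[OF f'(1) g'(1)] f'(2) g'(2)
      by (intro bexI[of _ "\<lambda>N. f' N + g' N"]) (simp_all add: distrib_right)
  next
    case (cmult f \<kappa>)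
    then obtain f' where f': "f' \<in> translates ?S (gram_functional (Suc n))"
      "\<And>N \<mu>. fst ` set_mset N \<subseteq> {..<n} \<Longrightarrow> set_mset \<mu> \<subseteq> {..<m} \<Longrightarrow> f' (N + image_mset (Pair n) \<mu>) = f N * Y \<mu>"
      by blast
    show ?case
      using translates.cmult[OF f'(1), of \<kappa>] f'(2)
      by (intro bexI[of _ "\<lambda>N. \<kappa> * f' N"]) simp_all
  qed
  then obtain f' where f': "f' \<in> translates ?S (gram_functional (Suc n))"
    "\<And>N \<mu>. fst ` set_mset N \<subseteq> {..<n} \<Longrightarrow> set_mset \<mu> \<subseteq> {..<m} \<Longrightarrow> f' (N + image_mset (Pair n) \<mu>) = f N * Y \<mu>"
    by blast
  have f'supp: "f' N = 0" if "\<not> set_mset N \<subseteq> {..<Suc n} \<times> {..<m}" for N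
    by (rule translates_eq_0[OF f'(1) _ that]) (rule gram_functional_support)
  have f'eigen: "f' (add_mset (i, c) N) = w i c * f' N" if ic: "i < n" "c < m" for i c N
  proof (cases "set_mset N \<subseteq> {..<Suc n} \<times> {..<m}")
    case False
    then show ?thesis using f'supp[of N] f'supp[of "add_mset (i, c) N"] by simp
  next
    case True
    \<comment> \<open>Separating the variables of vertex \<open>n\<close> exposes the product form
      of \<open>f'\<close>.\<close>
    define N1 where "N1 = filter_mset (\<lambda>x. fst x \<noteq> n) N"
    define \<mu> where "\<mu> = image_mset snd (filter_mset (\<lambda>x. fst x = n) N)"
    have "image_mset (Pair n) \<mu> = image_mset id (filter_mset (\<lambda>x. fst x = n) N)"
      unfolding \<mu>_def image_mset.compositionality comp_def
      by (rule image_mset_cong) auto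
    then have N: "N = N1 + image_mset (Pair n) \<mu>"
      unfolding N1_def using multiset_partition[of N "\<lambda>x. fst x \<noteq> n"] by simp
    have rng: "fst ` set_mset N1 \<subseteq> {..<n}" "set_mset \<mu> \<subseteq> {..<m}"
      using True by (force simp: N1_def \<mu>_def subset_iff)+
    have "f' (add_mset (i, c) N) = f (add_mset (i, c) N1) * Y \<mu>"
      using f'(2)[of "add_mset (i, c) N1" \<mu>] rng ic by (simp add: N)
    also have "\<dots> = w i c * f' N"
      using f'(2)[OF rng] \<omega> ic by (simp add: N w_def)
    finally show ?thesis .
  qed
  \<comment> \<open>The part of \<open>f'\<close> in which the last vertex meets vertex
    \<open>i\<close>.\<close>
  define G where "G i = frag_act m (row_indicator i) [] f'" for i
  have Geigen: "G i (add_mset (n, c) N) = w i c * G i N" if ic: "i < n" "c < m" for i c N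
  proof -
    \<comment> \<open>Where the row condition holds, the last vertex lies on vertex \<open>i\<close>
      and the difference vanishes.\<close>
    let ?X = "frag_mul (end_difference i) (row_indicator i)"
    have "frag_act m ?X [c] (gram_functional (Suc n)) N = 0" for N
    proof (rule gram_functional_annihilated)
      show "wf_frag (Suc n) 1 ?X"
        using wf_frag_mul[OF wf_end_difference[OF ic(1)] wf_row_indicator[of i]] by simp
    next
      fix \<psi> d assume psi: "\<psi> \<in> {..<Suc n} \<rightarrow>\<^sub>E {..<n}" "gram_preserving \<psi>" "d \<in> color_lists k 1"
      then obtain x where d: "d = [x]" by (auto simp: color_lists_def length_Suc_conv)
      have "frag_eval k u ?X \<psi> ([x] @ []) = frag_eval k u (end_difference i) \<psi> [x] * frag_eval k u (row_indicator i) \<psi> []"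
        by (rule frag_eval_mul[of "Suc n"]) (simp add: wf_end_difference ic)
      moreover have "\<psi> n = \<psi> i" if "\<forall>l<n. gram k u (\<psi> n) (\<psi> l) = gram k u i l"
      proof -
        have "\<psi> n < n" using PiE_mem[OF psi(1), of n] by simp
        then show ?thesis using gram_preserving_eqI[OF psi(2) ic(1)] that by blast
      qed
      moreover have "frag_eval k u (row_indicator i) \<psi> [] = of_bool (\<forall>l<n. gram k u (\<psi> n) (\<psi> l) = gram k u i l)"
        using PiE_mem[OF psi(1)] by (intro frag_eval_row_indicator) simp
      ultimately show "frag_eval k u ?X \<psi> d = 0" by (auto simp: d end_difference_def)
    qed (use ic in \<open>auto simp: color_lists_def\<close>)
    from frag_act_eq_0_translates[OF f'(1) this]
    have "frag_act m ?X ([c] @ []) f' N = 0" by simp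
    moreover have "frag_act m ?X ([c] @ []) f' = frag_act m (end_difference i) [c] (G i)"
      unfolding G_def by (rule frag_act_mul[of "Suc n"]) (simp add: wf_end_difference ic)
    ultimately have "G i (add_mset (n, c) N) = G i (add_mset (i, c) N)"
      by (simp add: end_difference_def)
    also have "\<dots> = frag_act m (row_indicator i) [] (\<lambda>N. f' (N + {#(i, c)#})) N"
      unfolding frag_act_shift by (simp add: G_def)
    also have "(\<lambda>N. f' (N + {#(i, c)#})) = (\<lambda>N. w i c * f' N)"
      using f'eigen[OF ic] by simp
    finally show ?thesis by (simp add: frag_act_cmult G_def)
  qed
  have Gprod: "G i (image_mset (Pair n) \<mu>) = (\<Prod>c\<in>#\<mu>. w i c) * G i {#}" if "i < n" "set_mset \<mu> \<subseteq> {..<m}" for i \<mu>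
    using that(2) by (induction \<mu>) (use that(1) Geigen in auto)
  \<comment> \<open>At a Gram preserving configuration exactly one row condition holds, so the
    indicators add up to 1.\<close>
  have sumG: "(\<Sum>i<n. G i N) = f' N" for N
  proof -
    let ?X = "concat (map row_indicator [0..<n]) @ frag_const (- 1)"
    have wfc: "wf_frag (Suc n) 0 (concat (map row_indicator is))" for "is"
      using wf_row_indicator by (induction "is") auto
    have evc: "frag_eval k u (concat (map row_indicator is)) \<psi> c = (\<Sum>i\<leftarrow>is. frag_eval k u (row_indicator i) \<psi> c)" for "is" \<psi> c
      by (induction "is") auto
    have actc: "frag_act m (concat (map row_indicator is)) c L N = (\<Sum>i\<leftarrow>is. frag_act m (row_indicator i) c L N)" for "is" c L N
      by (induction "is") auto
    have "frag_act m ?X [] (gram_functional (Suc n)) N = 0" for N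
    proof (rule gram_functional_annihilated)
      show "wf_frag (Suc n) 0 ?X" using wfc by simp
    next
      fix \<psi> d assume psi: "\<psi> \<in> {..<Suc n} \<rightarrow>\<^sub>E {..<n}" "gram_preserving \<psi>" "d \<in> color_lists k 0"
      have "\<psi> n \<in> \<psi> ` {..<n}"
        using psi(1) gram_preserving_bij[OF psi(2)] by (auto simp: bij_betw_def)
      then obtain i where i: "i < n" "\<psi> n = \<psi> i" by auto
      have "frag_eval k u (row_indicator j) \<psi> [] = of_bool (j = i)" if "j < n" for j
      proof -
        have "(\<forall>l<n. gram k u (\<psi> n) (\<psi> l) = gram k u j l) \<longleftrightarrow> j = i"
        proof
          assume *: "\<forall>l<n. gram k u (\<psi> n) (\<psi> l) = gram k u j l"
          show "j = i"
          proof (rule twin_free[OF that i(1)])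
            fix l assume "l < n"
            then have "gram k u (\<psi> i) (\<psi> l) = gram k u i l"
              using psi(2) i(1) unfolding gram_preserving_def by blast
            then show "gram k u j l = gram k u i l" using * \<open>l < n\<close> i(2) by simp
          qed
        next
          assume "j = i"
          then show "\<forall>l<n. gram k u (\<psi> n) (\<psi> l) = gram k u j l"
            using psi(2) i by (simp add: gram_preserving_def)
        qed
        moreover have "frag_eval k u (row_indicator j) \<psi> [] = of_bool (\<forall>l<n. gram k u (\<psi> n) (\<psi> l) = gram k u j l)"
          using PiE_mem[OF psi(1)] by (intro frag_eval_row_indicator) simp
        ultimately show ?thesis by simp
      qed
      then have "(\<Sum>j\<leftarrow>[0..<n]. frag_eval k u (row_indicator j) \<psi> []) = (\<Sum>j<n. of_bool (j = i))"
        by (simp add: interv_sum_list_conv_sum_set_nat atLeast0LessThan)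
      also have "\<dots> = 1" using i(1) by (simp add: of_bool_def)
      finally show "frag_eval k u ?X \<psi> d = 0" using psi(3) by (simp add: evc)
    qed simp_all
    from frag_act_eq_0_translates[OF f'(1) this]
    have "frag_act m ?X [] f' N = 0" .
    then show ?thesis
      by (simp add: actc G_def interv_sum_list_conv_sum_set_nat atLeast0LessThan)
  qed
  \<comment> \<open>On monomials in the last vertex alone, \<open>f'\<close> is
    \<open>f {#} * Y \<mu>\<close>; dividing by \<open>f {#}\<close> gives the weights.\<close>
  have "Y \<mu> = point_value n (\<lambda>i. G i {#} / f {#}) w \<mu>" if "set_mset \<mu> \<subseteq> {..<m}" for \<mu>
  proof -
    have "f {#} * Y \<mu> = f' (image_mset (Pair n) \<mu>)" using f'(2)[of "{#}" \<mu>] that by simp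
    also have "\<dots> = (\<Sum>i<n. (\<Prod>c\<in>#\<mu>. w i c) * G i {#})"
      unfolding sumG[symmetric] using Gprod that by simp
    finally have "Y \<mu> = (\<Sum>i<n. (\<Prod>c\<in>#\<mu>. w i c) * G i {#}) / f {#}"
      using f0 by (simp add: field_simps)
    then show ?thesis by (simp add: point_value_def sum_divide_distrib mult_ac)
  qed
  then show ?thesis using gram by blast
qed

text \<open>The points \<open>w\<close> have the Gram matrix of \<open>u\<close>, so closed graphs
  compare the weights \<open>b\<close> and \<open>a\<close> over the same matrix. They differ by an
  automorphism, along which the points are relabelled.\<close>

theorem realising_points_with_weights:
  "\<exists>w. (\<forall>i<n. \<forall>j<n. gram m w i j = gram k u i j) \<and>
     (\<forall>\<mu>. set_mset \<mu> \<subseteq> {..<m} \<longrightarrow> Y \<mu> = point_value n a w \<mu>)"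
proof -
  obtain b w where gram: "\<And>i j. i < n \<Longrightarrow> j < n \<Longrightarrow> gram m w i j = gram k u i j"
    and Y: "\<And>\<mu>. set_mset \<mu> \<subseteq> {..<m} \<Longrightarrow> Y \<mu> = point_value n b w \<mu>"
    using realising_points by blast
  have vt: "vertex_tensor m Y V = vertex_tensor m (point_value n b w) V" for V
    by (intro ext) (force simp: vertex_tensor_def intro!: prod.cong Y)
  have "(\<Sum>\<psi>\<in>{..<s} \<rightarrow>\<^sub>E {..<n}. (\<Prod>v<s. a (\<psi> v)) * frag_eval k u \<Gamma> \<psi> []) =
      (\<Sum>\<psi>\<in>{..<s} \<rightarrow>\<^sub>E {..<n}. (\<Prod>v<s. b (\<psi> v)) * frag_eval k u \<Gamma> \<psi> [])"
    if wf: "wf_frag s 0 \<Gamma>" for s \<Gamma>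
  proof -
    have "frag_eval m w \<Gamma> \<psi> [] = frag_eval k u \<Gamma> \<psi> []" if "\<psi> \<in> {..<s} \<rightarrow>\<^sub>E {..<n}" for \<psi>
    proof -
      have "(\<Prod>e\<leftarrow>E. gram m w (\<psi> (fst e)) (\<psi> (snd e))) = (\<Prod>e\<leftarrow>E. gram k u (\<psi> (fst e)) (\<psi> (snd e)))"
        if "(l, E, \<tau>) \<in> set \<Gamma>" for l E \<tau>
        using that wf \<open>\<psi> \<in> _\<close> by (intro arg_cong[where f = prod_list] map_cong refl gram) (fastforce simp: wf_frag_def)+
      then show ?thesis
        unfolding frag_eval_def by (intro arg_cong[where f = sum_list] map_cong refl) auto
    qed
    then have "(\<Sum>\<psi>\<in>{..<s} \<rightarrow>\<^sub>E {..<n}. (\<Prod>v<s. b (\<psi> v)) * frag_eval k u \<Gamma> \<psi> []) =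
       (\<Sum>\<psi>\<in>{..<s} \<rightarrow>\<^sub>E {..<n}. (\<Prod>v<s. b (\<psi> v)) * frag_eval m w \<Gamma> \<psi> [])"
      by (intro sum.cong) auto
    also have "\<dots> = frag_act m \<Gamma> [] (vertex_tensor m Y {..<s}) {#}"
      unfolding vt by (rule frag_act_point_value[OF wf, symmetric]) simp
    finally show ?thesis by (simp add: frag_act_eq_sum[OF wf])
  qed
  from weights_unique[OF weights_nonzero this]
  obtain \<beta> where \<beta>: "\<beta> \<in> automorphisms" "\<And>i. i < n \<Longrightarrow> b (\<beta> i) = a i" by blast
  have gp: "gram_preserving \<beta>" using \<beta>(1) by (simp add: automorphisms_def)
  have "Y \<mu> = point_value n a (\<lambda>i. w (\<beta> i)) \<mu>" if "set_mset \<mu> \<subseteq> {..<m}" for \<mu>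
  proof -
    have "Y \<mu> = (\<Sum>i<n. b i * (\<Prod>c\<in>#\<mu>. w i c))" using Y[OF that] by (simp add: point_value_def)
    also have "\<dots> = (\<Sum>i<n. b (\<beta> i) * (\<Prod>c\<in>#\<mu>. w (\<beta> i) c))"
      by (rule sum.reindex_bij_betw[OF gram_preserving_bij[OF gp], symmetric])
    finally show ?thesis by (simp add: point_value_def \<beta>(2))
  qed
  moreover have "gram m (\<lambda>i. w (\<beta> i)) i j = gram k u i j" if "i < n" "j < n" for i j
  proof -
    have "gram m (\<lambda>i. w (\<beta> i)) i j = gram m w (\<beta> i) (\<beta> j)" by (simp add: gram_def)
    also have "\<dots> = gram k u i j" using gp that by (simp add: gram gram_preserving_def)
    finally show ?thesis .
  qed
  ultimately show ?thesis by blast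
qed

end

subsection \<open>Extending isometries\<close>

definition reflection :: "nat \<Rightarrow> complex vec \<Rightarrow> complex mat" where
  "reflection l d = mat l l (\<lambda>(i, j). (if i = j then 1 else 0) - 2 * d $ i * d $ j / (d \<bullet> d))"

lemma reflection_carrier [simp]: "reflection l d \<in> carrier_mat l l"
  by (simp add: reflection_def)

lemma reflection_mult_vec:
  assumes "d \<in> carrier_vec l" "v \<in> carrier_vec l"
  shows "reflection l d *\<^sub>v v = v - (2 * (d \<bullet> v) / (d \<bullet> d)) \<cdot>\<^sub>v d"
proof (rule eq_vecI)
  fix i assume "i < dim_vec (v - (2 * (d \<bullet> v) / (d \<bullet> d)) \<cdot>\<^sub>v d)"
  then have i: "i < l" using assms by simp
  have "(reflection l d *\<^sub>v v) $ i = (\<Sum>j<l. ((if i = j then 1 else 0) - 2 * d $ i * d $ j / (d \<bullet> d)) * v $ j)"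
    using i assms by (simp add: reflection_def scalar_prod_def atLeast0LessThan)
  also have "\<dots> = (\<Sum>j<l. (if i = j then v $ j else 0) - 2 * d $ i / (d \<bullet> d) * (d $ j * v $ j))"
    by (intro sum.cong) (auto simp: algebra_simps)
  also have "\<dots> = v $ i - 2 * d $ i / (d \<bullet> d) * (\<Sum>j<l. d $ j * v $ j)"
    using i by (simp add: sum_subtractf sum_distrib_left)
  also have "(\<Sum>j<l. d $ j * v $ j) = d \<bullet> v"
    using assms by (simp add: scalar_prod_def atLeast0LessThan)
  finally show "(reflection l d *\<^sub>v v) $ i = (v - (2 * (d \<bullet> v) / (d \<bullet> d)) \<cdot>\<^sub>v d) $ i"
    using i assms by simp
qed (use assms in \<open>simp add: reflection_def\<close>)

lemma reflection_fixes:
  assumes "d \<in> carrier_vec l" "v \<in> carrier_vec l" "d \<bullet> v = 0"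
  shows "reflection l d *\<^sub>v v = v"
  unfolding reflection_mult_vec[OF assms(1,2)] assms(3) using assms(1,2) by (intro eq_vecI) simp_all

lemma reflection_orthogonal:
  assumes d: "d \<in> carrier_vec l" and "d \<bullet> d \<noteq> 0"
  shows "reflection l d \<in> complex_orthogonal_group l"
proof -
  have "(reflection l d *\<^sub>v v) \<bullet> (reflection l d *\<^sub>v v) = v \<bullet> v" if v: "v \<in> carrier_vec l" for v
  proof -
    define t where "t = 2 * (d \<bullet> v) / (d \<bullet> d)"
    have t: "t * (d \<bullet> d) = 2 * (d \<bullet> v)" using assms(2) by (simp add: t_def)
    have "(v - t \<cdot>\<^sub>v d) \<bullet> (v - t \<cdot>\<^sub>v d) = v \<bullet> v - t * (v \<bullet> d) - (t * (d \<bullet> v) - t * (t * (d \<bullet> d)))"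
      using d v by (simp add: minus_scalar_prod_distrib[of _ l] scalar_prod_minus_distrib[of _ l] algebra_simps)
    also have "\<dots> = v \<bullet> v"
      unfolding t comm_scalar_prod[OF v d] by simp
    finally show ?thesis using d v by (simp add: reflection_mult_vec t_def)
  qed
  then show ?thesis by (simp add: complex_orthogonal_group_def)
qed

lemma orthogonal_mult:
  assumes "g \<in> complex_orthogonal_group l" "h \<in> complex_orthogonal_group l"
  shows "g * h \<in> complex_orthogonal_group l"
proof -
  have g: "g \<in> carrier_mat l l" "h \<in> carrier_mat l l"
    using assms by (simp_all add: complex_orthogonal_group_def)
  have "((g * h) *\<^sub>v v) \<bullet> ((g * h) *\<^sub>v v) = v \<bullet> v" if v: "v \<in> carrier_vec l" for v
  proof -
    have "h *\<^sub>v v \<in> carrier_vec l" using g(2) v by (rule mult_mat_vec_carrier)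
    then show ?thesis
      using assms v unfolding assoc_mult_mat_vec[OF g v] by (simp add: complex_orthogonal_group_def)
  qed
  then show ?thesis using g by (simp add: complex_orthogonal_group_def)
qed

lemma orthogonal_one: "1\<^sub>m l \<in> complex_orthogonal_group l"
  by (auto simp: complex_orthogonal_group_def)

text \<open>By polarization, the group being defined through the quadratic form.\<close>

lemma orthogonal_scalar_prod:
  assumes g: "g \<in> complex_orthogonal_group l" and x: "x \<in> carrier_vec l" and y: "y \<in> carrier_vec l"
  shows "(g *\<^sub>v x) \<bullet> (g *\<^sub>v y) = x \<bullet> y"
proof -
  have gc: "g \<in> carrier_mat l l" and q: "\<And>v. v \<in> carrier_vec l \<Longrightarrow> (g *\<^sub>v v) \<bullet> (g *\<^sub>v v) = v \<bullet> v"
    using g by (auto simp: complex_orthogonal_group_def)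
  have gx: "g *\<^sub>v x \<in> carrier_vec l" "g *\<^sub>v y \<in> carrier_vec l" using gc x y by auto
  have pol: "(a + b) \<bullet> (a + b) = a \<bullet> a + 2 * (a \<bullet> b) + b \<bullet> b"
    if "a \<in> carrier_vec l" "b \<in> carrier_vec l" for a b :: "complex vec"
    using that comm_scalar_prod[OF that]
    by (simp add: add_scalar_prod_distrib[of _ l] scalar_prod_add_distrib[of _ l])
  have "(g *\<^sub>v (x + y)) \<bullet> (g *\<^sub>v (x + y)) = (x + y) \<bullet> (x + y)" using x y q by simp
  also have "g *\<^sub>v (x + y) = g *\<^sub>v x + g *\<^sub>v y" using gc x y by (rule mult_add_distrib_mat_vec)
  finally show ?thesis using pol[OF gx] pol[OF x y] q[OF x] q[OF y] by simp
qed

text \<open>One of \<open>p - q\<close> and \<open>p + q\<close> is anisotropic, so one or two reflections map \<open>p\<close> to \<open>q\<close>.\<close>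

lemma orthogonal_moves_unit_vector:
  assumes p: "p \<in> carrier_vec l" "p \<bullet> p = 1" and q: "q \<in> carrier_vec l" "q \<bullet> q = 1"
  shows "\<exists>g\<in>complex_orthogonal_group l. g *\<^sub>v p = q \<and>
    (\<forall>v\<in>carrier_vec l. v \<bullet> p = 0 \<longrightarrow> v \<bullet> q = 0 \<longrightarrow> g *\<^sub>v v = v)"
proof (cases "p \<bullet> q = 1")
  case False
  let ?d = "p - q"
  have qp: "q \<bullet> p = p \<bullet> q" using p q by (intro comm_scalar_prod)
  have d: "?d \<in> carrier_vec l" using p q by simp
  have dd: "?d \<bullet> ?d = 2 - 2 * (p \<bullet> q)"
    using p q qp by (simp add: minus_scalar_prod_distrib[of _ l] scalar_prod_minus_distrib[of _ l])
  have dp: "?d \<bullet> p = 1 - p \<bullet> q" using p q qp by (simp add: minus_scalar_prod_distrib[of _ l])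
  have nz: "?d \<bullet> ?d \<noteq> 0" using False dd by auto
  have one: "2 * (?d \<bullet> p) / (?d \<bullet> ?d) = 1" using nz unfolding dd dp by (simp add: field_simps)
  have "reflection l ?d *\<^sub>v p = q"
    unfolding reflection_mult_vec[OF d p(1)] one using p q by (intro eq_vecI) auto
  moreover have "reflection l ?d *\<^sub>v v = v" if v: "v \<in> carrier_vec l" "v \<bullet> p = 0" "v \<bullet> q = 0" for v
  proof (rule reflection_fixes[OF d v(1)])
    show "?d \<bullet> v = 0"
      using p q v comm_scalar_prod[OF v(1) p(1)] comm_scalar_prod[OF v(1) q(1)]
      by (simp add: minus_scalar_prod_distrib[of _ l])
  qed
  ultimately show ?thesis using reflection_orthogonal[OF d nz] by blast
next
  case True
  let ?d = "p + q"
  have qp: "q \<bullet> p = 1" using comm_scalar_prod[OF q(1) p(1)] True by simp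
  have d: "?d \<in> carrier_vec l" using p q by simp
  have dd: "?d \<bullet> ?d = 4"
    using p q qp True by (simp add: add_scalar_prod_distrib[of _ l] scalar_prod_add_distrib[of _ l])
  have dp: "?d \<bullet> p = 2" using p q qp by (simp add: add_scalar_prod_distrib[of _ l])
  have "reflection l ?d *\<^sub>v p = - q"
    unfolding reflection_mult_vec[OF d p(1)] dd dp using p q by (intro eq_vecI) auto
  \<comment> \<open>The reflection in \<open>p + q\<close> ends at \<open>- q\<close>; the one in
    \<open>q\<close> corrects the sign.\<close>
  moreover have "reflection l q *\<^sub>v (- q) = q"
    using q by (subst reflection_mult_vec) (auto intro!: eq_vecI)
  ultimately have "(reflection l q * reflection l ?d) *\<^sub>v p = q"
    using p(1) by (simp add: assoc_mult_mat_vec[of _ l l _ l])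
  moreover have "(reflection l q * reflection l ?d) *\<^sub>v v = v" if v: "v \<in> carrier_vec l" "v \<bullet> p = 0" "v \<bullet> q = 0" for v
  proof -
    have "?d \<bullet> v = 0" "q \<bullet> v = 0"
      using p q v comm_scalar_prod[OF v(1) p(1)] comm_scalar_prod[OF v(1) q(1)]
      by (simp_all add: add_scalar_prod_distrib[of _ l])
    then show ?thesis
      using v(1) d q by (simp add: assoc_mult_mat_vec[of _ l l _ l] reflection_fixes)
  qed
  ultimately show ?thesis
    using orthogonal_mult[OF reflection_orthogonal[OF q(1)] reflection_orthogonal[OF d]] q(2) dd by auto
qed

text \<open>The map that corrects the image of \<open>e q\<close> to \<open>f q\<close> fixes all
  vectors orthogonal to both, among them the images \<open>f i\<close> reached before.\<close>

lemma orthogonal_maps_orthonormal: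
  fixes e f :: "nat \<Rightarrow> complex vec"
  assumes "\<And>i. i < r \<Longrightarrow> e i \<in> carrier_vec l" "\<And>i. i < r \<Longrightarrow> f i \<in> carrier_vec l"
    and "\<And>i j. i < r \<Longrightarrow> j < r \<Longrightarrow> e i \<bullet> e j = of_bool (i = j)"
    and "\<And>i j. i < r \<Longrightarrow> j < r \<Longrightarrow> f i \<bullet> f j = of_bool (i = j)"
  shows "\<exists>g\<in>complex_orthogonal_group l. \<forall>i<r. g *\<^sub>v e i = f i"
proof -
  have "\<exists>g\<in>complex_orthogonal_group l. \<forall>i<q. g *\<^sub>v e i = f i" if "q \<le> r" for q
    using that
  proof (induction q)
    case 0
    show ?case by (rule bexI[OF _ orthogonal_one]) simp
  next
    case (Suc q)
    have e: "e i \<in> carrier_vec l" "f i \<in> carrier_vec l" if "i \<le> q" for i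
      using assms(1,2)[of i] that Suc.prems by simp_all
    have ee: "e i \<bullet> e q = of_bool (i = q)" "f i \<bullet> f q = of_bool (i = q)" if "i \<le> q" for i
      using assms(3,4)[of i q] that Suc.prems by simp_all
    have "\<exists>g\<in>complex_orthogonal_group l. \<forall>i<q. g *\<^sub>v e i = f i"
      by (rule Suc.IH) (use Suc.prems in simp)
    then obtain g where g: "g \<in> complex_orthogonal_group l" "\<forall>i<q. g *\<^sub>v e i = f i" by blast
    have gc: "g \<in> carrier_mat l l" using g(1) by (simp add: complex_orthogonal_group_def)
    let ?p = "g *\<^sub>v e q"
    have p: "?p \<in> carrier_vec l" using gc e(1)[OF order_refl] by (rule mult_mat_vec_carrier)
    have gi: "(g *\<^sub>v e i) \<bullet> ?p = of_bool (i = q)" if "i \<le> q" for i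
      using orthogonal_scalar_prod[OF g(1) e(1)[OF that] e(1)[OF order_refl]] ee(1)[OF that] by simp
    obtain h where h: "h \<in> complex_orthogonal_group l" "h *\<^sub>v ?p = f q"
      and hfix: "\<forall>v\<in>carrier_vec l. v \<bullet> ?p = 0 \<longrightarrow> v \<bullet> f q = 0 \<longrightarrow> h *\<^sub>v v = v"
      using orthogonal_moves_unit_vector[OF p _ e(2)[OF order_refl]] gi[of q] ee(2)[of q] by fastforce
    have hc: "h \<in> carrier_mat l l" using h(1) by (simp add: complex_orthogonal_group_def)
    have "(h * g) *\<^sub>v e i = f i" if i: "i < Suc q" for i
    proof -
      have ir: "i \<le> q" using i by simp
      have hg: "(h * g) *\<^sub>v e i = h *\<^sub>v (g *\<^sub>v e i)"
        using hc gc e(1)[OF ir] by (rule assoc_mult_mat_vec)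
      show ?thesis
      proof (cases "i = q")
        case True
        then show ?thesis using hg h(2) by simp
      next
        case False
        then have "i < q" using ir by simp
        then have gf: "g *\<^sub>v e i = f i" using g(2) by blast
        have "f i \<bullet> ?p = 0" "f i \<bullet> f q = 0" using gi[OF ir] ee(2)[OF ir] False by (simp_all add: gf)
        then have "h *\<^sub>v f i = f i" using hfix e(2)[OF ir] by blast
        then show ?thesis using hg gf by simp
      qed
    qed
    then show ?case using orthogonal_mult[OF h(1) g(1)] by blast
  qed
  then show ?thesis by blast
qed

section \<open>Symmetric bilinear forms and Witt's theorem\<close>

definition bilinear_value :: "nat \<Rightarrow> (nat \<Rightarrow> nat \<Rightarrow> complex) \<Rightarrow> (nat \<Rightarrow> complex) \<Rightarrow> (nat \<Rightarrow> complex) \<Rightarrow> complex" where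
  "bilinear_value n b x y = (\<Sum>s<n. \<Sum>t<n. x s * b s t * y t)"

lemma bilinear_value_add_left:
  "bilinear_value n b (\<lambda>s. x s + z s) y = bilinear_value n b x y + bilinear_value n b z y"
  by (simp add: bilinear_value_def distrib_right sum.distrib)

lemma bilinear_value_cmult_left:
  "bilinear_value n b (\<lambda>s. \<kappa> * x s) y = \<kappa> * bilinear_value n b x y"
  by (simp add: bilinear_value_def sum_distrib_left mult.assoc)

lemma bilinear_value_sum_left:
  "finite A \<Longrightarrow> bilinear_value n b (\<lambda>s. \<Sum>i\<in>A. x i s) y = (\<Sum>i\<in>A. bilinear_value n b (x i) y)"
proof (induction A rule: finite_induct)
  case empty
  show ?case by (simp add: bilinear_value_def)
next
  case (insert i A)
  then show ?case by (simp add: bilinear_value_add_left)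
qed

lemma bilinear_value_sym:
  assumes "\<And>s t. s < n \<Longrightarrow> t < n \<Longrightarrow> b s t = b t s"
  shows "bilinear_value n b x y = bilinear_value n b y x"
proof -
  have "bilinear_value n b x y = (\<Sum>t<n. \<Sum>s<n. x s * b s t * y t)"
    unfolding bilinear_value_def by (rule sum.swap)
  also have "\<dots> = bilinear_value n b y x"
    unfolding bilinear_value_def using assms by (intro sum.cong refl) (simp add: mult_ac)
  finally show ?thesis .
qed

text \<open>A longer system would factor the identity of size \<open>r\<close> through
  \<open>n < r\<close> coordinates. Padded by zeros to square matrices, the factors would be inverse
  to each other although column \<open>n\<close> of \<open>A\<close> is zero.\<close>

lemma orthonormal_card_le:
  assumes "\<forall>i<r. \<forall>j<r. bilinear_value n b (x i) (x j) = of_bool (i = j)"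
  shows "r \<le> n"
proof (rule ccontr)
  assume "\<not> r \<le> n"
  then have nr: "n < r" by simp
  define A where "A = mat r r (\<lambda>(i, s). if s < n then x i s else (0 :: complex))"
  define C where "C = mat r r (\<lambda>(s, j). if s < n then (\<Sum>t<n. b s t * x j t) else (0 :: complex))"
  have "A * C = 1\<^sub>m r"
  proof (rule eq_matI)
    fix i j assume "i < dim_row (1\<^sub>m r :: complex mat)" "j < dim_col (1\<^sub>m r :: complex mat)"
    then have ij: "i < r" "j < r" by simp_all
    have "(A * C) $$ (i, j) = (\<Sum>s<r. (if s < n then x i s else 0) * (if s < n then (\<Sum>t<n. b s t * x j t) else 0))"
      using ij by (simp add: A_def C_def scalar_prod_def atLeast0LessThan)
    also have "\<dots> = (\<Sum>s<n. x i s * (\<Sum>t<n. b s t * x j t))"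
      using nr by (intro sum.mono_neutral_cong_right) auto
    also have "\<dots> = of_bool (i = j)"
      using assms ij by (simp add: bilinear_value_def sum_distrib_left mult.assoc)
    finally show "(A * C) $$ (i, j) = 1\<^sub>m r $$ (i, j)" using ij by simp
  qed (simp_all add: A_def C_def)
  moreover have "A \<in> carrier_mat r r" "C \<in> carrier_mat r r" by (simp_all add: A_def C_def)
  ultimately have CA: "C * A = 1\<^sub>m r" using mat_mult_left_right_inverse by blast
  have "(C * A) $$ (n, n) = 0"
    using nr by (simp add: A_def C_def scalar_prod_def)
  then show False using CA nr by simp
qed

text \<open>The form may be degenerate. Vectors orthogonal to a system of maximal size are
  isotropic, since any other could be normalised and added. By polarization they are orthogonal to
  each other, hence to everything, and so lie in the radical.\<close>

lemma orthonormal_basis_exists: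
  assumes sym: "\<And>s t. s < n \<Longrightarrow> t < n \<Longrightarrow> b s t = b t s"
  obtains r :: nat and x where "\<And>i j. i < r \<Longrightarrow> j < r \<Longrightarrow> bilinear_value n b (x i) (x j) = of_bool (i = j)"
    and "\<And>y z. (\<And>i. i < r \<Longrightarrow> bilinear_value n b (x i) y = 0) \<Longrightarrow> bilinear_value n b z y = 0"
proof -
  let ?\<beta> = "bilinear_value n b"
  define P where "P r \<longleftrightarrow> (\<exists>x. \<forall>i<r. \<forall>j<r. ?\<beta> (x i) (x j) = of_bool (i = j))" for r :: nat
  have P0: "P 0" by (simp add: P_def)
  have bound: "r \<le> n" if "P r" for r
    using that unfolding P_def by (elim exE) (rule orthonormal_card_le)
  define r where "r = Greatest P"
  have Pr: "P r" unfolding r_def using P0 bound by (rule GreatestI_nat)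
  have max: "r' \<le> r" if "P r'" for r' unfolding r_def using that bound by (rule Greatest_le_nat)
  from Pr obtain x where x': "\<forall>i<r. \<forall>j<r. ?\<beta> (x i) (x j) = of_bool (i = j)"
    unfolding P_def by (elim exE)
  have x: "?\<beta> (x i) (x j) = of_bool (i = j)" if "i < r" "j < r" for i j
    using x' that by blast
  have comm: "?\<beta> y z = ?\<beta> z y" for y z using sym by (rule bilinear_value_sym)
  have add_right: "?\<beta> v (\<lambda>s. p s + q s) = ?\<beta> v p + ?\<beta> v q" for v p q
    using bilinear_value_add_left[of n b p q v] comm[of v p] comm[of v q] comm[of v "\<lambda>s. p s + q s"] by simp
  have isotropic: "?\<beta> v v = 0" if v: "\<And>i. i < r \<Longrightarrow> ?\<beta> (x i) v = 0" for v
  proof (rule ccontr)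
    assume nz: "?\<beta> v v \<noteq> 0"
    \<comment> \<open>Every nonzero complex number is a square, so \<open>v\<close> can be scaled to
      value 1.\<close>
    define \<kappa> where "\<kappa> = 1 / csqrt (?\<beta> v v)"
    define w where "w = (\<lambda>s. \<kappa> * v s)"
    have \<beta>w: "?\<beta> w z = \<kappa> * ?\<beta> v z" for z unfolding w_def by (rule bilinear_value_cmult_left)
    have "\<kappa> * \<kappa> * ?\<beta> v v = 1"
      using nz power2_csqrt[of "?\<beta> v v"] by (simp add: \<kappa>_def field_simps power2_eq_square)
    then have ww: "?\<beta> w w = 1" using \<beta>w[of w] comm[of v w] \<beta>w[of v] by (simp add: mult.assoc)
    have xw: "?\<beta> (x i) w = 0" if "i < r" for i
      unfolding comm[of "x i" w] \<beta>w comm[of v "x i"] v[OF that] by simp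
    have "P (Suc r)"
      unfolding P_def
    proof (rule exI[of _ "x(r := w)"], intro allI impI)
      fix i j assume "i < Suc r" "j < Suc r"
      then show "?\<beta> ((x(r := w)) i) ((x(r := w)) j) = of_bool (i = j)"
        using x[of i j] ww xw[of i] xw[of j] comm[of w "x j"] by (cases "i = r"; cases "j = r") simp_all
    qed
    then have "Suc r \<le> r" by (rule max)
    then show False by simp
  qed
  have orth: "?\<beta> z y = 0" if y: "\<And>i. i < r \<Longrightarrow> ?\<beta> (x i) y = 0" for y z
  proof -
    \<comment> \<open>\<open>z\<close> minus its projection to the system has the same product with
      \<open>y\<close> and is itself orthogonal to the system.\<close>
    define z' where "z' = (\<lambda>s. z s + (\<Sum>i<r. (- ?\<beta> (x i) z) * x i s))"
    have z': "?\<beta> z' v = ?\<beta> z v - (\<Sum>i<r. ?\<beta> (x i) z * ?\<beta> (x i) v)" for v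
      unfolding z'_def bilinear_value_add_left bilinear_value_sum_left[OF finite_lessThan] bilinear_value_cmult_left
      by (simp add: sum_negf)
    have z'y: "?\<beta> z' y = ?\<beta> z y" using z'[of y] y by simp
    have xz': "?\<beta> (x j) z' = 0" if "j < r" for j
    proof -
      have "?\<beta> (x j) z' = ?\<beta> z' (x j)" by (rule comm)
      also have "\<dots> = ?\<beta> z (x j) - (\<Sum>i<r. ?\<beta> (x i) z * of_bool (i = j))"
        using x that unfolding z' by simp
      also have "(\<Sum>i<r. ?\<beta> (x i) z * of_bool (i = j)) = ?\<beta> (x j) z"
      proof -
        have "(\<Sum>i<r. ?\<beta> (x i) z * of_bool (i = j)) = (\<Sum>i<r. if i = j then ?\<beta> (x i) z else 0)"
          by (intro sum.cong) auto
        then show ?thesis using that by simp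
      qed
      finally show ?thesis using comm[of z "x j"] by simp
    qed
    have "?\<beta> (x i) (\<lambda>s. y s + z' s) = 0" if "i < r" for i
      unfolding add_right using y[OF that] xz'[OF that] by simp
    then have "?\<beta> (\<lambda>s. y s + z' s) (\<lambda>s. y s + z' s) = 0" by (rule isotropic)
    then have "?\<beta> y y + ?\<beta> y z' + (?\<beta> z' y + ?\<beta> z' z') = 0"
      unfolding add_right bilinear_value_add_left by (simp only: add_ac)
    then have "?\<beta> z' y = 0"
      using isotropic[of y, OF y] isotropic[of z', OF xz'] comm[of y z'] by simp
    then show ?thesis using z'y by simp
  qed
  show ?thesis by (rule that[OF x orth])
qed

text \<open>Nondegeneracy of the spans is expressed by coefficients: a vector in the radical of the
  Gram form is a linear relation. An orthonormal system of coefficient vectors gives orthonormal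
  vectors in both spans, and these express \<open>u t\<close> and \<open>w t\<close> with the same
  coefficients.\<close>

lemma orthogonal_extension:
  assumes gram: "\<And>i j. i < n \<Longrightarrow> j < n \<Longrightarrow> gram l u i j = gram l w i j"
    and nondeg_u: "\<And>y c. (\<And>s. s < n \<Longrightarrow> (\<Sum>t<n. gram l u s t * y t) = 0) \<Longrightarrow> c < l \<Longrightarrow> (\<Sum>t<n. y t * u t c) = 0"
    and nondeg_w: "\<And>y c. (\<And>s. s < n \<Longrightarrow> (\<Sum>t<n. gram l w s t * y t) = 0) \<Longrightarrow> c < l \<Longrightarrow> (\<Sum>t<n. y t * w t c) = 0"
  shows "\<exists>g\<in>complex_orthogonal_group l. \<forall>t<n. g *\<^sub>v vec l (u t) = vec l (w t)"
proof -
  let ?b = "gram l u"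
  let ?\<beta> = "bilinear_value n ?b"
  have sym: "?b s t = ?b t s" for s t by (simp add: gram_def mult.commute)
  obtain r :: nat and x where x: "\<And>i j. i < r \<Longrightarrow> j < r \<Longrightarrow> ?\<beta> (x i) (x j) = of_bool (i = j)"
    and max: "\<And>y z. (\<And>i. i < r \<Longrightarrow> ?\<beta> (x i) y = 0) \<Longrightarrow> ?\<beta> z y = 0"
    by (rule orthonormal_basis_exists[of n ?b]) (use sym in blast)+
  define C where "C v y c = (\<Sum>t<n. y t * v t c)" for v :: "nat \<Rightarrow> nat \<Rightarrow> complex" and y c
  have CC: "vec l (C v y) \<bullet> vec l (C v z) = bilinear_value n (gram l v) y z" for v y z
  proof -
    have "vec l (C v y) \<bullet> vec l (C v z) = (\<Sum>c<l. \<Sum>s<n. \<Sum>t<n. y s * (v s c * v t c) * z t)"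
      by (simp add: scalar_prod_def C_def sum_product atLeast0LessThan mult_ac)
    also have "\<dots> = (\<Sum>s<n. \<Sum>t<n. \<Sum>c<l. y s * (v s c * v t c) * z t)"
      by (subst sum.swap, rule sum.cong[OF refl], rule sum.swap)
    finally show ?thesis by (simp add: bilinear_value_def gram_def sum_distrib_left sum_distrib_right)
  qed
  have \<beta>w: "bilinear_value n (gram l w) y z = ?\<beta> y z" for y z
    using gram by (simp add: bilinear_value_def)
  obtain g where g: "g \<in> complex_orthogonal_group l" "\<And>i. i < r \<Longrightarrow> g *\<^sub>v vec l (C u (x i)) = vec l (C w (x i))"
    using orthogonal_maps_orthonormal[of r "\<lambda>i. vec l (C u (x i))" l "\<lambda>i. vec l (C w (x i))"]
    unfolding CC \<beta>w using x by auto
  have gc: "g \<in> carrier_mat l l" using g(1) by (simp add: complex_orthogonal_group_def)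
  have "g *\<^sub>v vec l (u t) = vec l (w t)" if t: "t < n" for t
  proof -
    define \<delta> where "\<delta> s = (if s = t then 1 else (0 :: complex))" for s
    \<comment> \<open>The unit coefficient vector at \<open>t\<close> minus its projection lies in
      the radical, hence is a relation in both families.\<close>
    define y where "y = (\<lambda>s. \<delta> s + (\<Sum>i<r. (- ?\<beta> (x i) \<delta>) * x i s))"
    have comm: "?\<beta> p q = ?\<beta> q p" for p q by (rule bilinear_value_sym) (rule sym)
    have "?\<beta> (x j) y = 0" if "j < r" for j
    proof -
      have "?\<beta> (x j) y = ?\<beta> y (x j)" by (rule comm)
      also have "\<dots> = ?\<beta> \<delta> (x j) + (\<Sum>i<r. (- ?\<beta> (x i) \<delta>) * ?\<beta> (x i) (x j))"
        unfolding y_def bilinear_value_add_left bilinear_value_sum_left[OF finite_lessThan] bilinear_value_cmult_left ..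
      also have "(\<Sum>i<r. (- ?\<beta> (x i) \<delta>) * ?\<beta> (x i) (x j)) = (\<Sum>i<r. if i = j then - ?\<beta> (x i) \<delta> else 0)"
        using x that by (intro sum.cong) auto
      also have "\<dots> = - ?\<beta> (x j) \<delta>" using that by simp
      finally show ?thesis using comm[of \<delta>] by simp
    qed
    then have \<beta>y: "?\<beta> z y = 0" for z by (rule max)
    have row: "(\<Sum>t<n. ?b s t * y t) = 0" if s: "s < n" for s
    proof -
      have "?\<beta> (\<lambda>q. if q = s then 1 else 0) y = (\<Sum>q<n. if q = s then (\<Sum>t<n. ?b q t * y t) else 0)"
        unfolding bilinear_value_def by (intro sum.cong) (auto simp: mult_ac)
      then show ?thesis using \<beta>y s by simp
    qed
    have row': "(\<Sum>t<n. gram l w s t * y t) = 0" if s: "s < n" for s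
      using row[OF s] gram s by simp
    have Cy: "C v y c = v t c - (\<Sum>i<r. ?\<beta> (x i) \<delta> * C v (x i) c)" for v :: "nat \<Rightarrow> nat \<Rightarrow> complex" and c
    proof -
      have "C v y c = (\<Sum>s<n. \<delta> s * v s c) + (\<Sum>s<n. \<Sum>i<r. (- ?\<beta> (x i) \<delta>) * x i s * v s c)"
        by (simp add: C_def y_def distrib_right sum.distrib sum_distrib_right)
      also have "(\<Sum>s<n. \<delta> s * v s c) = (\<Sum>s<n. if s = t then v s c else 0)"
        by (intro sum.cong) (auto simp: \<delta>_def)
      also have "\<dots> = v t c" using t by simp
      also have "(\<Sum>s<n. \<Sum>i<r. (- ?\<beta> (x i) \<delta>) * x i s * v s c) = (\<Sum>i<r. \<Sum>s<n. (- ?\<beta> (x i) \<delta>) * x i s * v s c)"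
        by (rule sum.swap)
      finally show ?thesis by (simp add: C_def sum_distrib_left mult.assoc sum_negf)
    qed
    have uc: "u t c = (\<Sum>i<r. ?\<beta> (x i) \<delta> * C u (x i) c)" if "c < l" for c
      using nondeg_u[OF row that] Cy[of u c] by (simp add: C_def)
    have wc: "w t c = (\<Sum>i<r. ?\<beta> (x i) \<delta> * C w (x i) c)" if "c < l" for c
      using nondeg_w[OF row' that] Cy[of w c] by (simp add: C_def)
    show ?thesis
    proof (rule eq_vecI)
      fix c assume "c < dim_vec (vec l (w t))"
      then have c: "c < l" by simp
      have "(g *\<^sub>v vec l (u t)) $ c = (\<Sum>j<l. g $$ (c, j) * (\<Sum>i<r. ?\<beta> (x i) \<delta> * C u (x i) j))"
        using c gc by (simp add: scalar_prod_def atLeast0LessThan uc)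
      also have "\<dots> = (\<Sum>j<l. \<Sum>i<r. ?\<beta> (x i) \<delta> * (g $$ (c, j) * C u (x i) j))"
        by (simp add: sum_distrib_left mult_ac)
      also have "\<dots> = (\<Sum>i<r. \<Sum>j<l. ?\<beta> (x i) \<delta> * (g $$ (c, j) * C u (x i) j))"
        by (rule sum.swap)
      also have "\<dots> = (\<Sum>i<r. ?\<beta> (x i) \<delta> * (g *\<^sub>v vec l (C u (x i))) $ c)"
        using c gc by (simp add: scalar_prod_def atLeast0LessThan sum_distrib_left)
      also have "\<dots> = (\<Sum>i<r. ?\<beta> (x i) \<delta> * C w (x i) c)"
        using g(2) c by simp
      finally show "(g *\<^sub>v vec l (u t)) $ c = vec l (w t) $ c" using c by (simp add: wc)
    qed (use gc in simp)
  qed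
  then show ?thesis using g(1) by blast
qed

subsection \<open>Sums of evaluations\<close>

lemma ev_superset:
  assumes "finite S" "Poly_Mapping.keys p \<subseteq> S"
  shows "ev x p = (\<Sum>m\<in>S. Poly_Mapping.lookup p m * (\<Prod>i\<in>Poly_Mapping.keys m. (x $ i) ^ Poly_Mapping.lookup m i))"
  unfolding ev_def using assms by (intro sum.mono_neutral_left) (auto simp: in_keys_iff)

lemma ev_add: "ev x (p + q) = ev x p + ev x q"
proof -
  let ?S = "Poly_Mapping.keys p \<union> Poly_Mapping.keys q"
  have "Poly_Mapping.keys (p + q) \<subseteq> ?S" by (rule Poly_Mapping.keys_add)
  then have "ev x (p + q) = (\<Sum>m\<in>?S. Poly_Mapping.lookup (p + q) m * (\<Prod>i\<in>Poly_Mapping.keys m. (x $ i) ^ Poly_Mapping.lookup m i))"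
    by (intro ev_superset) auto
  also have "\<dots> = ev x p + ev x q"
    by (simp add: ev_superset[of ?S p] ev_superset[of ?S q] lookup_add distrib_right sum.distrib)
  finally show ?thesis .
qed

lemma lookup_const_poly_mult: "Poly_Mapping.lookup (const_poly c * p) m = c * Poly_Mapping.lookup p m"
  unfolding const_poly_def mult_map_scale_conv_mult[symmetric] Poly_Mapping.map.rep_eq by (simp add: when_def)

lemma ev_const_poly_mult: "ev x (const_poly c * p) = c * ev x p"
proof -
  have "Poly_Mapping.keys (const_poly c * p) \<subseteq> Poly_Mapping.keys p"
    by (auto simp: in_keys_iff lookup_const_poly_mult)
  then have "ev x (const_poly c * p) = (\<Sum>m\<in>Poly_Mapping.keys p. Poly_Mapping.lookup (const_poly c * p) m *
      (\<Prod>i\<in>Poly_Mapping.keys m. (x $ i) ^ Poly_Mapping.lookup m i))"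
    by (intro ev_superset) auto
  then show ?thesis by (simp add: ev_def lookup_const_poly_mult sum_distrib_left mult.assoc)
qed

lemma prod_var_poly: "(\<Prod>c\<in>#\<mu>. var_poly c) = Poly_Mapping.single (\<Sum>c\<in>#\<mu>. Poly_Mapping.single c (Suc 0)) 1"
  by (induction \<mu>) (simp_all add: var_poly_def mult_single)

lemma lookup_sum_single: "Poly_Mapping.lookup (\<Sum>c\<in>#\<mu>. Poly_Mapping.single c (Suc 0)) i = count \<mu> i"
  by (induction \<mu>) (auto simp: lookup_add lookup_single when_def)

lemma keys_sum_single: "Poly_Mapping.keys (\<Sum>c\<in>#\<mu>. Poly_Mapping.single c (Suc 0)) = set_mset \<mu>"
  by (auto simp: in_keys_iff lookup_sum_single)

lemma ev_prod_var_poly: "ev x (\<Prod>c\<in>#\<mu>. var_poly c) = (\<Prod>c\<in>#\<mu>. x $ c)"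
  unfolding prod_var_poly by (simp add: ev_def keys_sum_single lookup_sum_single image_prod_mset_multiplicity)

lemma prod_var_poly_real:
  assumes "set_mset \<mu> \<subseteq> {..<k}"
  shows "(\<Prod>c\<in>#\<mu>. var_poly c) \<in> real_polys k"
  using assms unfolding prod_var_poly real_polys_def polys_def
  by (auto simp: keys_sum_single lookup_single when_def)

text \<open>Conjugation writes the real functional as a second sum, with weights
  \<open>cnj (a j)\<close> and points \<open>cnj (x j)\<close>. Comparing total weights at the
  conjugate of \<open>x i\<close> finds the partner of \<open>i\<close>, as distinctness turns both
  fibres into singletons.\<close>

lemma closed_points_if_real:
  assumes real: "\<And>\<mu>. set_mset \<mu> \<subseteq> {..<d} \<Longrightarrow> point_value n a x \<mu> \<in> \<real>"
    and distinct: "\<And>i j. i < n \<Longrightarrow> j < n \<Longrightarrow> (\<And>c. c < d \<Longrightarrow> x i c = x j c) \<Longrightarrow> i = j"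
    and nz: "\<And>i. i < n \<Longrightarrow> a i \<noteq> 0"
    and i: "i < n"
  shows "\<exists>j<n. (\<forall>c<d. x j c = cnj (x i c)) \<and> a j = cnj (a i)"
proof -
  let ?p = "\<lambda>c. cnj (x i c)"
  have eq: "(\<Sum>i<n. a i * (\<Prod>c\<in>#\<mu>. x i c)) = (\<Sum>j<n. cnj (a j) * (\<Prod>c\<in>#\<mu>. cnj (x j c)))"
    if "set_mset \<mu> \<subseteq> {..<d}" for \<mu>
  proof -
    have "cnj (\<Prod>c\<in>#\<mu>. x j c) = (\<Prod>c\<in>#\<mu>. cnj (x j c))" for j by (induction \<mu>) simp_all
    then have "cnj (point_value n a x \<mu>) = (\<Sum>j<n. cnj (a j) * (\<Prod>c\<in>#\<mu>. cnj (x j c)))"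
      by (simp add: point_value_def)
    moreover have "cnj (point_value n a x \<mu>) = point_value n a x \<mu>"
      using real[OF that] by (simp add: Reals_cnj_iff)
    ultimately show ?thesis by (simp add: point_value_def)
  qed
  have sums: "(\<Sum>j | j \<in> {..<n} \<and> (\<forall>c<d. x j c = ?p c). a j) =
      (\<Sum>j | j \<in> {..<n} \<and> (\<forall>c<d. cnj (x j c) = ?p c). cnj (a j))"
    using evaluations_independent[OF finite_lessThan finite_lessThan eq, where p = ?p] .
  have "{j \<in> {..<n}. \<forall>c<d. cnj (x j c) = ?p c} = {i}"
    using i distinct[of _ i] by auto
  then have a: "(\<Sum>j | j \<in> {..<n} \<and> (\<forall>c<d. x j c = ?p c). a j) = cnj (a i)" unfolding sums by simp
  then have "{j \<in> {..<n}. \<forall>c<d. x j c = ?p c} \<noteq> {}" using nz[OF i] by (metis complex_cnj_zero_iff sum.empty)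
  then obtain j where j: "j < n" "\<forall>c<d. x j c = ?p c" by blast
  have "{j \<in> {..<n}. \<forall>c<d. x j c = ?p c} = {j}"
  proof (intro equalityI subsetI)
    fix j' assume "j' \<in> {j \<in> {..<n}. \<forall>c<d. x j c = ?p c}"
    then have "j' = j" using j by (intro distinct) auto
    then show "j' \<in> {j}" by simp
  qed (use j in auto)
  then show ?thesis using a j by auto
qed

text \<open>Phrased by indices instead of sets of columns, since the arguments below use conjugation
  as a permutation of the indices.\<close>

definition conjugation_closed :: "nat \<Rightarrow> (nat \<Rightarrow> complex) \<Rightarrow> nat \<Rightarrow> (nat \<Rightarrow> nat \<Rightarrow> complex) \<Rightarrow> bool" where
  "conjugation_closed n a d x \<longleftrightarrow> (\<forall>i<n. \<exists>j<n. (\<forall>c<d. x j c = cnj (x i c)) \<and> a j = cnj (a i))"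

lemma conjugation_permutation:
  assumes "conjugation_closed n a d x"
    and distinct: "\<And>i j. i < n \<Longrightarrow> j < n \<Longrightarrow> (\<And>c. c < d \<Longrightarrow> x i c = x j c) \<Longrightarrow> i = j"
  obtains \<pi> where "bij_betw \<pi> {..<n} {..<n}"
    "\<And>i c. i < n \<Longrightarrow> c < d \<Longrightarrow> x (\<pi> i) c = cnj (x i c)" "\<And>i. i < n \<Longrightarrow> a (\<pi> i) = cnj (a i)"
proof -
  have "\<forall>i. \<exists>j. i < n \<longrightarrow> j < n \<and> (\<forall>c<d. x j c = cnj (x i c)) \<and> a j = cnj (a i)"
    using assms(1) unfolding conjugation_closed_def by blast
  then obtain \<pi> where \<pi>: "\<forall>i. i < n \<longrightarrow> \<pi> i < n \<and> (\<forall>c<d. x (\<pi> i) c = cnj (x i c)) \<and> a (\<pi> i) = cnj (a i)"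
    by (elim choice[THEN exE])
  have "inj_on \<pi> {..<n}"
  proof (rule inj_onI)
    fix i j assume ij: "i \<in> {..<n}" "j \<in> {..<n}" "\<pi> i = \<pi> j"
    show "i = j"
    proof (rule distinct)
      fix c assume "c < d"
      then have "cnj (x i c) = cnj (x j c)" using \<pi> ij by (metis lessThan_iff)
      then show "x i c = x j c" by simp
    qed (use ij in auto)
  qed
  moreover have "\<pi> ` {..<n} \<subseteq> {..<n}" using \<pi> by auto
  ultimately have "bij_betw \<pi> {..<n} {..<n}" by (simp add: bij_betw_def endo_inj_surj)
  then show ?thesis by (rule that) (use \<pi> in blast)+
qed

lemma closed_under_conjugation_iff:
  assumes "\<And>i. i < n \<Longrightarrow> x i \<in> carrier_vec l"
  shows "closed_under_conjugation {x i @\<^sub>v vec 1 (\<lambda>_. a $ i) | i. i < n} \<longleftrightarrow>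
    conjugation_closed n (($) a) l (\<lambda>i c. x i $ c)"
proof -
  have eq: "conjugate (x i @\<^sub>v vec 1 (\<lambda>_. a $ i)) = x j @\<^sub>v vec 1 (\<lambda>_. a $ j) \<longleftrightarrow>
     (\<forall>c<l. x j $ c = cnj (x i $ c)) \<and> a $ j = cnj (a $ i)" if "i < n" "j < n" for i j
  proof -
    have d: "dim_vec (x i) = l" "dim_vec (x j) = l" using assms that by auto
    have "conjugate (x i @\<^sub>v vec 1 (\<lambda>_. a $ i)) = x j @\<^sub>v vec 1 (\<lambda>_. a $ j) \<longleftrightarrow>
      (\<forall>c<Suc l. cnj ((x i @\<^sub>v vec 1 (\<lambda>_. a $ i)) $ c) = (x j @\<^sub>v vec 1 (\<lambda>_. a $ j)) $ c)"
      unfolding vec_eq_iff by (simp add: d)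
    also have "\<dots> \<longleftrightarrow> (\<forall>c<l. cnj (x i $ c) = x j $ c) \<and> cnj (a $ i) = a $ j"
      by (simp add: d All_less_Suc conj_commute)
    finally show ?thesis by auto
  qed
  show ?thesis
    unfolding closed_under_conjugation_def conjugation_closed_def
  proof (intro iffI allI impI ballI)
    fix i assume *: "\<forall>w\<in>{x i @\<^sub>v vec 1 (\<lambda>_. a $ i) | i. i < n}. conjugate w \<in> {x i @\<^sub>v vec 1 (\<lambda>_. a $ i) | i. i < n}" and i: "i < n"
    then have "conjugate (x i @\<^sub>v vec 1 (\<lambda>_. a $ i)) \<in> {x i @\<^sub>v vec 1 (\<lambda>_. a $ i) | i. i < n}" by blast
    then show "\<exists>j<n. (\<forall>c<l. x j $ c = cnj (x i $ c)) \<and> a $ j = cnj (a $ i)" using eq[OF i] by blast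
  next
    fix w assume *: "\<forall>i<n. \<exists>j<n. (\<forall>c<l. x j $ c = cnj (x i $ c)) \<and> a $ j = cnj (a $ i)"
      and "w \<in> {x i @\<^sub>v vec 1 (\<lambda>_. a $ i) | i. i < n}"
    then obtain i where i: "i < n" "w = x i @\<^sub>v vec 1 (\<lambda>_. a $ i)" by blast
    with * obtain j where "j < n" "(\<forall>c<l. x j $ c = cnj (x i $ c)) \<and> a $ j = cnj (a $ i)" by blast
    then show "conjugate w \<in> {x i @\<^sub>v vec 1 (\<lambda>_. a $ i) | i. i < n}" using eq[OF i(1)] i(2) by blast
  qed
qed

lemma cnj_ev:
  assumes "p \<in> real_polys l" "\<And>c. c < l \<Longrightarrow> x' $ c = cnj (x $ c)"
  shows "cnj (ev x p) = ev x' p"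
proof -
  have r: "cnj (Poly_Mapping.lookup p m) = Poly_Mapping.lookup p m" for m
    using assms(1) by (simp add: real_polys_def Reals_cnj_iff)
  have "(\<Prod>i\<in>Poly_Mapping.keys m. cnj (x $ i) ^ Poly_Mapping.lookup m i) = (\<Prod>i\<in>Poly_Mapping.keys m. (x' $ i) ^ Poly_Mapping.lookup m i)"
    if "m \<in> Poly_Mapping.keys p" for m
  proof (rule prod.cong[OF refl])
    fix i assume "i \<in> Poly_Mapping.keys m"
    then have "i < l" using assms(1) that by (auto simp: real_polys_def polys_def)
    then show "cnj (x $ i) ^ Poly_Mapping.lookup m i = (x' $ i) ^ Poly_Mapping.lookup m i"
      using assms(2) by simp
  qed
  then show ?thesis by (simp add: ev_def r)
qed

text \<open>Values at monomials force partners for the points; conversely, conjugation permutes the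
  summands.\<close>

lemma real_evaluation_sum_iff:
  fixes x :: "nat \<Rightarrow> complex vec"
  assumes distinct: "\<And>i j. i < n \<Longrightarrow> j < n \<Longrightarrow> (\<And>c. c < l \<Longrightarrow> x i $ c = x j $ c) \<Longrightarrow> i = j"
    and nz: "\<And>i. i < n \<Longrightarrow> a $ i \<noteq> 0"
  shows "real_edge_coloring_model l (\<lambda>p. \<Sum>i<n. a $ i * ev (x i) p) \<longleftrightarrow>
    conjugation_closed n (($) a) l (\<lambda>i c. x i $ c)"
proof
  assume "real_edge_coloring_model l (\<lambda>p. \<Sum>i<n. a $ i * ev (x i) p)"
  then have "(\<Sum>i<n. a $ i * ev (x i) (\<Prod>c\<in>#\<mu>. var_poly c)) \<in> \<real>" if "set_mset \<mu> \<subseteq> {..<l}" for \<mu>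
    using prod_var_poly_real[OF that] by (auto simp: real_edge_coloring_model_def)
  then have "point_value n (($) a) (\<lambda>i c. x i $ c) \<mu> \<in> \<real>" if "set_mset \<mu> \<subseteq> {..<l}" for \<mu>
    using that by (simp add: point_value_def ev_prod_var_poly)
  then show "conjugation_closed n (($) a) l (\<lambda>i c. x i $ c)"
    unfolding conjugation_closed_def using closed_points_if_real[of l n "($) a" "\<lambda>i c. x i $ c"] distinct nz by blast
next
  assume "conjugation_closed n (($) a) l (\<lambda>i c. x i $ c)"
  then obtain \<pi> where \<pi>: "bij_betw \<pi> {..<n} {..<n}"
    "\<And>i c. i < n \<Longrightarrow> c < l \<Longrightarrow> x (\<pi> i) $ c = cnj (x i $ c)" "\<And>i. i < n \<Longrightarrow> a $ (\<pi> i) = cnj (a $ i)"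
    by (rule conjugation_permutation) (use distinct in blast)+
  have "(\<Sum>i<n. a $ i * ev (x i) p) \<in> \<real>" if p: "p \<in> real_polys l" for p
  proof -
    have "cnj (\<Sum>i<n. a $ i * ev (x i) p) = (\<Sum>i<n. a $ (\<pi> i) * ev (x (\<pi> i)) p)"
      using cnj_ev[OF p \<pi>(2)] \<pi>(3) by simp
    also have "\<dots> = (\<Sum>i<n. a $ i * ev (x i) p)"
      by (rule sum.reindex_bij_betw[OF \<pi>(1), where g = "\<lambda>i. a $ i * ev (x i) p"])
    finally show ?thesis by (simp add: Reals_cnj_iff)
  qed
  then show "real_edge_coloring_model l (\<lambda>p. \<Sum>i<n. a $ i * ev (x i) p)"
    by (simp add: real_edge_coloring_model_def edge_coloring_model_def ev_add ev_const_poly_mult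
      distrib_left sum.distrib sum_distrib_left mult.left_commute)
qed

section \<open>The factored vertex model and its rotations\<close>

locale factored_vertex_model =
  fixes n k :: nat and a :: "complex vec" and B U :: "complex mat"
  assumes model: "vertex_coloring_model n a B"
    and no_twins: "twin_free n a B"
    and U: "U \<in> carrier_mat k n"
    and nondegenerate: "nondegenerate_mat U"
    and factorization: "transpose_mat U * U = B"
begin

definition column :: "nat \<Rightarrow> nat \<Rightarrow> complex" where
  "column i c = U $$ (c, i)"

definition rotated :: "nat \<Rightarrow> complex mat \<Rightarrow> nat \<Rightarrow> complex vec" where
  "rotated l g i = g *\<^sub>v pad_vec l (col U i)"

lemma weights_nonzero: "i < n \<Longrightarrow> a $ i \<noteq> 0"
  using model by (simp add: vertex_coloring_model_def)

lemma B_eq_gram: "i < n \<Longrightarrow> j < n \<Longrightarrow> B $$ (i, j) = gram k column i j"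
  using U by (simp add: factorization[symmetric] gram_def column_def scalar_prod_def atLeast0LessThan)

lemma distinct_rows:
  assumes "i < n" "j < n" "\<And>l. l < n \<Longrightarrow> gram k column i l = gram k column j l"
  shows "i = j"
proof (rule ccontr)
  have B: "B \<in> carrier_mat n n" using model by (simp add: vertex_coloring_model_def)
  assume "i \<noteq> j"
  moreover have "row B i = row B j"
    using B assms B_eq_gram by (intro eq_vecI) auto
  ultimately show False using no_twins assms(1,2) by (auto simp: twin_free_def twins_def)
qed

lemma distinct_points:
  assumes gram: "\<And>i j. i < n \<Longrightarrow> j < n \<Longrightarrow> gram d x i j = gram k column i j"
    and "i < n" "j < n" "\<And>c. c < d \<Longrightarrow> x i c = x j c"
  shows "i = j"
  using assms(2,3)
proof (rule distinct_rows)
  fix l assume "l < n"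
  then have "gram k column i l = gram d x i l" "gram k column j l = gram d x j l"
    using gram assms(2,3) by simp_all
  then show "gram k column i l = gram k column j l" using assms(4) by (simp add: gram_def)
qed

lemma pad_column: "k \<le> l \<Longrightarrow> i < n \<Longrightarrow> pad_vec l (col U i) = vec l (\<lambda>c. if c < k then column i c else 0)"
  using U by (intro eq_vecI) (auto simp: pad_vec_def column_def)

lemma gram_pad: "k \<le> l \<Longrightarrow> gram l (\<lambda>i c. if c < k then x i c else 0) i j = gram k x i j"
  unfolding gram_def by (intro sum.mono_neutral_cong_right) auto

lemma rotated_carrier:
  assumes "k \<le> l" "g \<in> complex_orthogonal_group l" "i < n"
  shows "rotated l g i \<in> carrier_vec l"
  using assms by (auto simp: rotated_def complex_orthogonal_group_def pad_column)

lemma gram_rotated: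
  assumes "k \<le> l" "g \<in> complex_orthogonal_group l" "i < n" "j < n"
  shows "gram l (\<lambda>i c. rotated l g i $ c) i j = gram k column i j"
proof -
  have "gram l (\<lambda>i c. rotated l g i $ c) i j = rotated l g i \<bullet> rotated l g j"
    using rotated_carrier[OF assms(1,2,4)] by (auto simp: gram_def scalar_prod_def atLeast0LessThan)
  also have "\<dots> = pad_vec l (col U i) \<bullet> pad_vec l (col U j)"
    unfolding rotated_def using assms by (intro orthogonal_scalar_prod) (auto simp: pad_column)
  also have "\<dots> = gram l (\<lambda>i c. if c < k then column i c else 0) i j"
    using assms by (simp add: pad_column gram_def scalar_prod_def atLeast0LessThan)
  finally show ?thesis using gram_pad[OF assms(1)] by simp
qed

lemma closed_iff:
  assumes "k \<le> l" "g \<in> complex_orthogonal_group l"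
  shows "closed_under_conjugation (extended_columns n a U l g) \<longleftrightarrow>
    conjugation_closed n (($) a) l (\<lambda>i c. rotated l g i $ c)"
  unfolding extended_columns_def rotated_def[symmetric]
  using rotated_carrier[OF assms] by (rule closed_under_conjugation_iff)

lemma evaluation_model_eq: "evaluation_model n a U l g = (\<lambda>p. \<Sum>i<n. a $ i * ev (rotated l g i) p)"
  by (simp add: evaluation_model_def rotated_def fun_eq_iff)

lemma real_iff:
  assumes "k \<le> l" "g \<in> complex_orthogonal_group l"
  shows "real_edge_coloring_model l (evaluation_model n a U l g) \<longleftrightarrow>
    conjugation_closed n (($) a) l (\<lambda>i c. rotated l g i $ c)"
  unfolding evaluation_model_eq
  by (rule real_evaluation_sum_iff) (use distinct_points[OF gram_rotated[OF assms]] weights_nonzero in blast)+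

text \<open>Closed graphs depend on the points through their Gram matrix, which rotations
  preserve.\<close>

lemma partition_function_evaluation_model:
  assumes "k \<le> l" "g \<in> complex_orthogonal_group l" "G \<in> finite_graphs"
  shows "vertex_partition_function n a B G = edge_partition_function l (evaluation_model n a U l g) G"
proof -
  have "finite (edges G)" using assms(3) by (simp add: finite_graphs_def)
  then obtain es where es: "distinct es" "set es = edges G" using finite_distinct_list by blast
  have "monomial_value (evaluation_model n a U l g) = point_value n (($) a) (\<lambda>i c. rotated l g i $ c)"
    by (simp add: monomial_value_def point_value_def evaluation_model_eq ev_prod_var_poly fun_eq_iff)
  then show ?thesis
    unfolding edge_partition_function_eq_contract[OF assms(3) es]
    using vertex_partition_function_eq_contract[OF assms(3) es, where n = n and B = B and k = l and u = "\<lambda>i c. rotated l g i $ c" and a = a]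
      B_eq_gram gram_rotated[OF assms(1,2)] by (simp add: gram_def)
qed

text \<open>A kernel vector \<open>y\<close> of the Gram matrix makes \<open>U y\<close> orthogonal
  to the column space, in which it lies.\<close>

lemma kernel_gram:
  assumes "\<And>s. s < n \<Longrightarrow> (\<Sum>t<n. gram k column s t * y t) = 0" "c < k"
  shows "(\<Sum>t<n. y t * column t c) = 0"
proof -
  have cs: "vec_space.col_space (dim_row U) U = {z \<in> carrier_vec k. \<exists>x\<in>carrier_vec n. U *\<^sub>v x = z}"
    using U vec_space.col_space_eq[OF U] by simp
  have Uv: "(U *\<^sub>v x) $ c = (\<Sum>t<n. x $ t * column t c)" if "x \<in> carrier_vec n" "c < k" for x c
    using that U by (simp add: scalar_prod_def column_def atLeast0LessThan mult.commute)
  let ?z = "U *\<^sub>v vec n y"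
  have z: "?z \<in> vec_space.col_space (dim_row U) U" unfolding cs using U by auto
  have "?z \<bullet> z' = 0" if z': "z' \<in> vec_space.col_space (dim_row U) U" for z'
  proof -
    obtain x where x: "x \<in> carrier_vec n" "z' = U *\<^sub>v x" using z' unfolding cs by blast
    have "?z \<bullet> z' = (\<Sum>c<k. (\<Sum>t<n. y t * column t c) * (\<Sum>s<n. x $ s * column s c))"
      using U x by (simp add: scalar_prod_def[of _ "U *\<^sub>v x"] Uv atLeast0LessThan del: index_mult_mat_vec)
    also have "\<dots> = (\<Sum>c<k. \<Sum>s<n. \<Sum>t<n. x $ s * (column s c * column t c * y t))"
      by (simp only: mult.commute[of "sum (\<lambda>t. y t * column t _) _"] sum_product) (simp add: mult_ac)
    also have "\<dots> = (\<Sum>s<n. \<Sum>t<n. \<Sum>c<k. x $ s * (column s c * column t c * y t))"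
      by (subst sum.swap, rule sum.cong[OF refl], rule sum.swap)
    also have "\<dots> = (\<Sum>s<n. x $ s * (\<Sum>t<n. gram k column s t * y t))"
      by (simp add: gram_def sum_distrib_left sum_distrib_right)
    finally show ?thesis using assms(1) by simp
  qed
  then have "?z = 0\<^sub>v k"
    using nondegenerate z U unfolding nondegenerate_mat_def by auto
  then show ?thesis using Uv[of "vec n y" c] assms(2) by simp
qed

lemma edge_model_imp_rotation:
  assumes y: "real_edge_coloring_model m y"
    and eq: "\<And>G. G \<in> finite_graphs \<Longrightarrow> vertex_partition_function n a B G = edge_partition_function m y G"
  shows "\<exists>l\<ge>k. \<exists>g\<in>complex_orthogonal_group l. conjugation_closed n (($) a) l (\<lambda>i c. rotated l g i $ c)"
proof -
  have Y: "monomial_value y \<mu> \<in> \<real>" if "set_mset \<mu> \<subseteq> {..<m}" for \<mu>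
    using y prod_var_poly_real[OF that] by (simp add: real_edge_coloring_model_def monomial_value_def)
  interpret twin_free_matching n k m "($) a" column "monomial_value y"
  proof
    fix E :: "(nat \<times> nat) list" and s
    assume E: "set E \<subseteq> {..<s} \<times> {..<s}"
    \<comment> \<open>Positions in the list serve as names of edges, which keeps parallel edges
      apart.\<close>
    define G where "G = \<lparr>verts = {..<s}, edges = {..<length E}, ends = (!) E\<rparr>"
    have G: "G \<in> finite_graphs"
      using E nth_mem by (fastforce simp: finite_graphs_def G_def)
    have es: "distinct [0..<length E]" "set [0..<length E] = edges G"
      by (auto simp: G_def)
    have *: "map (ends G) [0..<length E] = E" "verts G = {..<s}"
      by (simp_all add: G_def map_nth)
    show "contract m E (vertex_tensor m (monomial_value y) {..<s}) {#} =
      contract k E (vertex_tensor k (point_value n (($) a) column) {..<s}) {#}"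
      using eq[OF G] edge_partition_function_eq_contract[OF G es, of m y]
        vertex_partition_function_eq_contract[OF G es, where n = n and B = B and k = k and u = column and a = a] B_eq_gram
      by (simp only: * gram_def)
  qed (use Y weights_nonzero distinct_rows in blast)+
  obtain w where gram: "\<And>i j. i < n \<Longrightarrow> j < n \<Longrightarrow> gram m w i j = gram k column i j"
    and w: "\<And>\<mu>. set_mset \<mu> \<subseteq> {..<m} \<Longrightarrow> monomial_value y \<mu> = point_value n (($) a) w \<mu>"
    using realising_points_with_weights by blast
  have "conjugation_closed n (($) a) m w"
    unfolding conjugation_closed_def
    using closed_points_if_real[of m n "($) a" w] Y w distinct_points[OF gram] weights_nonzero by simp
  \<comment> \<open>Zero padding brings the columns and the points into one space and preserves Gram
    matrices and conjugation.\<close>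
  define l where "l = max k m"
  define w' where "w' i c = (if c < m then w i c else 0)" for i c
  define u' where "u' i c = (if c < k then column i c else 0)" for i c
  have gram_w': "gram l w' i j = gram k column i j" if "i < n" "j < n" for i j
  proof -
    have "gram l w' i j = gram m w i j"
      unfolding gram_def w'_def by (intro sum.mono_neutral_cong_right) (auto simp: l_def)
    then show ?thesis using gram that by simp
  qed
  have gram_u': "gram l u' i j = gram k column i j" for i j
    unfolding u'_def by (rule gram_pad) (simp add: l_def)
  have closed: "conjugation_closed n (($) a) l w'"
    using \<open>conjugation_closed n (($) a) m w\<close> unfolding conjugation_closed_def w'_def by fastforce
  obtain \<pi> where \<pi>: "bij_betw \<pi> {..<n} {..<n}" "\<And>i c. i < n \<Longrightarrow> c < l \<Longrightarrow> w' (\<pi> i) c = cnj (w' i c)"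
    using closed by (rule conjugation_permutation) (use distinct_points[OF gram_w'] in blast)+
  have "\<exists>g\<in>complex_orthogonal_group l. \<forall>t<n. g *\<^sub>v vec l (u' t) = vec l (w' t)"
  proof (rule orthogonal_extension)
    show "gram l u' i j = gram l w' i j" if "i < n" "j < n" for i j
      using that by (simp add: gram_u' gram_w')
  next
    fix z c assume z: "\<And>s. s < n \<Longrightarrow> (\<Sum>t<n. gram l u' s t * z t) = 0"
    have "(\<Sum>t<n. z t * column t c) = 0" if "c < k"
      using z that by (intro kernel_gram) (simp_all add: gram_u')
    then show "(\<Sum>t<n. z t * u' t c) = 0" by (cases "c < k") (simp_all add: u'_def)
  next
    fix z c assume z: "\<And>s. s < n \<Longrightarrow> (\<Sum>t<n. gram l w' s t * z t) = 0" and c: "c < l"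
    define v where "v c = (\<Sum>t<n. z t * w' t c)" for c
    \<comment> \<open>The conjugate of \<open>w' s\<close> belongs to the family again, so bilinear
      orthogonality of \<open>v\<close> to the family is Hermitian orthogonality; as
      \<open>v\<close> lies in the span, its norm is 0.\<close>
    have inner: "(\<Sum>c<l. v c * cnj (w' s c)) = 0" if s: "s < n" for s
    proof -
      have \<pi>s: "\<pi> s < n" using \<pi>(1) s by (auto simp: bij_betw_def)
      have "(\<Sum>c<l. v c * cnj (w' s c)) = (\<Sum>c<l. \<Sum>t<n. w' (\<pi> s) c * w' t c * z t)"
        using \<pi>(2)[OF s] by (simp add: v_def sum_distrib_right sum_distrib_left mult_ac)
      also have "\<dots> = (\<Sum>t<n. \<Sum>c<l. w' (\<pi> s) c * w' t c * z t)" by (rule sum.swap)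
      also have "\<dots> = (\<Sum>t<n. gram l w' (\<pi> s) t * z t)" by (simp add: gram_def sum_distrib_right)
      finally show ?thesis using z[OF \<pi>s] by simp
    qed
    have "(\<Sum>c<l. v c * cnj (v c)) = (\<Sum>c<l. \<Sum>s<n. cnj (z s) * (v c * cnj (w' s c)))"
      by (simp add: v_def sum_distrib_left mult_ac)
    also have "\<dots> = (\<Sum>s<n. \<Sum>c<l. cnj (z s) * (v c * cnj (w' s c)))" by (rule sum.swap)
    also have "\<dots> = (\<Sum>s<n. cnj (z s) * (\<Sum>c<l. v c * cnj (w' s c)))" by (simp add: sum_distrib_left)
    also have "\<dots> = 0" by (intro sum.neutral ballI) (simp add: inner)
    finally have "of_real (\<Sum>c<l. (norm (v c))\<^sup>2) = (0 :: complex)"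
      by (simp only: of_real_sum complex_norm_square)
    then have "(\<Sum>c<l. (norm (v c))\<^sup>2) = 0" by (simp only: of_real_eq_0_iff)
    then have "(norm (v c))\<^sup>2 = 0" using sum_nonneg_0[of "{..<l}" "\<lambda>c. (norm (v c))\<^sup>2" c] c by simp
    then show "(\<Sum>t<n. z t * w' t c) = 0" by (simp add: v_def)
  qed
  then obtain g where g: "g \<in> complex_orthogonal_group l" "\<And>t. t < n \<Longrightarrow> g *\<^sub>v vec l (u' t) = vec l (w' t)" by blast
  have kl: "k \<le> l" by (simp add: l_def)
  have u'_eq: "u' i = (\<lambda>c. if c < k then column i c else 0)" for i
    by (simp add: u'_def fun_eq_iff)
  have "rotated l g i = vec l (w' i)" if "i < n" for i
    unfolding rotated_def pad_column[OF kl that] u'_eq[symmetric] by (rule g(2)[OF that])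
  then have rot: "rotated l g i $ c = w' i c" if "i < n" "c < l" for i c
    using that by simp
  have "conjugation_closed n (($) a) l (\<lambda>i c. rotated l g i $ c)"
    unfolding conjugation_closed_def
  proof (intro allI impI)
    fix i assume i: "i < n"
    then obtain j where "j < n" "\<forall>c<l. w' j c = cnj (w' i c)" "a $ j = cnj (a $ i)"
      using closed unfolding conjugation_closed_def by blast
    then show "\<exists>j<n. (\<forall>c<l. rotated l g j $ c = cnj (rotated l g i $ c)) \<and> a $ j = cnj (a $ i)"
      using rot i by (intro exI[of _ j]) simp
  qed
  then show ?thesis using g(1) kl by blast
qed

end

subsection \<open>Orthogonal maps preserving reality\<close>

definition trace_sum :: "complex mat \<Rightarrow> complex" where
  "trace_sum A = (\<Sum>i<dim_row A. A $$ (i, i))"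

definition cnj_mat :: "complex mat \<Rightarrow> complex mat" where
  "cnj_mat A = map_mat cnj A"

definition adj :: "complex mat \<Rightarrow> complex mat" where
  "adj A = transpose_mat (cnj_mat A)"

lemma cnj_mat_carrier [simp]: "cnj_mat A \<in> carrier_mat r c \<longleftrightarrow> A \<in> carrier_mat r c"
  by (simp add: cnj_mat_def)

lemma adj_carrier: "A \<in> carrier_mat r c \<Longrightarrow> adj A \<in> carrier_mat c r"
  by (simp add: adj_def)

lemma cnj_mat_mult:
  assumes "A \<in> carrier_mat r n" "B \<in> carrier_mat n c"
  shows "cnj_mat (A * B) = cnj_mat A * cnj_mat B"
  using assms by (intro eq_matI) (auto simp: cnj_mat_def scalar_prod_def)

lemma adj_mult:
  assumes "A \<in> carrier_mat r n" "B \<in> carrier_mat n c"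
  shows "adj (A * B) = adj B * adj A"
  unfolding adj_def cnj_mat_mult[OF assms] using assms by (intro transpose_mult) auto

lemma cnj_mat_adj: "cnj_mat (adj A) = transpose_mat A"
  by (intro eq_matI) (auto simp: cnj_mat_def adj_def)

lemma adj_cnj_mat: "adj (cnj_mat A) = transpose_mat A"
  by (intro eq_matI) (simp_all add: cnj_mat_def adj_def)

lemma adj_transpose: "adj (transpose_mat A) = cnj_mat A"
  by (intro eq_matI) (simp_all add: cnj_mat_def adj_def)

lemma adj_adj: "adj (adj A) = A"
  by (intro eq_matI) (simp_all add: cnj_mat_def adj_def)

lemma trace_mult_comm:
  assumes "A \<in> carrier_mat r c" "B \<in> carrier_mat c r"
  shows "trace_sum (A * B) = trace_sum (B * A)"
proof -
  have "trace_sum (A * B) = (\<Sum>i<r. \<Sum>j<c. A $$ (i, j) * B $$ (j, i))"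
    using assms by (simp add: trace_sum_def scalar_prod_def atLeast0LessThan)
  also have "\<dots> = (\<Sum>j<c. \<Sum>i<r. B $$ (j, i) * A $$ (i, j))"
    by (subst sum.swap) (simp add: mult.commute)
  also have "\<dots> = trace_sum (B * A)"
    using assms by (simp add: trace_sum_def scalar_prod_def atLeast0LessThan)
  finally show ?thesis .
qed

lemma trace_minus:
  assumes "A \<in> carrier_mat l l" "B \<in> carrier_mat l l"
  shows "trace_sum (A - B) = trace_sum A - trace_sum B"
  using assms by (simp add: trace_sum_def sum_subtractf)

lemma trace_mult_adj:
  assumes "M \<in> carrier_mat r c"
  shows "trace_sum (M * adj M) = of_real (\<Sum>i<r. \<Sum>j<c. (norm (M $$ (i, j)))\<^sup>2)"
  using assms
  by (simp only: of_real_sum complex_norm_square)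
    (simp add: trace_sum_def adj_def cnj_mat_def scalar_prod_def atLeast0LessThan)

text \<open>The trace is the squared Hilbert-Schmidt norm of \<open>M\<close>.\<close>

lemma trace_mult_adj_eq_0:
  assumes "M \<in> carrier_mat r c" "trace_sum (M * adj M) = 0"
  shows "M = 0\<^sub>m r c"
proof (rule eq_matI)
  fix i j assume "i < dim_row (0\<^sub>m r c :: complex mat)" "j < dim_col (0\<^sub>m r c :: complex mat)"
  then have ij: "i < r" "j < c" by simp_all
  have "(\<Sum>i<r. \<Sum>j<c. (norm (M $$ (i, j)))\<^sup>2) = 0"
    using assms(2) unfolding trace_mult_adj[OF assms(1)] by (simp only: of_real_eq_0_iff)
  then have "(\<Sum>j<c. (norm (M $$ (i, j)))\<^sup>2) = 0"
    using sum_nonneg_0[of "{..<r}" "\<lambda>i. \<Sum>j<c. (norm (M $$ (i, j)))\<^sup>2" i] ij by (simp add: sum_nonneg)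
  then have "(norm (M $$ (i, j)))\<^sup>2 = 0"
    using sum_nonneg_0[of "{..<c}" "\<lambda>j. (norm (M $$ (i, j)))\<^sup>2" j] ij by simp
  then show "M $$ (i, j) = 0\<^sub>m r c $$ (i, j)" using ij by simp
qed (use assms in auto)

lemma orthogonal_transpose_mult:
  assumes g: "g \<in> complex_orthogonal_group l"
  shows "transpose_mat g * g = 1\<^sub>m l" "g * transpose_mat g = 1\<^sub>m l"
proof -
  have gc: "g \<in> carrier_mat l l" using g by (simp add: complex_orthogonal_group_def)
  have gu: "g *\<^sub>v unit_vec l i = col g i" if "i < l" for i
    using gc that by (intro eq_vecI) auto
  show "transpose_mat g * g = 1\<^sub>m l"
  proof (rule eq_matI)
    fix i j assume "i < dim_row (1\<^sub>m l :: complex mat)" "j < dim_col (1\<^sub>m l :: complex mat)"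
    then have ij: "i < l" "j < l" by simp_all
    have "(transpose_mat g * g) $$ (i, j) = col g i \<bullet> col g j" using gc ij by simp
    also have "\<dots> = unit_vec l i \<bullet> (unit_vec l j :: complex vec)"
      unfolding gu[OF ij(1), symmetric] gu[OF ij(2), symmetric] by (intro orthogonal_scalar_prod[OF g]) auto
    finally show "(transpose_mat g * g) $$ (i, j) = 1\<^sub>m l $$ (i, j)" using ij by simp
  qed (use gc in auto)
  then show "g * transpose_mat g = 1\<^sub>m l"
    using mat_mult_left_right_inverse[of "transpose_mat g" l g] gc by simp
qed

text \<open>The inverse \<open>q\<close> satisfies \<open>q * S * q = S\<close> as well. Of the four
  terms of the product, two equal \<open>S\<close>, and the mixed ones have the trace of
  \<open>S\<close> by cyclicity.\<close>

lemma trace_congruence_difference: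
  assumes p: "p \<in> carrier_mat l l" and q: "q \<in> carrier_mat l l" and S: "S \<in> carrier_mat l l"
    and pq: "p * q = 1\<^sub>m l" "q * p = 1\<^sub>m l" and pSp: "p * S * p = S"
  shows "trace_sum ((p - q) * S * (p - q)) = 0"
proof -
  note assoc = assoc_mult_mat[of _ l l _ l _ l]
  have qSq: "q * S * q = S"
  proof -
    have "q * S * q = q * (p * S * p) * q" using pSp by simp
    also have "\<dots> = (q * p) * (S * (p * q))" using p q S by (simp add: assoc)
    finally show ?thesis using pq S by simp
  qed
  have "(p - q) * S * (p - q) = (p * S * p - q * S * p) - (p * S * q - q * S * q)"
  proof -
    have pS: "p * S \<in> carrier_mat l l" and qS: "q * S \<in> carrier_mat l l" using p q S by simp_all
    have "(p - q) * S * (p - q) = (p * S - q * S) * p - (p * S - q * S) * q"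
      unfolding minus_mult_distrib_mat[OF p q S] by (rule mult_minus_distrib_mat[OF minus_carrier_mat[OF qS] p q])
    then show ?thesis
      unfolding minus_mult_distrib_mat[OF pS qS p] minus_mult_distrib_mat[OF pS qS q] .
  qed
  moreover have "trace_sum (p * S * q) = trace_sum S"
  proof -
    have "trace_sum (p * S * q) = trace_sum (S * q * p)"
      unfolding assoc_mult_mat[OF p S q] by (rule trace_mult_comm[OF p]) (use S q in simp)
    then show ?thesis unfolding assoc_mult_mat[OF S q p] using pq S by simp
  qed
  moreover have "trace_sum (q * S * p) = trace_sum S"
  proof -
    have "trace_sum (q * S * p) = trace_sum (S * p * q)"
      unfolding assoc_mult_mat[OF q S p] by (rule trace_mult_comm[OF q]) (use S p in simp)
    then show ?thesis unfolding assoc_mult_mat[OF S p q] using pq S by simp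
  qed
  ultimately show ?thesis
    using p q S pSp qSq by (simp add: trace_minus[of _ l] minus_carrier_mat)
qed

text \<open>With \<open>p = g\<^sup>* g\<close> the two reality conditions give \<open>p V V\<^sup>* p = V V\<^sup>*\<close>, where
  \<open>p\<close> is positive definite with inverse the complex conjugate of \<open>p\<close>. Hence the Hilbert-Schmidt norm of
  \<open>(p - p\<^sup>-\<^sup>1) V\<close> vanishes, so \<open>p\<^sup>2 V = V\<close> and then \<open>p V = V\<close>.\<close>

lemma orthogonal_acts_as_conjugate:
  assumes g: "g \<in> complex_orthogonal_group l" and V: "V \<in> carrier_mat l n"
    and S: "cnj_mat (V * adj V) = V * adj V"
    and T: "cnj_mat (g * V * adj (g * V)) = g * V * adj (g * V)"
  shows "cnj_mat g * V = g * V"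
proof -
  define S where "S = V * adj V"
  define gt where "gt = transpose_mat g"
  define gb where "gb = cnj_mat g"
  define gh where "gh = adj g"
  define p where "p = gh * g"
  define q where "q = gt * gb"
  have gc: "g \<in> carrier_mat l l" using g by (simp add: complex_orthogonal_group_def)
  have car: "gt \<in> carrier_mat l l" "gb \<in> carrier_mat l l" "gh \<in> carrier_mat l l" "p \<in> carrier_mat l l" "q \<in> carrier_mat l l"
    "S \<in> carrier_mat l l" "adj V \<in> carrier_mat n l"
    using gc V adj_carrier[OF V] adj_carrier[OF gc] by (auto simp: gt_def gb_def gh_def p_def q_def S_def)
  note assoc = assoc_mult_mat[of _ l l _ l _ l]
  note assocV = assoc_mult_mat[of _ l l _ l _ n]
  have inv: "gt * g = 1\<^sub>m l" "g * gt = 1\<^sub>m l"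
    unfolding gt_def by (rule orthogonal_transpose_mult[OF g])+
  have gh: "gh = cnj_mat gt" by (intro eq_matI) (auto simp: gh_def gt_def adj_def cnj_mat_def)
  have one: "cnj_mat (1\<^sub>m l) = 1\<^sub>m l" by (intro eq_matI) (auto simp: cnj_mat_def)
  have inv': "gh * gb = 1\<^sub>m l" "gb * gh = 1\<^sub>m l"
    unfolding gh gb_def cnj_mat_mult[OF car(1) gc, symmetric] cnj_mat_mult[OF gc car(1), symmetric] inv one by simp_all
  have cgh: "cnj_mat gh = gt" unfolding gh_def gt_def by (rule cnj_mat_adj)
  have gS: "g * V * adj (g * V) = g * S * gh"
  proof -
    have "g * V * adj (g * V) = g * V * (adj V * gh)"
      unfolding gh_def adj_mult[OF gc V] ..
    also have "\<dots> = g * (V * adj V) * gh"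
      using gc V car by (simp add: assoc_mult_mat[of _ l l _ n _ l] assoc_mult_mat[of _ l n _ l _ l] assoc)
    finally show ?thesis by (simp add: S_def)
  qed
  \<comment> \<open>The left side and \<open>S\<close> are both real, so conjugating the outer
    factors changes nothing.\<close>
  have gSgh: "g * S * gh = gb * S * gt"
  proof -
    have "g * S * gh = cnj_mat (g * S * gh)" using T unfolding gS by simp
    also have "\<dots> = cnj_mat (g * S) * cnj_mat gh" by (rule cnj_mat_mult) (use gc car in auto)
    also have "cnj_mat (g * S) = cnj_mat g * cnj_mat S" by (rule cnj_mat_mult[OF gc car(6)])
    also have "cnj_mat S = S" using S by (simp add: S_def)
    finally show ?thesis by (simp add: cgh gb_def)
  qed
  have pSp: "p * S * p = S"
  proof -
    have "p * S * p = gh * (g * S * gh) * g" using gc car by (simp add: p_def assoc)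
    also have "\<dots> = (gh * gb) * S * (gt * g)" unfolding gSgh using gc car by (simp add: assoc)
    finally show ?thesis using inv inv' car by simp
  qed
  have pq: "p * q = 1\<^sub>m l"
  proof -
    have "p * q = gh * ((g * gt) * gb)" using gc car by (simp add: p_def q_def assoc)
    then show ?thesis using inv inv' car by simp
  qed
  have qp: "q * p = 1\<^sub>m l"
  proof -
    have "q * p = gt * ((gb * gh) * g)" using gc car by (simp add: p_def q_def assoc)
    then show ?thesis using inv inv' gc car by simp
  qed
  have hp: "adj p = p"
  proof -
    have "adj gh = g" unfolding gh_def by (rule adj_adj)
    then show ?thesis unfolding p_def adj_mult[OF car(3) gc] by (simp add: gh_def)
  qed
  have hq: "adj q = q"
  proof -
    have "adj gb = gt" "adj gt = gb" unfolding gb_def gt_def by (rule adj_cnj_mat adj_transpose)+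
    then show ?thesis unfolding q_def adj_mult[OF car(1,2)] by simp
  qed
  have hd: "adj (p - q) = p - q"
  proof -
    have "adj (p - q) = adj p - adj q" using car(4,5) by (intro eq_matI) (simp_all add: adj_def cnj_mat_def)
    then show ?thesis by (simp add: hp hq)
  qed
  have pmq: "p - q \<in> carrier_mat l l" using car by auto
  have "(p - q) * V = 0\<^sub>m l n"
  proof (rule trace_mult_adj_eq_0)
    have "(p - q) * V * adj ((p - q) * V) = (p - q) * V * (adj V * (p - q))"
      unfolding adj_mult[OF pmq V] hd ..
    also have "\<dots> = (p - q) * S * (p - q)"
      using pmq V car by (simp add: S_def assoc_mult_mat[of _ l l _ n _ l] assoc_mult_mat[of _ l n _ l _ l] assoc)
    finally show "trace_sum ((p - q) * V * adj ((p - q) * V)) = 0"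
      using trace_congruence_difference[OF car(4,5,6) pq qp pSp] by simp
  qed (use pmq V in auto)
  then have pVqV: "p * V - q * V = 0\<^sub>m l n"
    using minus_mult_distrib_mat[OF car(4,5) V] by simp
  have ppV: "p * V = q * V"
  proof (rule eq_matI)
    fix i j assume "i < dim_row (q * V)" "j < dim_col (q * V)"
    then have ij: "i < l" "j < n" using car V by auto
    have "(p * V) $$ (i, j) - (q * V) $$ (i, j) = (p * V - q * V) $$ (i, j)"
      by (rule index_minus_mat(1)[symmetric]) (use ij car V in simp_all)
    also have "\<dots> = 0" unfolding pVqV using ij by simp
    finally show "(p * V) $$ (i, j) = (q * V) $$ (i, j)" by (rule eq_iff_diff_eq_0[THEN iffD2])
  qed (use car V in auto)
  have V2: "p * (p * V) = V"
  proof -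
    have "p * (p * V) = (p * q) * V" unfolding ppV using car V by (simp add: assocV)
    then show ?thesis using pq V by simp
  qed
  \<comment> \<open>As \<open>p * p\<close> fixes \<open>V\<close>, \<open>p\<close> maps
    \<open>E\<close> to \<open>- E\<close>. Since \<open>p = gh * g\<close> is positive, the squared
    norms of \<open>g * E\<close> and \<open>E\<close> add up to 0.\<close>
  define E where "E = p * V - V"
  have E: "E \<in> carrier_mat l n" unfolding E_def by (rule minus_carrier_mat[OF V])
  have pE: "p * E = V - p * V"
    unfolding E_def using car V V2 by (simp add: mult_minus_distrib_mat[of _ l l _ n])
  have "E = 0\<^sub>m l n"
  proof (rule trace_mult_adj_eq_0[OF E])
    have gE: "g * E \<in> carrier_mat l n" using gc E by simp
    have aE: "adj E \<in> carrier_mat n l" by (rule adj_carrier[OF E])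
    have "trace_sum (g * E * adj (g * E)) = trace_sum (adj (g * E) * (g * E))"
      by (rule trace_mult_comm[OF gE adj_carrier[OF gE]])
    also have "adj (g * E) * (g * E) = adj E * (p * E)"
      unfolding adj_mult[OF gc E] p_def gh_def[symmetric] using gc E aE car
      by (simp add: assoc_mult_mat[of _ n l _ l _ n] assoc_mult_mat[of _ l l _ l _ n])
    also have "trace_sum \<dots> = trace_sum (p * E * adj E)"
      using trace_mult_comm[of "adj E" n l "p * E"] aE E car by simp
    also have "p * E = - E"
    proof -
      have "- E = V - p * V" unfolding E_def by (intro eq_matI) (use car V in auto)
      then show ?thesis using pE by simp
    qed
    also have "trace_sum (- E * adj E) = - trace_sum (E * adj E)"
    proof -
      have "- E * adj E = - (E * adj E)" by (rule uminus_mult_left_mat) (use E aE in simp)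
      then show ?thesis using E aE by (simp add: trace_sum_def sum_negf)
    qed
    finally have "trace_sum (g * E * adj (g * E)) + trace_sum (E * adj E) = 0" by simp
    then have "of_real ((\<Sum>i<l. \<Sum>j<n. (norm ((g * E) $$ (i, j)))\<^sup>2) + (\<Sum>i<l. \<Sum>j<n. (norm (E $$ (i, j)))\<^sup>2)) = (0 :: complex)"
      unfolding trace_mult_adj[OF gE] trace_mult_adj[OF E] by (simp only: of_real_add)
    then have sum0: "(\<Sum>i<l. \<Sum>j<n. (norm ((g * E) $$ (i, j)))\<^sup>2) + (\<Sum>i<l. \<Sum>j<n. (norm (E $$ (i, j)))\<^sup>2) = 0"
      by (simp only: of_real_eq_0_iff)
    have "(\<Sum>i<l. \<Sum>j<n. (norm ((g * E) $$ (i, j)))\<^sup>2) \<ge> 0" "(\<Sum>i<l. \<Sum>j<n. (norm (E $$ (i, j)))\<^sup>2) \<ge> 0"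
      by (intro sum_nonneg zero_le_power2)+
    then have "(\<Sum>i<l. \<Sum>j<n. (norm (E $$ (i, j)))\<^sup>2) = 0" using sum0 by linarith
    then show "trace_sum (E * adj E) = 0" unfolding trace_mult_adj[OF E] by (simp only: of_real_0)
  qed
  then have pV: "p * V = V"
  proof -
    have "p * V = E + V" using car V by (intro eq_matI) (auto simp: E_def)
    then show ?thesis using \<open>E = 0\<^sub>m l n\<close> V by simp
  qed
  have "gb * V = gb * (p * V)" using pV by simp
  also have "\<dots> = (gb * gh) * (g * V)" using gc car V by (simp add: p_def assocV)
  also have "\<dots> = g * V" using inv' gc V by simp
  finally show ?thesis by (simp add: gb_def)
qed

context factored_vertex_model
begin

lemma rotated_one: "i < n \<Longrightarrow> c < k \<Longrightarrow> rotated k (1\<^sub>m k) i $ c = column i c"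
  by (simp add: rotated_def pad_column)

text \<open>\<open>V * adj V\<close> is real by hypothesis, and so is the same product for
  \<open>g * V\<close>, whose columns are permuted by conjugation. Hence \<open>g\<close> and its
  conjugate act alike on the columns of \<open>V\<close>, and the permutation found for the rotated
  columns serves for the original ones.\<close>

lemma identity_rotation_if_real:
  assumes real: "real_mat (U * mat_adjoint U)" and "k \<le> l" and g: "g \<in> complex_orthogonal_group l"
    and closed: "conjugation_closed n (($) a) l (\<lambda>i c. rotated l g i $ c)"
  shows "conjugation_closed n (($) a) k (\<lambda>i c. rotated k (1\<^sub>m k) i $ c)"
proof -
  have gc: "g \<in> carrier_mat l l" using g by (simp add: complex_orthogonal_group_def)
  define V where "V = mat l n (\<lambda>(c, i). if c < k then column i c else 0)"
  have V: "V \<in> carrier_mat l n" by (simp add: V_def)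
  have colV: "col V i = pad_vec l (col U i)" if "i < n" for i
    using that by (simp add: pad_column[OF assms(2)] V_def)
  have rot: "(g * V) $$ (c, i) = rotated l g i $ c" if "c < l" "i < n" for c i
    using that gc V colV by (simp add: rotated_def)
  obtain \<pi> where \<pi>: "bij_betw \<pi> {..<n} {..<n}"
    "\<And>i c. i < n \<Longrightarrow> c < l \<Longrightarrow> rotated l g (\<pi> i) $ c = cnj (rotated l g i $ c)" "\<And>i. i < n \<Longrightarrow> a $ \<pi> i = cnj (a $ i)"
    using closed by (rule conjugation_permutation) (use distinct_points[OF gram_rotated[OF assms(2) g]] in blast)+
  have \<pi>n: "\<pi> i < n" if "i < n" for i using \<pi>(1) that by (auto simp: bij_betw_def)
  have entry: "(M * adj M) $$ (c, d) = (\<Sum>i<n. M $$ (c, i) * cnj (M $$ (d, i)))"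
    if "M \<in> carrier_mat r n" "c < r" "d < r" for M r c d
    using that by (simp add: adj_def cnj_mat_def scalar_prod_def atLeast0LessThan)
  have S: "cnj_mat (V * adj V) = V * adj V"
  proof (rule eq_matI)
    fix c d assume "c < dim_row (V * adj V)" "d < dim_col (V * adj V)"
    then have cd: "c < l" "d < l" using V by (auto simp: adj_def cnj_mat_def)
    have "(V * adj V) $$ (c, d) \<in> \<real>"
    proof (cases "c < k \<and> d < k")
      case True
      then have "(V * adj V) $$ (c, d) = (\<Sum>i<n. U $$ (c, i) * cnj (U $$ (d, i)))"
        unfolding entry[OF V cd] using cd by (simp add: V_def column_def)
      also have "\<dots> = (U * mat_adjoint U) $$ (c, d)"
        using True U by (simp add: mat_adjoint_def scalar_prod_def atLeast0LessThan mat_of_rows_def)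
      also have "\<dots> \<in> \<real>"
      proof -
        have "mat_adjoint U \<in> carrier_mat n k"
          by (intro carrier_matI) (use U in \<open>simp_all add: mat_adjoint_def\<close>)
        then have "U * mat_adjoint U \<in> carrier_mat k k" using U by simp
        from elements_matI[OF this _ _ refl]
        have "(U * mat_adjoint U) $$ (c, d) \<in> elements_mat (U * mat_adjoint U)"
          using True by blast
        then show ?thesis using real unfolding real_mat_def by blast
      qed
      finally show ?thesis .
    next
      case False
      have "(V * adj V) $$ (c, d) = 0"
        unfolding entry[OF V cd] using False cd by (intro sum.neutral) (auto simp: V_def)
      then show ?thesis by simp
    qed
    moreover have "cnj_mat (V * adj V) $$ (c, d) = cnj ((V * adj V) $$ (c, d))"
      using cd V by (simp add: cnj_mat_def adj_def)
    ultimately show "cnj_mat (V * adj V) $$ (c, d) = (V * adj V) $$ (c, d)"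
      by (simp add: Reals_cnj_iff)
  qed (auto simp: cnj_mat_def)
  have W: "g * V \<in> carrier_mat l n" using gc V by simp
  have T: "cnj_mat (g * V * adj (g * V)) = g * V * adj (g * V)"
  proof (rule eq_matI)
    fix c d assume "c < dim_row (g * V * adj (g * V))" "d < dim_col (g * V * adj (g * V))"
    then have cd: "c < l" "d < l" using gc by (auto simp: adj_def cnj_mat_def)
    have "cnj_mat (g * V * adj (g * V)) $$ (c, d) = cnj ((g * V * adj (g * V)) $$ (c, d))"
      using cd gc by (simp add: cnj_mat_def adj_def)
    also have "\<dots> = (\<Sum>i<n. cnj (rotated l g i $ c) * rotated l g i $ d)"
      using cd by (simp add: entry[OF W cd] rot)
    also have "\<dots> = (\<Sum>i<n. rotated l g (\<pi> i) $ c * cnj (rotated l g (\<pi> i) $ d))"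
      using cd by (simp add: \<pi>(2))
    also have "\<dots> = (\<Sum>i<n. rotated l g i $ c * cnj (rotated l g i $ d))"
      by (rule sum.reindex_bij_betw[OF \<pi>(1), where g = "\<lambda>i. rotated l g i $ c * cnj (rotated l g i $ d)"])
    also have "\<dots> = (g * V * adj (g * V)) $$ (c, d)"
      using cd by (simp add: entry[OF W cd] rot)
    finally show "cnj_mat (g * V * adj (g * V)) $$ (c, d) = (g * V * adj (g * V)) $$ (c, d)" .
  qed (auto simp: cnj_mat_def)
  have gV: "cnj_mat g * V = g * V" by (rule orthogonal_acts_as_conjugate[OF g V S T])
  have column_\<pi>: "column (\<pi> i) c = cnj (column i c)" if i: "i < n" and c: "c < k" for i c
  proof -
    let ?v = "vec l (\<lambda>c. cnj (V $$ (c, i)))"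
    have v: "?v \<in> carrier_vec l" by simp
    \<comment> \<open>The conjugate of \<open>g\<close> times column \<open>i\<close> is
      \<open>g\<close> times the conjugate column, because \<open>g\<close> may be replaced by its
      conjugate before conjugating.\<close>
    have "g *\<^sub>v col V (\<pi> i) = g *\<^sub>v ?v"
    proof (rule eq_vecI)
      fix d assume "d < dim_vec (g *\<^sub>v ?v)"
      then have d: "d < l" using gc by simp
      have "(g *\<^sub>v col V (\<pi> i)) $ d = cnj ((g * V) $$ (d, i))"
        using \<pi>(2)[OF i d] rot[OF d i] colV[OF \<pi>n[OF i]] by (simp add: rotated_def)
      also have "\<dots> = cnj ((cnj_mat g * V) $$ (d, i))" by (simp add: gV)
      also have "\<dots> = (g *\<^sub>v ?v) $ d"
        using gc V d i by (simp add: cnj_mat_def scalar_prod_def)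
      finally show "(g *\<^sub>v col V (\<pi> i)) $ d = (g *\<^sub>v ?v) $ d" .
    qed (use gc in auto)
    then have eq: "transpose_mat g *\<^sub>v (g *\<^sub>v col V (\<pi> i)) = transpose_mat g *\<^sub>v (g *\<^sub>v ?v)" by simp
    have cancel: "transpose_mat g *\<^sub>v (g *\<^sub>v x) = x" if "x \<in> carrier_vec l" for x
      using assoc_mult_mat_vec[of "transpose_mat g" l l g l x] gc that orthogonal_transpose_mult(1)[OF g] by simp
    have "col V (\<pi> i) \<in> carrier_vec l" using V \<pi>n[OF i] by auto
    then have "col V (\<pi> i) = ?v" using eq cancel v by simp
    then have "col V (\<pi> i) $ c = ?v $ c" by simp
    then show ?thesis using i c assms(2) \<pi>n[OF i] by (simp add: V_def)
  qed
  show ?thesis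
    unfolding conjugation_closed_def
  proof (intro allI impI)
    fix i assume i: "i < n"
    have "rotated k (1\<^sub>m k) (\<pi> i) $ c = cnj (rotated k (1\<^sub>m k) i $ c)" if "c < k" for c
      using column_\<pi>[OF i that] by (simp add: rotated_one that i \<pi>n)
    then show "\<exists>j<n. (\<forall>c<k. rotated k (1\<^sub>m k) j $ c = cnj (rotated k (1\<^sub>m k) i $ c)) \<and> a $ j = cnj (a $ i)"
      using \<pi>(3)[OF i] \<pi>n[OF i] by blast
  qed
qed

end

theorem theorem1:
  fixes n k :: nat and a :: "complex vec" and B U :: "complex mat"
  assumes "vertex_coloring_model n a B"
    and "twin_free n a B"
    and "U \<in> carrier_mat k n"
    and "nondegenerate_mat U"
    and "transpose_mat U * U = B"
  defines "cond_i \<equiv> \<exists>m y. real_edge_coloring_model m y \<and>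
      (\<forall>G\<in>finite_graphs. vertex_partition_function n a B G = edge_partition_function m y G)"
    and "cond_ii \<equiv> \<lambda>l g. closed_under_conjugation (extended_columns n a U l g)"
    and "cond_iii \<equiv> \<lambda>l g. real_edge_coloring_model l (evaluation_model n a U l g)"
  shows "(cond_i \<longleftrightarrow> (\<exists>l\<ge>k. \<exists>g\<in>complex_orthogonal_group l. cond_ii l g)) \<and>
    ((\<exists>l\<ge>k. \<exists>g\<in>complex_orthogonal_group l. cond_ii l g) \<longleftrightarrow>
     (\<exists>l\<ge>k. \<exists>g\<in>complex_orthogonal_group l. cond_iii l g)) \<and>
    (real_mat (U * mat_adjoint U) \<longrightarrow>
      (cond_i \<longleftrightarrow> cond_ii k (1\<^sub>m k)) \<and> (cond_i \<longleftrightarrow> cond_iii k (1\<^sub>m k)))"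
proof -
  interpret factored_vertex_model n k a B U
    using assms(1-5) by unfold_locales
  \<comment> \<open>Conditions (ii) and (iii) at the same \<open>l\<close> and \<open>g\<close> both
    reduce to this property.\<close>
  define closed where "closed l g \<longleftrightarrow> conjugation_closed n (($) a) l (\<lambda>i c. rotated l g i $ c)" for l g
  have ii: "cond_ii l g \<longleftrightarrow> closed l g" if "k \<le> l" "g \<in> complex_orthogonal_group l" for l g
    unfolding cond_ii_def closed_def by (rule closed_iff[OF that])
  have iii: "cond_iii l g \<longleftrightarrow> closed l g" if "k \<le> l" "g \<in> complex_orthogonal_group l" for l g
    unfolding cond_iii_def closed_def by (rule real_iff[OF that])
  have iii_i: cond_i if "k \<le> l" "g \<in> complex_orthogonal_group l" "closed l g" for l g
    unfolding cond_i_def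
    using iii[OF that(1,2)] that(3) partition_function_evaluation_model[OF that(1,2)] unfolding cond_iii_def by blast
  have i_ii: "\<exists>l\<ge>k. \<exists>g\<in>complex_orthogonal_group l. closed l g" if cond_i
    using that edge_model_imp_rotation unfolding cond_i_def closed_def by blast
  have id: "closed k (1\<^sub>m k)" if "real_mat (U * mat_adjoint U)" "k \<le> l" "g \<in> complex_orthogonal_group l" "closed l g" for l g
    using identity_rotation_if_real[OF that(1-3)] that(4) unfolding closed_def by blast
  show ?thesis
    using ii iii iii_i i_ii id orthogonal_one[of k] by blast
qed

end
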